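(* Let $N\ge 3$, let $K\subset\mathbb{R}^N$ be a compact set which is Ahlfors–David regular of dimension $N-2$, let $\omega$ be a modulus of continuity satisfying the integral condition stated in the context, let $r\ge 1$ be an integer, and let $\mathcal{L}u=-\nabla\cdot(a(x)\nabla u)$ be a formally self-adjoint second-order elliptic operator in $\Omega\supset K$ whose coefficients belong to $C^{k_0+3}(\Omega)$ for a certain integer $0\le k_0\le r$. Let the function $f$, defined on $K$, belong to the class $\mathcal{H}^{r+\omega}_{\mathcal{L}}(K)$, and let $v_\delta$, $0<\delta<\frac14\operatorname{diam}(K)$, be its approximation, that is, functions on $K_\delta$ such that, with a constant not depending on $\delta$ (denoted $c_0$), $\mathcal{L}v_\delta=0$ in $K_\delta$; $|v_\delta(x)-f(x)|\le c_0\,\delta^{r}\omega(\delta)$ for $x\in K$; and $|v_\delta(y)-v_{\delta/2}(y)|\le c_0\,\delta^{r}\omega(\delta)$ for $y\in K_{\delta/2}$. Then the derivatives of $v_\delta$ satisfy $$\|\nabla^{k_0+1}v_\delta\|_{C(K_{\delta/2})}\le c\,\frac{\omega(\delta)}{\delta}.$$ Moreover, surrogate derivatives $f_{(\alpha)}(x)$, $x\in K$, can be defined so that $$|f_{(\alpha)}(x)-\partial^\alpha v_\delta(x)|\le C\,\delta^{r-|\alpha|}\omega(\delta),\qquad x\in K,\quad 1\le|\alpha|\le k_0 .$$ Here the constants $c,C$ and the functions $f_{(\alpha)}$ do not depend on $\delta$.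
   Context: Notation: $B_\rho(x)$ is the open ball in $\mathbb{R}^N$ with center $x$ and radius $\rho$; $K_\delta$ is the $\delta$-neighborhood of $K$; $\nabla^k v$ is the collection of all partial derivatives of $v$ of order $k$; $\|\cdot\|_{C(K_{\delta/2})}$ is the supremum norm over $K_{\delta/2}$. Ahlfors–David regularity: a compact set $K$ is AD regular of dimension $\varkappa$ if there are constants $0<c'<c''<\infty$ such that $c'\rho^{\varkappa}\le\mu_\varkappa(K\cap B_\rho(x))\le c''\rho^{\varkappa}$ for all $x\in K$ and all $\rho\le\operatorname{diam}(K)$, where $\mu_\varkappa$ is the $\varkappa$-dimensional Hausdorff measure. Modulus of continuity: $\omega(t)$, $t>0$, is a modulus of continuity such that, for some constant $c$, $$\int_0^{\tau}\frac{\omega(t)}{t}\,dt+\tau\int_\tau^\infty\frac{\omega(t)}{t^2}\,dt\le c\,\omega(\tau),\qquad 0<\tau<\infty .$$ Operator: $\Omega\supset K$ is a bounded open connected set in $\mathbb{R}^N$, on which the formally self-adjoint elliptic operator $\mathcal{L}u=-\sum_{j,j'}\partial_j(a_{jj'}(x)\partial_{j'}u)$, $a(x)=(a_{jj'}(x))_{j,j'\le N}$, is defined. The class $\mathcal{H}^{r+\omega}_{\mathcal{L}}(K)$: a continuous function $f$ on $K$ belongs to $\mathcal{H}^{r+\omega}_{\mathcal{L}}(K)$ if there exist constants $c_1=c_1(f)$, $c_2=c_2(f)$ such that for any $x\in K$ and any $\delta$ with $0<\delta\le 2\operatorname{diam}(K)$ there exists a function $\Phi_{x,\delta}$ defined in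 $B_\delta(x)$ with (i) $\mathcal{L}\Phi_{x,\delta}=0$ in $B_\delta(x)$; (ii) $|f(y)-\Phi_{x,\delta}(y)|\le c_1\delta^{r}\omega(\delta)$ for $y\in B_\delta(x)\cap K$; (iii) for some constants $\gamma_1,\gamma_2$ with $\frac18\le\gamma_1\le1\le\gamma_2\le8$: if $\gamma_1\delta_1\le\delta_2\le\gamma_2\delta_1$ and $x_1,x_2\in K$ are any points such that the balls $B_{\delta_1}(x_1)$, $B_{\delta_2}(x_2)$ are not disjoint, then $|\Phi_{x_1,\delta_1}(y)-\Phi_{x_2,\delta_2}(y)|\le c_2\,\delta_1^{r}\omega(\delta_1)$ for all $y\in B_{\delta_1}(x_1)\cap B_{\delta_2}(x_2)$.
   Formalization: The claim over all δ fails since only δ and δ/2 are linked; it is proved along each sequence δ₀/2ⁿ (constants may depend on δ₀), or for all δ<diam(K)/4 if also |v_δ−v_δ'|≤cδ^rω(δ) on K_δ' for δ/2≤δ'≤δ. *)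

theory Defs
  imports "HOL-Analysis.Analysis"
begin

section \<open>Hausdorff measure and Ahlfors--David regularity\<close>

text \<open>
  The s-dimensional Hausdorff measure without normalising factor, for s > 0 only: at s = 0 the
  convention \<open>0 powr 0 = 0\<close> would give singletons measure zero. Boundedness of the covering sets
  is required because \<^const>\<open>diameter\<close> is meaningless on unbounded sets.
\<close>

definition hausdorff_content :: "real \<Rightarrow> real \<Rightarrow> 'a::metric_space set \<Rightarrow> ennreal" where
  "hausdorff_content s d A =
     (INF U \<in> {U :: nat \<Rightarrow> 'a set. A \<subseteq> (\<Union>i. U i) \<and> (\<forall>i. bounded (U i) \<and> diameter (U i) \<le> d)}.
        \<Sum>i. ennreal (diameter (U i) powr s))"

definition hausdorff_measure :: "real \<Rightarrow> 'a::metric_space set \<Rightarrow> ennreal" where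
  "hausdorff_measure s A = (SUP d \<in> {0<..}. hausdorff_content s d A)"

definition AD_regular :: "real \<Rightarrow> 'a::metric_space set \<Rightarrow> bool" where
  "AD_regular s K \<longleftrightarrow> compact K \<and>
     (\<exists>c' c''. 0 < c' \<and> c' < c'' \<and>
        (\<forall>x\<in>K. \<forall>\<rho>. 0 < \<rho> \<and> \<rho> \<le> diameter K \<longrightarrow>
           ennreal (c' * \<rho> powr s) \<le> hausdorff_measure s (K \<inter> ball x \<rho>) \<and>
           hausdorff_measure s (K \<inter> ball x \<rho>) \<le> ennreal (c'' * \<rho> powr s)))"

definition nbhd :: "'a::metric_space set \<Rightarrow> real \<Rightarrow> 'a set" where
  "nbhd K \<delta> = (\<Union>x\<in>K. ball x \<delta>)"

section \<open>Moduli of continuity\<close>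

definition modulus_of_continuity :: "(real \<Rightarrow> real) \<Rightarrow> bool" where
  "modulus_of_continuity \<omega> \<longleftrightarrow>
     (\<forall>t>0. 0 < \<omega> t) \<and> mono_on {0<..} \<omega> \<and> (\<omega> \<longlongrightarrow> 0) (at_right 0)"

text \<open>The integrals are taken in \<^typ>\<open>ennreal\<close>, so the bound includes their convergence.\<close>

definition modulus_integral_condition :: "(real \<Rightarrow> real) \<Rightarrow> bool" where
  "modulus_integral_condition \<omega> \<longleftrightarrow>
     (\<exists>c. \<forall>\<tau>>0.
        (\<integral>\<^sup>+t\<in>{0<..<\<tau>}. ennreal (\<omega> t / t) \<partial>lborel)
        + ennreal \<tau> * (\<integral>\<^sup>+t\<in>{\<tau><..}. ennreal (\<omega> t / t^2) \<partial>lborel) \<le> ennreal (c * \<omega> \<tau>))"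

section \<open>Partial derivatives\<close>

definition pderiv_dir :: "'n::finite \<Rightarrow> (real^'n \<Rightarrow> real) \<Rightarrow> real^'n \<Rightarrow> real" where
  "pderiv_dir j f x = frechet_derivative f (at x) (axis j 1)"

text \<open>The class \<open>C\<^sup>k(U)\<close> for open \<open>U\<close>.\<close>

fun Ck_on :: "nat \<Rightarrow> (real^'n::finite \<Rightarrow> real) \<Rightarrow> (real^'n) set \<Rightarrow> bool" where
  "Ck_on 0 f U \<longleftrightarrow> continuous_on U f"
| "Ck_on (Suc k) f U \<longleftrightarrow> (\<forall>x\<in>U. f differentiable (at x)) \<and> (\<forall>j. Ck_on k (pderiv_dir j f) U)"

definition mi_order :: "('n::finite \<Rightarrow> nat) \<Rightarrow> nat" where
  "mi_order \<alpha> = (\<Sum>j\<in>UNIV. \<alpha> j)"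

text \<open>
  The derivative \<open>\<partial>\<^sup>\<alpha>\<close> is the composition of first-order ones along a list in which each index j
  occurs \<open>\<alpha> j\<close> times. The index type carries no order, hence the choice; for functions of class
  \<open>C\<^sup>k\<close> with \<open>k \<ge> |\<alpha>|\<close> the result does not depend on it.
\<close>

definition mi_deriv :: "('n::finite \<Rightarrow> nat) \<Rightarrow> (real^'n \<Rightarrow> real) \<Rightarrow> real^'n \<Rightarrow> real" where
  "mi_deriv \<alpha> f = foldr pderiv_dir (SOME js. \<forall>j. count_list js j = \<alpha> j) f"

text \<open>The norm of \<open>\<nabla>\<^sup>k u\<close> in \<open>C(U)\<close>; extended real so that it is meaningful when unbounded.\<close>

definition nabla_sup_norm :: "nat \<Rightarrow> (real^'n::finite) set \<Rightarrow> (real^'n \<Rightarrow> real) \<Rightarrow> ereal" where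
  "nabla_sup_norm k U u = (SUP y\<in>U. SUP \<alpha>\<in>{\<alpha>. mi_order \<alpha> = k}. ereal \<bar>mi_deriv \<alpha> u y\<bar>)"

section \<open>The elliptic operator and its solutions\<close>

definition elliptic_operator ::
    "nat \<Rightarrow> (real^'n::finite \<Rightarrow> real^'n^'n) \<Rightarrow> (real^'n) set \<Rightarrow> bool" where
  "elliptic_operator m a \<Omega> \<longleftrightarrow>
     (\<forall>i j. Ck_on m (\<lambda>x. a x $ i $ j) \<Omega>) \<and>
     (\<forall>x\<in>\<Omega>. transpose (a x) = a x) \<and>
     (\<forall>x\<in>\<Omega>. \<forall>\<xi>. \<xi> \<noteq> 0 \<longrightarrow> 0 < \<xi> \<bullet> (a x *v \<xi>))"

definition L_op :: "(real^'n::finite \<Rightarrow> real^'n^'n) \<Rightarrow> (real^'n \<Rightarrow> real) \<Rightarrow> real^'n \<Rightarrow> real" where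
  "L_op a u x = - (\<Sum>i\<in>UNIV. \<Sum>j\<in>UNIV. pderiv_dir i (\<lambda>y. a y $ i $ j * pderiv_dir j u y) x)"

text \<open>
  Classical solutions. The operator lives on \<open>\<Omega>\<close> only, so the equation makes sense in U only
  for \<open>U \<subseteq> \<Omega>\<close>.
\<close>

definition L_solution ::
    "(real^'n::finite \<Rightarrow> real^'n^'n) \<Rightarrow> (real^'n) set \<Rightarrow> (real^'n) set \<Rightarrow> (real^'n \<Rightarrow> real) \<Rightarrow> bool" where
  "L_solution a \<Omega> U u \<longleftrightarrow> U \<subseteq> \<Omega> \<and> Ck_on 2 u U \<and> (\<forall>x\<in>U. L_op a u x = 0)"

section \<open>The class of functions and their approximations\<close>

definition H_class ::
    "(real^'n::finite \<Rightarrow> real^'n^'n) \<Rightarrow> (real^'n) set \<Rightarrow> nat \<Rightarrow> (real \<Rightarrow> real) \<Rightarrow> (real^'n) set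
       \<Rightarrow> (real^'n \<Rightarrow> real) set" where
  "H_class a \<Omega> r \<omega> K = {f. continuous_on K f \<and>
     (\<exists>c\<^sub>1 c\<^sub>2 \<gamma>\<^sub>1 \<gamma>\<^sub>2. \<exists>\<Phi> :: real^'n \<Rightarrow> real \<Rightarrow> real^'n \<Rightarrow> real.
        1/8 \<le> \<gamma>\<^sub>1 \<and> \<gamma>\<^sub>1 \<le> 1 \<and> 1 \<le> \<gamma>\<^sub>2 \<and> \<gamma>\<^sub>2 \<le> 8 \<and>
        (\<forall>x\<in>K. \<forall>\<delta>\<in>{0<..2 * diameter K}.
           L_solution a \<Omega> (ball x \<delta>) (\<Phi> x \<delta>) \<and>
           (\<forall>y \<in> ball x \<delta> \<inter> K. \<bar>f y - \<Phi> x \<delta> y\<bar> \<le> c\<^sub>1 * \<delta>^r * \<omega> \<delta>)) \<and>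
        (\<forall>x\<^sub>1\<in>K. \<forall>x\<^sub>2\<in>K. \<forall>\<delta>\<^sub>1\<in>{0<..2 * diameter K}. \<forall>\<delta>\<^sub>2\<in>{0<..2 * diameter K}.
           \<gamma>\<^sub>1 * \<delta>\<^sub>1 \<le> \<delta>\<^sub>2 \<and> \<delta>\<^sub>2 \<le> \<gamma>\<^sub>2 * \<delta>\<^sub>1 \<and> ball x\<^sub>1 \<delta>\<^sub>1 \<inter> ball x\<^sub>2 \<delta>\<^sub>2 \<noteq> {} \<longrightarrow>
           (\<forall>y \<in> ball x\<^sub>1 \<delta>\<^sub>1 \<inter> ball x\<^sub>2 \<delta>\<^sub>2. \<bar>\<Phi> x\<^sub>1 \<delta>\<^sub>1 y - \<Phi> x\<^sub>2 \<delta>\<^sub>2 y\<bar> \<le> c\<^sub>2 * \<delta>\<^sub>1^r * \<omega> \<delta>\<^sub>1)))}"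

definition approximating_family ::
    "(real^'n::finite \<Rightarrow> real^'n^'n) \<Rightarrow> (real^'n) set \<Rightarrow> nat \<Rightarrow> (real \<Rightarrow> real) \<Rightarrow> (real^'n) set
       \<Rightarrow> (real^'n \<Rightarrow> real) \<Rightarrow> real set \<Rightarrow> (real \<Rightarrow> real^'n \<Rightarrow> real) \<Rightarrow> bool" where
  "approximating_family a \<Omega> r \<omega> K f S v \<longleftrightarrow>
     (\<exists>c\<^sub>0. \<forall>\<delta>\<in>S.
        L_solution a \<Omega> (nbhd K \<delta>) (v \<delta>) \<and>
        (\<forall>x\<in>K. \<bar>v \<delta> x - f x\<bar> \<le> c\<^sub>0 * \<delta>^r * \<omega> \<delta>) \<and>
        (\<forall>y\<in>nbhd K (\<delta>/2). \<bar>v \<delta> y - v (\<delta>/2) y\<bar> \<le> c\<^sub>0 * \<delta>^r * \<omega> \<delta>))"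

text \<open>
  The condition relating \<open>v \<delta>\<close> to \<open>v (\<delta>/2)\<close> does not relate two scales whose quotient is not a
  power of 2. If K lies in the hyperplane \<open>x\<^sub>1 = 0\<close>, \<open>L = - \<Delta>\<close> and \<open>f = 0\<close>, then
  \<open>v \<delta> x = M \<delta> * x\<^sub>1\<close> with \<open>M \<delta> = M (\<delta>/2)\<close> is an approximating family at all scales, for
  arbitrary, even unbounded, values of M on \<open>[s, 2 * s)\<close>; no constant then bounds the gradients
  of all \<open>v \<delta>\<close>. Constants independent of \<open>\<delta>\<close> exist along every sequence \<open>\<delta>\<^sub>0 / 2^n\<close>, and for all
  scales at once if comparable scales are related too, as follows.
\<close>

definition comparable_scales ::
    "nat \<Rightarrow> (real \<Rightarrow> real) \<Rightarrow> (real^'n::finite) set \<Rightarrow> (real \<Rightarrow> real^'n \<Rightarrow> real) \<Rightarrow> bool" where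
  "comparable_scales r \<omega> K v \<longleftrightarrow>
     (\<exists>c. \<forall>\<delta> \<delta>'. 0 < \<delta> \<and> \<delta> < diameter K / 4 \<and> \<delta>/2 \<le> \<delta>' \<and> \<delta>' \<le> \<delta> \<longrightarrow>
        (\<forall>y\<in>nbhd K \<delta>'. \<bar>v \<delta> y - v \<delta>' y\<bar> \<le> c * \<delta>^r * \<omega> \<delta>))"

definition scale_range ::
    "nat \<Rightarrow> (real \<Rightarrow> real) \<Rightarrow> (real^'n::finite) set \<Rightarrow> (real \<Rightarrow> real^'n \<Rightarrow> real) \<Rightarrow> real set \<Rightarrow> bool" where
  "scale_range r \<omega> K v S \<longleftrightarrow>
     (\<exists>\<delta>\<^sub>0. 0 < \<delta>\<^sub>0 \<and> \<delta>\<^sub>0 < diameter K / 4 \<and> S = range (\<lambda>n. \<delta>\<^sub>0 / 2^n)) \<or>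
     S = {0<..<diameter K / 4} \<and> comparable_scales r \<omega> K v"

end

theory Submission
  imports Defs
begin

text \<open>
  Everything rests on one interior estimate: a solution on a ball of radius \<open>\<rho>\<close> satisfies
  \<open>|\<partial>\<^sup>l u| \<le> C \<rho>\<^bsup>-|l|\<^esup> sup |u|\<close> at the centre. Applying the maximum principle to
  \<open>w x - w y - L (|x - y| - |x - y|\<^sup>2 / 8\<rho>)\<close> minus a localising term, with the reflection coupling as
  second-order matrix, bounds the gradient of a \<open>C\<^sup>2\<close> function by \<open>sup |w|\<close> and
  \<open>sup |\<Sum> a\<^sub>i\<^sub>j \<partial>\<^sub>i \<partial>\<^sub>j w|\<close> when the coefficients are Lipschitz. A derivative of a solution solves an
  equation with the same principal part whose right-hand side contains only derivatives of at most
  the next order; on small balls these are absorbed, which gives the estimate by induction on the order.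

  Solutions are a priori only \<open>C\<^sup>2\<close>. Third differences of a derivative of \<open>u\<close> with increments of size \<open>s\<close>,
  estimated on balls of radius \<open>s\<^bsup>1/2\<^esup>\<close>, decay half a power of \<open>s\<close> better than before, and by
  Marchaud's inequality the gain turns into further continuous derivatives.

  The interior estimate, applied to \<open>v\<^sub>\<delta> - v\<^bsub>\<delta>/2\<^esub>\<close> on balls of radius \<open>\<delta>/4\<close>, bounds the derivatives of
  order \<open>p\<close> of this difference by \<open>\<delta>\<^bsup>r-p\<^esup> \<omega>(\<delta>)\<close>. For \<open>p = k\<^sub>0 + 1\<close> the terms are summed over larger
  dyadic scales, where the integral of \<open>\<omega>(t)/t\<^sup>2\<close> controls the sum; for \<open>p \<le> k\<^sub>0\<close> over smaller ones, where
  the integral of \<open>\<omega>(t)/t\<close> does, and the limit is the surrogate derivative.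
\<close>

section \<open>Functions of class \<open>C\<^sup>k\<close> and their derivatives\<close>

text \<open>Only \<open>Ck_on 2\<close> is known of a solution, while derivatives of order
  \<open>k\<^sub>0 + 1\<close> must exist and be bounded, so everything has to come from a maximum
  principle for the principal part. The square in the doubled function makes its profile strictly
  concave. The Hessian of the distance vanishes in the direction x - y, which is where the
  reflection coupling concentrates, so without the square nothing would be gained. This gain, of
  order 1 / \<open>\<rho>\<close>, must also pay for the difference of the coefficients at x and y;
  this is why radii are small. The radius s^(1/2) balances the two terms sup |w| /
  \<open>\<rho>\<close> and \<open>\<rho>\<close> sup |trace| of the gradient estimate, since third
  differences of w have size s^(2 + \<open>\<theta>\<close>) and those of the right-hand side s^(1 +
  \<open>\<theta>\<close>). Second differences would not do: they cannot have an exponent above 2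
  unless the function is affine, and a whole derivative is gained only after passing 2. The upward
  summation over scales ends at a scale bounded from below, where compactness takes over. Since a
  neighbourhood on which some \<open>v \<delta>\<close> is defined need not have its closure in
  \<open>\<Omega>\<close>, constants are taken at a radius strictly below some scale.\<close>

lemma pderiv_dir_eqI:
  assumes "(f has_derivative f') (at x)"
  shows "pderiv_dir j f x = f' (axis j 1)"
  using frechet_derivative_at[OF assms] by (simp add: pderiv_dir_def)

lemma has_derivative_pderiv_dir:
  fixes f :: "real^'n::finite \<Rightarrow> real"
  assumes "f differentiable (at x)"
  shows "(f has_derivative (\<lambda>h. \<Sum>i\<in>UNIV. h $ i * pderiv_dir i f x)) (at x)"
proof -
  let ?D = "frechet_derivative f (at x)"
  have D: "(f has_derivative ?D) (at x)"
    using assms by (simp add: frechet_derivative_works)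
  then have lin: "linear ?D" by (rule has_derivative_linear)
  have "?D h = (\<Sum>i\<in>UNIV. h $ i * pderiv_dir i f x)" for h
  proof -
    have "h = (\<Sum>i\<in>UNIV. h $ i *\<^sub>R axis i 1)"
      using basis_expansion[of h] by (simp add: scalar_mult_eq_scaleR)
    then have "?D h = ?D (\<Sum>i\<in>UNIV. h $ i *\<^sub>R axis i 1)" by simp
    also have "\<dots> = (\<Sum>i\<in>UNIV. h $ i * pderiv_dir i f x)"
      by (simp add: linear_sum[OF lin] linear_scale[OF lin] pderiv_dir_def)
    finally show ?thesis .
  qed
  then have "?D = (\<lambda>h. \<Sum>i\<in>UNIV. h $ i * pderiv_dir i f x)" by blast
  then show ?thesis using D by simp
qed

lemma pderiv_dir_cong:
  assumes "open U" "x \<in> U" "\<And>y. y \<in> U \<Longrightarrow> f y = g y"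
  shows "pderiv_dir j f x = pderiv_dir j g x"
proof -
  \<comment> \<open>The derivative is chosen by \<open>SOME\<close>, so equal sets of derivatives
    give equal partials, also at points where neither function is differentiable.\<close>
  have "(f has_derivative F) (at x) \<longleftrightarrow> (g has_derivative F) (at x)" for F
    using has_derivative_transform_within_open[of _ _ x UNIV U] assms by metis
  then show ?thesis by (simp add: pderiv_dir_def frechet_derivative_def)
qed

lemma differentiable_cong_open:
  assumes "open U" "x \<in> U" "\<And>y. y \<in> U \<Longrightarrow> f y = g y" "f differentiable (at x)"
  shows "g differentiable (at x)"
  using assms has_derivative_transform_within_open[of f _ x UNIV U g]
  unfolding differentiable_def by metis

lemma Ck_on_cong:
  assumes "open U" "\<And>y. y \<in> U \<Longrightarrow> f y = g y" "Ck_on k f U"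
  shows "Ck_on k g U"
  using assms(2,3)
proof (induction k arbitrary: f g)
  case 0
  then show ?case using continuous_on_cong[of U U f g] by auto
next
  case (Suc k)
  have "g differentiable (at x)" if "x \<in> U" for x
    using differentiable_cong_open[OF assms(1) that Suc.prems(1)] Suc.prems(2) that by auto
  moreover have "Ck_on k (pderiv_dir j g) U" for j
    using Suc.IH[of "pderiv_dir j f" "pderiv_dir j g"] Suc.prems
      pderiv_dir_cong[OF assms(1) _ Suc.prems(1)] by auto
  ultimately show ?case by simp
qed

lemma Ck_on_subset: "Ck_on k f U \<Longrightarrow> V \<subseteq> U \<Longrightarrow> Ck_on k f V"
proof (induction k arbitrary: f)
  case 0
  then show ?case using continuous_on_subset by auto
qed auto

text \<open>Difference bounds are properties of germs, so regularity comes out near each point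
  separately and is glued here.\<close>

lemma Ck_on_local:
  assumes "\<And>x. x \<in> U \<Longrightarrow> \<exists>V. open V \<and> x \<in> V \<and> Ck_on k f V"
  shows "Ck_on k f U"
  using assms
proof (induction k arbitrary: f)
  case 0
  have "continuous (at x) f" if "x \<in> U" for x
    using 0[OF that] by (auto simp: continuous_on_eq_continuous_at)
  then show ?case by (simp add: continuous_at_imp_continuous_on)
next
  case (Suc k)
  have "f differentiable (at x)" if "x \<in> U" for x
    using Suc.prems[OF that] by auto
  moreover have "Ck_on k (pderiv_dir j f) U" for j
    using Suc.prems by (intro Suc.IH) fastforce
  ultimately show ?case by simp
qed

lemma Ck_on_Suc_imp_Ck_on: "Ck_on (Suc k) f U \<Longrightarrow> Ck_on k f U"
proof (induction k arbitrary: f)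
  case 0
  then show ?case
    by (auto intro!: continuous_at_imp_continuous_on differentiable_imp_continuous_within)
qed auto

lemma Ck_on_le: "Ck_on k f U \<Longrightarrow> l \<le> k \<Longrightarrow> Ck_on l f U"
proof (induction k)
  case (Suc k)
  then show ?case using Ck_on_Suc_imp_Ck_on by (cases "l = Suc k") auto
qed auto

lemma Ck_on_imp_continuous_on: "Ck_on k f U \<Longrightarrow> continuous_on U f"
  using Ck_on_le[of k f U 0] by simp

lemma Ck_on_const: "Ck_on k (\<lambda>x. c) (U :: (real^'n::finite) set)"
proof (induction k arbitrary: c)
  case (Suc k)
  have "pderiv_dir j (\<lambda>x. c) = (\<lambda>x. 0)" for j :: 'n
    by (simp add: pderiv_dir_def fun_eq_iff)
  then show ?case using Suc[of 0] by (simp only: Ck_on.simps) simp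
qed simp

section \<open>Sums, products and translates of functions of class C^k\<close>

lemma pderiv_dir_add:
  assumes "f differentiable (at x)" "g differentiable (at x)"
  shows "pderiv_dir j (\<lambda>y. f y + g y) x = pderiv_dir j f x + pderiv_dir j g x"
  using pderiv_dir_eqI[OF has_derivative_add[OF assms[THEN has_derivative_pderiv_dir]], of j]
  by (simp add: axis_def if_distrib[of "\<lambda>u. u * _"] cong: if_cong)

lemma pderiv_dir_mult:
  assumes "f differentiable (at x)" "g differentiable (at x)"
  shows "pderiv_dir j (\<lambda>y. f y * g y) x = f x * pderiv_dir j g x + pderiv_dir j f x * g x"
  using pderiv_dir_eqI[OF has_derivative_mult[OF assms[THEN has_derivative_pderiv_dir]], of j]
  by (simp add: axis_def if_distrib[of "\<lambda>u. u * _"] cong: if_cong)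

text \<open>Allows the partial derivatives to be replaced by a formula that holds on U only, which
  is all that the sum and product rules provide.\<close>

lemma Ck_on_SucI:
  assumes "open U" "\<And>x. x \<in> U \<Longrightarrow> f differentiable (at x)"
    and "\<And>j x. x \<in> U \<Longrightarrow> g j x = pderiv_dir j f x"
    and "\<And>j. Ck_on k (g j) U"
  shows "Ck_on (Suc k) f U"
proof -
  have "Ck_on k (pderiv_dir j f) U" for j
    by (rule Ck_on_cong[of U "g j"]) (use assms in auto)
  then show ?thesis using assms(2) by simp
qed

lemma Ck_on_add:
  assumes "open U" "Ck_on k f U" "Ck_on k g U"
  shows "Ck_on k (\<lambda>x. f x + g x) U"
  using assms(2,3)
proof (induction k arbitrary: f g)
  case 0
  then show ?case by (auto intro: continuous_on_add)
next
  case (Suc k)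
  show ?case
  proof (rule Ck_on_SucI[OF assms(1), where g = "\<lambda>j x. pderiv_dir j f x + pderiv_dir j g x"])
    show "Ck_on k (\<lambda>x. pderiv_dir j f x + pderiv_dir j g x) U" for j
      by (rule Suc.IH) (use Suc.prems in simp_all)
  qed (use Suc.prems in \<open>simp_all add: differentiable_add pderiv_dir_add\<close>)
qed

lemma Ck_on_mult:
  assumes "open U" "Ck_on k f U" "Ck_on k g U"
  shows "Ck_on k (\<lambda>x. f x * g x) U"
  using assms(2,3)
proof (induction k arbitrary: f g)
  case 0
  then show ?case by (auto intro: continuous_on_mult)
next
  case (Suc k)
  show ?case
  proof (rule Ck_on_SucI[OF assms(1), where
        g = "\<lambda>j x. f x * pderiv_dir j g x + pderiv_dir j f x * g x"])
    show "Ck_on k (\<lambda>x. f x * pderiv_dir j g x + pderiv_dir j f x * g x) U" for j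
      using Suc.prems Suc.prems[THEN Ck_on_Suc_imp_Ck_on]
      by (intro Ck_on_add[OF assms(1)] Suc.IH) simp_all
  qed (use Suc.prems in \<open>simp_all add: differentiable_mult pderiv_dir_mult\<close>)
qed

lemma Ck_on_cmult: "open U \<Longrightarrow> Ck_on k f U \<Longrightarrow> Ck_on k (\<lambda>x. c * f x) U"
  by (rule Ck_on_mult) (auto intro: Ck_on_const)

lemma Ck_on_diff:
  assumes "open U" "Ck_on k f U" "Ck_on k g U"
  shows "Ck_on k (\<lambda>x. f x - g x) U"
  using Ck_on_add[OF assms(1,2) Ck_on_cmult[OF assms(1,3), of "-1"]] by simp

lemma pderiv_dir_cmult:
  assumes "f differentiable (at x)"
  shows "pderiv_dir j (\<lambda>y. c * f y) x = c * pderiv_dir j f x"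
  using pderiv_dir_mult[of "\<lambda>_. c" x f j] assms by (simp add: pderiv_dir_def)

lemma pderiv_dir_diff:
  assumes "f differentiable (at x)" "g differentiable (at x)"
  shows "pderiv_dir j (\<lambda>y. f y - g y) x = pderiv_dir j f x - pderiv_dir j g x"
  using pderiv_dir_add[of f x "\<lambda>y. -1 * g y" j] assms pderiv_dir_cmult[of g x j "-1"]
  by (simp add: differentiable_minus)

lemma pderiv_dir_sum:
  assumes "finite I" "\<And>i. i \<in> I \<Longrightarrow> f i differentiable (at x)"
  shows "pderiv_dir j (\<lambda>y. \<Sum>i\<in>I. f i y) x = (\<Sum>i\<in>I. pderiv_dir j (f i) x)"
  using assms
proof (induction I)
  case empty
  then show ?case by (simp add: pderiv_dir_def)
next
  case (insert i I)
  then show ?case by (simp add: pderiv_dir_add differentiable_sum)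
qed

lemma pderiv_dir_shift:
  "pderiv_dir j (\<lambda>y. f (y + h)) x = pderiv_dir j f (x + h)"
proof -
  have *: "(f has_derivative F) (at (x + h)) \<longleftrightarrow> ((\<lambda>y. f (y + h)) has_derivative F) (at x)" for F
  proof
    assume "(f has_derivative F) (at (x + h))"
    then have "((\<lambda>y. f (y + h)) has_derivative (\<lambda>y. F (id y))) (at x)"
      by (intro has_derivative_compose[where g = f and f = "\<lambda>y. y + h"])
        (auto intro!: derivative_eq_intros)
    then show "((\<lambda>y. f (y + h)) has_derivative F) (at x)" by simp
  next
    assume "((\<lambda>y. f (y + h)) has_derivative F) (at x)"
    then have "((\<lambda>z. f ((z - h) + h)) has_derivative (\<lambda>y. F (id y))) (at (x + h))"
      by (intro has_derivative_compose[where g = "\<lambda>y. f (y + h)" and f = "\<lambda>y. y - h"])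
        (auto intro!: derivative_eq_intros)
    then show "(f has_derivative F) (at (x + h))" by simp
  qed
  show ?thesis by (simp add: pderiv_dir_def frechet_derivative_def *)
qed

lemma differentiable_shift:
  assumes "f differentiable (at (x + h))"
  shows "(\<lambda>y. f (y + h)) differentiable (at x)"
proof -
  obtain F where "(f has_derivative F) (at (x + h))" using assms by (auto simp: differentiable_def)
  then have "((\<lambda>y. f (y + h)) has_derivative (\<lambda>y. F (id y))) (at x)"
    by (intro has_derivative_compose[where g = f and f = "\<lambda>y. y + h"])
      (auto intro!: derivative_eq_intros)
  then show ?thesis by (auto simp: differentiable_def)
qed

lemma Ck_on_shift:
  assumes "Ck_on k f U" "\<And>x. x \<in> V \<Longrightarrow> x + h \<in> U"
  shows "Ck_on k (\<lambda>y. f (y + h)) V"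
  using assms(1)
proof (induction k arbitrary: f)
  case 0
  then show ?case
    by (auto intro!: continuous_on_compose2[of U f] continuous_intros assms(2))
next
  case (Suc k)
  have "pderiv_dir j (\<lambda>y. f (y + h)) = (\<lambda>y. pderiv_dir j f (y + h))" for j
    by (simp add: fun_eq_iff pderiv_dir_shift)
  then show ?case using Suc assms(2) by (auto intro: differentiable_shift)
qed

text \<open>Derivatives are indexed by lists rather than multi-indices. The order of differentiation
  is then fixed, the head being outermost, and mixed partials have to be interchanged only where a
  new derivative is moved past the second-order part.\<close>

definition iter_deriv :: "'n::finite list \<Rightarrow> (real^'n \<Rightarrow> real) \<Rightarrow> real^'n \<Rightarrow> real" where
  "iter_deriv l f = foldr pderiv_dir l f"

lemma iter_deriv_Nil [simp]: "iter_deriv [] f = f"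
  and iter_deriv_Cons: "iter_deriv (j # l) f = pderiv_dir j (iter_deriv l f)"
  by (simp_all add: iter_deriv_def)

lemma iter_deriv_snoc: "iter_deriv (l @ [j]) f = iter_deriv l (pderiv_dir j f)"
  by (simp add: iter_deriv_def)

lemma Ck_on_iter_deriv: "Ck_on (k + length l) f U \<Longrightarrow> Ck_on k (iter_deriv l f) U"
proof (induction l arbitrary: f rule: rev_induct)
  \<comment> \<open>\<open>Ck_on\<close> peels off the innermost derivative, hence the induction
    from the end of the list.\<close>
  case (snoc j l)
  then show ?case by (simp add: iter_deriv_snoc)
qed simp

lemma Ck_on_iter_deriv_le: "Ck_on n f U \<Longrightarrow> k + length l \<le> n \<Longrightarrow> Ck_on k (iter_deriv l f) U"
  using Ck_on_iter_deriv Ck_on_le by blast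

text \<open>A gain of regularity is proved for the derivatives of the highest available order only;
  this transfers it to the function.\<close>

lemma Ck_on_addI:
  assumes "Ck_on n f U" "\<And>l. length l = n \<Longrightarrow> Ck_on k (iter_deriv l f) U"
  shows "Ck_on (n + k) f U"
  using assms
proof (induction n arbitrary: f)
  case 0
  then show ?case using "0.prems"(2)[of "[]"] by simp
next
  case (Suc n)
  have "Ck_on (n + k) (pderiv_dir j f) U" for j
    using Suc.prems(1) Suc.prems(2)[of "_ @ [j]"] by (intro Suc.IH) (auto simp: iter_deriv_snoc)
  then show ?case using Suc.prems(1) by simp
qed

lemma iter_deriv_differentiable:
  "Ck_on n f U \<Longrightarrow> length l < n \<Longrightarrow> x \<in> U \<Longrightarrow> iter_deriv l f differentiable (at x)"
  using Ck_on_iter_deriv_le[of n f U "Suc 0" l] by simp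

lemma iter_deriv_diff:
  assumes "open U" "Ck_on n f U" "Ck_on n g U" "length l \<le> n" "x \<in> U"
  shows "iter_deriv l (\<lambda>y. f y - g y) x = iter_deriv l f x - iter_deriv l g x"
  using assms(4,5)
proof (induction l arbitrary: x)
  case (Cons j l)
  have "pderiv_dir j (iter_deriv l (\<lambda>y. f y - g y)) x
      = pderiv_dir j (\<lambda>y. iter_deriv l f y - iter_deriv l g y) x"
    using Cons by (intro pderiv_dir_cong[OF assms(1)]) auto
  also have "\<dots> = pderiv_dir j (iter_deriv l f) x - pderiv_dir j (iter_deriv l g) x"
    using Cons.prems assms(2,3) by (intro pderiv_dir_diff iter_deriv_differentiable) auto
  finally show ?case by (simp add: iter_deriv_Cons)
qed simp

section \<open>Mean values along lines and symmetry of mixed partials\<close>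

lemma DERIV_along_line:
  fixes f :: "real^'n::finite \<Rightarrow> real"
  assumes "f differentiable (at (x + t *\<^sub>R h))"
  shows "((\<lambda>t. f (x + t *\<^sub>R h)) has_real_derivative
           (\<Sum>i\<in>UNIV. h $ i * pderiv_dir i f (x + t *\<^sub>R h))) (at t)"
proof -
  have "((\<lambda>t. f (x + t *\<^sub>R h)) has_derivative
      (\<lambda>s. \<Sum>i\<in>UNIV. (s *\<^sub>R h) $ i * pderiv_dir i f (x + t *\<^sub>R h))) (at t)"
    by (rule has_derivative_compose[where f = "\<lambda>t. x + t *\<^sub>R h", OF _ has_derivative_pderiv_dir[OF assms]])
      (auto intro!: derivative_eq_intros)
  moreover have "(\<lambda>s. \<Sum>i\<in>UNIV. (s *\<^sub>R h) $ i * pderiv_dir i f (x + t *\<^sub>R h))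
      = (*) (\<Sum>i\<in>UNIV. h $ i * pderiv_dir i f (x + t *\<^sub>R h))"
    by (simp add: fun_eq_iff sum_distrib_left sum_distrib_right ac_simps)
  ultimately show ?thesis by (simp only: has_field_derivative_def)
qed

lemma mean_value_along_line:
  fixes f :: "real^'n::finite \<Rightarrow> real"
  assumes "\<And>t. 0 \<le> t \<Longrightarrow> t \<le> 1 \<Longrightarrow> f differentiable (at (x + t *\<^sub>R h))"
  shows "\<exists>t. 0 < t \<and> t < 1 \<and>
    f (x + h) - f x = (\<Sum>i\<in>UNIV. h $ i * pderiv_dir i f (x + t *\<^sub>R h))"
  using MVT2[of 0 1 "\<lambda>t. f (x + t *\<^sub>R h)" "\<lambda>t. \<Sum>i\<in>UNIV. h $ i * pderiv_dir i f (x + t *\<^sub>R h)"]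
    DERIV_along_line[OF assms] by auto

lemma abs_sum_component_mult_le:
  fixes h :: "real^'n::finite"
  assumes "\<And>i. \<bar>d i\<bar> \<le> M"
  shows "\<bar>\<Sum>i\<in>UNIV. h $ i * d i\<bar> \<le> real CARD('n) * norm h * M"
proof -
  have "\<bar>\<Sum>i\<in>UNIV. h $ i * d i\<bar> \<le> (\<Sum>i\<in>(UNIV::'n set). norm h * M)"
    using assms component_le_norm_cart[of h]
    by (intro order_trans[OF sum_abs] sum_mono) (auto simp: abs_mult intro!: mult_mono)
  then show ?thesis by simp
qed

lemma mean_value_bound:
  fixes f :: "real^'n::finite \<Rightarrow> real"
  assumes "convex B" "x \<in> B" "x + h \<in> B"
    and "\<And>y. y \<in> B \<Longrightarrow> f differentiable (at y)"
    and "\<And>y i. y \<in> B \<Longrightarrow> \<bar>pderiv_dir i f y\<bar> \<le> M"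
  shows "\<bar>f (x + h) - f x\<bar> \<le> real CARD('n) * norm h * M"
proof -
  have *: "x + t *\<^sub>R h \<in> B" if "0 \<le> t" "t \<le> 1" for t
  proof -
    have "(1 - t) *\<^sub>R x + t *\<^sub>R (x + h) \<in> B"
      using assms(1-3) that by (simp add: convex_alt)
    then show ?thesis by (simp add: algebra_simps)
  qed
  obtain t where t: "0 < t" "t < 1"
    "f (x + h) - f x = (\<Sum>i\<in>UNIV. h $ i * pderiv_dir i f (x + t *\<^sub>R h))"
    using mean_value_along_line[of f x h] assms(4) * by blast
  show ?thesis unfolding t(3)
    using assms(5) * t by (intro abs_sum_component_mult_le) auto
qed

text \<open>Both mixed partials are limits of the quotient of the same second difference.\<close>

lemma pderiv_dir_commute:
  fixes f :: "real^'n::finite \<Rightarrow> real"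
  assumes "open U" "Ck_on 2 f U" "x \<in> U"
  shows "pderiv_dir i (pderiv_dir j f) x = pderiv_dir j (pderiv_dir i f) x"
proof -
  have C: "\<And>y. y \<in> U \<Longrightarrow> f differentiable (at y)"
    "\<And>y i. y \<in> U \<Longrightarrow> pderiv_dir i f differentiable (at y)"
    "\<And>i j. continuous_on U (pderiv_dir i (pderiv_dir j f))"
    using assms(2) by (auto simp: numeral_2_eq_2)
  obtain e where e: "0 < e" "ball x e \<subseteq> U" using assms(1,3) open_contains_ball by blast
  define D where "D s i j = f (x + s *\<^sub>R axis i 1 + s *\<^sub>R axis j 1) - f (x + s *\<^sub>R axis i 1)
      - (f (x + s *\<^sub>R axis j 1) - f x)" for s :: real and i j :: 'n
  have key: "\<exists>y. norm (y - x) \<le> 2 * s \<and> D s i j = s * s * pderiv_dir j (pderiv_dir i f) y"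
    if s: "0 < s" "2 * s < e" for s i j
  proof -
    have inU: "x + a *\<^sub>R axis i 1 + b *\<^sub>R axis j 1 \<in> U" if "\<bar>a\<bar> \<le> s" "\<bar>b\<bar> \<le> s" for a b
    proof -
      have "norm (a *\<^sub>R axis i (1::real) + b *\<^sub>R axis j 1 :: real^'n) \<le> \<bar>a\<bar> + \<bar>b\<bar>"
        by (rule order_trans[OF norm_triangle_ineq]) simp
      then have "norm (a *\<^sub>R axis i (1::real) + b *\<^sub>R axis j 1 :: real^'n) < e"
        using that s by linarith
      then show ?thesis
        using subsetD[OF e(2), of "x + (a *\<^sub>R axis i 1 + b *\<^sub>R axis j 1)"]
        by (simp only: mem_ball dist_norm norm_minus_commute[of x]) (simp add: add.assoc)
    qed
    have sum1: "(\<Sum>k\<in>UNIV. (axis i (1::real) :: real^'n) $ k * g k) = g i" for g i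
      by (simp add: axis_def if_distrib[of "\<lambda>u. u * _"] cong: if_cong)
    \<comment> \<open>The first mean value is taken in direction i of a difference in direction j,
      the second in direction j of the derivative in direction i. This order alone decides which
      mixed partial appears.\<close>
    define F where "F = (\<lambda>t. f ((x + s *\<^sub>R axis j 1) + t *\<^sub>R axis i 1) - f (x + t *\<^sub>R axis i 1))"
    have dF: "(F has_real_derivative
       (pderiv_dir i f (x + s *\<^sub>R axis j 1 + t *\<^sub>R axis i 1) - pderiv_dir i f (x + t *\<^sub>R axis i 1))) (at t)"
      if "0 \<le> t" "t \<le> s" for t
      unfolding F_def
    proof (rule DERIV_diff)
      have "x + s *\<^sub>R axis j 1 + t *\<^sub>R axis i 1 \<in> U" using inU[of t s] that by (simp add: algebra_simps)
      from DERIV_along_line[OF C(1)[OF this]]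
      show "((\<lambda>t. f (x + s *\<^sub>R axis j 1 + t *\<^sub>R axis i 1)) has_real_derivative
          pderiv_dir i f (x + s *\<^sub>R axis j 1 + t *\<^sub>R axis i 1)) (at t)" by (simp only: sum1)
      have "x + t *\<^sub>R axis i 1 \<in> U" using inU[of t 0] that by simp
      from DERIV_along_line[OF C(1)[OF this]]
      show "((\<lambda>t. f (x + t *\<^sub>R axis i 1)) has_real_derivative
          pderiv_dir i f (x + t *\<^sub>R axis i 1)) (at t)" by (simp only: sum1)
    qed
    obtain t where t: "0 < t" "t < s"
      "F s - F 0 = s * (pderiv_dir i f (x + s *\<^sub>R axis j 1 + t *\<^sub>R axis i 1) - pderiv_dir i f (x + t *\<^sub>R axis i 1))"
      using MVT2[of 0 s F, OF s(1) dF] by auto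
    have dG: "((\<lambda>r. pderiv_dir i f (x + t *\<^sub>R axis i 1 + r *\<^sub>R axis j 1)) has_real_derivative
        pderiv_dir j (pderiv_dir i f) (x + t *\<^sub>R axis i 1 + r *\<^sub>R axis j 1)) (at r)" if "0 \<le> r" "r \<le> s" for r
    proof -
      have "x + t *\<^sub>R axis i 1 + r *\<^sub>R axis j 1 \<in> U" using inU[of t r] t that by simp
      from DERIV_along_line[OF C(2)[OF this]] show ?thesis by (simp only: sum1)
    qed
    obtain r where r: "0 < r" "r < s"
      "pderiv_dir i f (x + t *\<^sub>R axis i 1 + s *\<^sub>R axis j 1) - pderiv_dir i f (x + t *\<^sub>R axis i 1 + 0 *\<^sub>R axis j 1)
        = s * pderiv_dir j (pderiv_dir i f) (x + t *\<^sub>R axis i 1 + r *\<^sub>R axis j 1)"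
      using MVT2[of 0 s "\<lambda>r. pderiv_dir i f (x + t *\<^sub>R axis i 1 + r *\<^sub>R axis j 1)", OF s(1) dG] by auto
    let ?y = "x + t *\<^sub>R axis i 1 + r *\<^sub>R axis j 1"
    have "norm (t *\<^sub>R axis i (1::real) + r *\<^sub>R axis j 1 :: real^'n) \<le> \<bar>t\<bar> + \<bar>r\<bar>"
      by (rule order_trans[OF norm_triangle_ineq]) simp
    then have "norm (?y - x) \<le> 2 * s" using t r by (simp add: add.assoc)
    moreover have "D s i j = F s - F 0" by (simp add: D_def F_def algebra_simps)
    moreover have "x + s *\<^sub>R axis j 1 + t *\<^sub>R axis i 1 = x + t *\<^sub>R axis i 1 + s *\<^sub>R axis j 1"
      by simp
    ultimately have "D s i j = s * (s * pderiv_dir j (pderiv_dir i f) ?y)"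
      using t(3) r(3) by simp
    then show ?thesis using \<open>norm (?y - x) \<le> 2 * s\<close> by (intro exI[of _ ?y]) simp
  qed
  have lim: "((\<lambda>s. D s i j / (s * s)) \<longlongrightarrow> pderiv_dir j (pderiv_dir i f) x) (at_right 0)" for i j
  proof (rule tendstoI)
    fix \<epsilon> :: real assume "0 < \<epsilon>"
    have "isCont (pderiv_dir j (pderiv_dir i f)) x"
      using C(3) assms(1,3) continuous_on_eq_continuous_at by blast
    then obtain d where d: "0 < d" "\<And>y. dist y x < d \<Longrightarrow>
        dist (pderiv_dir j (pderiv_dir i f) y) (pderiv_dir j (pderiv_dir i f) x) < \<epsilon>"
      using \<open>0 < \<epsilon>\<close> unfolding continuous_at_eps_delta by blast
    have "dist (D s i j / (s * s)) (pderiv_dir j (pderiv_dir i f) x) < \<epsilon>"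
      if s: "0 < s" "s < min (d/2) (e/2)" for s
    proof -
      obtain y where "norm (y - x) \<le> 2 * s" "D s i j = s * s * pderiv_dir j (pderiv_dir i f) y"
        using key[of s i j] s by auto
      then show ?thesis using d(2)[of y] s by (simp add: dist_norm)
    qed
    then show "\<forall>\<^sub>F s in at_right 0. dist (D s i j / (s * s)) (pderiv_dir j (pderiv_dir i f) x) < \<epsilon>"
      unfolding eventually_at_right_field using d(1) e(1) by (intro exI[of _ "min (d/2) (e/2)"]) auto
  qed
  have "D s i j = D s j i" for s by (simp add: D_def algebra_simps)
  then show ?thesis using tendsto_unique[OF _ lim[of j i]] lim[of i j] by (simp add: trivial_limit_at_right_real)
qed

section \<open>Gradient estimate by coupling and doubling of variables\<close>

text \<open>Symmetric Gaussian elimination: the finite set carries the rows that may be nonzero, and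
  each pivot removes one of them. Writing a second-order matrix as a sum of squares reduces the
  maximum principle to the second derivative test along finitely many lines.\<close>

lemma psd_decomposition_on:
  fixes A :: "'i::finite \<Rightarrow> 'i \<Rightarrow> real"
  assumes "finite I" "\<And>i j. A i j = A j i" "\<And>i j. i \<notin> I \<Longrightarrow> A i j = 0"
    and "\<And>x. 0 \<le> (\<Sum>i\<in>UNIV. \<Sum>j\<in>UNIV. x i * A i j * x j)"
  shows "\<exists>v :: 'i \<Rightarrow> 'i \<Rightarrow> real. \<forall>i j. A i j = (\<Sum>k\<in>I. v k i * v k j)"
  using assms
proof (induction I arbitrary: A)
  case empty
  then show ?case by auto
next
  case (insert p I)
  define Q where "Q A x = (\<Sum>i\<in>UNIV. \<Sum>j\<in>UNIV. x i * A i j * x j)" for A and x :: "'i \<Rightarrow> real"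
  define e where "e k = (\<lambda>i. if i = k then 1 else (0::real))" for k :: 'i
  have sum_e: "(\<Sum>i\<in>UNIV. e k i * g i) = g k" "(\<Sum>i\<in>UNIV. g i * e k i) = g k" for k g
    by (auto simp: e_def if_distrib[of "\<lambda>u. u * _"] if_distrib[of "\<lambda>u. _ * u"] cong: if_cong)
  have expand: "Q A (\<lambda>i. x i + t * e k i) = Q A x + 2 * t * (\<Sum>i\<in>UNIV. x i * A i k) + t\<^sup>2 * A k k"
    for x t k
  proof -
    have "Q A (\<lambda>i. x i + t * e k i) = (\<Sum>i\<in>UNIV. \<Sum>j\<in>UNIV. x i * A i j * x j
        + t * (x i * (A i j * e k j)) + t * (e k i * (A i j * x j))
        + t\<^sup>2 * (e k i * (A i j * e k j)))"
      unfolding Q_def by (intro sum.cong refl) (simp add: algebra_simps power2_eq_square)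
    also have "\<dots> = Q A x + t * (\<Sum>i\<in>UNIV. x i * (\<Sum>j\<in>UNIV. A i j * e k j))
        + t * (\<Sum>i\<in>UNIV. e k i * (\<Sum>j\<in>UNIV. A i j * x j))
        + t\<^sup>2 * (\<Sum>i\<in>UNIV. e k i * (\<Sum>j\<in>UNIV. A i j * e k j))"
      unfolding Q_def by (simp only: sum.distrib sum_distrib_left)
    finally have "Q A (\<lambda>i. x i + t * e k i) = Q A x + t * (\<Sum>i\<in>UNIV. x i * A i k)
        + t * (\<Sum>j\<in>UNIV. A k j * x j) + t\<^sup>2 * A k k" unfolding sum_e .
    moreover have "(\<Sum>j\<in>UNIV. A k j * x j) = (\<Sum>i\<in>UNIV. x i * A i k)"
      using insert.prems(1) by (intro sum.cong refl) (simp add: mult.commute)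
    ultimately show ?thesis by simp
  qed
  have pos: "0 \<le> Q A x" for x using insert.prems(3) by (simp add: Q_def)
  have diag: "Q A (\<lambda>i. e k i) = A k k" for k
    unfolding Q_def by (simp add: mult.assoc sum_distrib_left[symmetric] sum_e)
  show ?case
  proof (cases "A p p = 0")
    case True
    have "A i p = 0" for i
    proof (rule ccontr)
      assume nz: "A i p \<noteq> 0"
      \<comment> \<open>Solves A i i + 2 t A i p = -1.\<close>
      define t where "t = - (A i i + 1) / (2 * A i p)"
      have "Q A (\<lambda>j. e i j + t * e p j) = A i i + 2 * t * A i p"
        using expand[of "\<lambda>j. e i j" t p] by (simp add: diag sum_e True)
      also have "\<dots> = -1" using nz by (simp add: t_def field_simps)
      finally show False using pos[of "\<lambda>j. e i j + t * e p j"] by simp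
    qed
    then have "A i j = 0" if "i \<notin> I" for i j
      using insert.prems(1,2) that by (metis insert_iff)
    then obtain v where v: "\<forall>i j. A i j = (\<Sum>k\<in>I. v k i * v k j)"
      using insert.IH[of A] insert.prems by blast
    show ?thesis
      using insert.hyps v by (intro exI[of _ "v(p := \<lambda>_. 0)"]) (auto intro!: sum.cong)
  next
    case False
    then have App: "0 < A p p" using pos[of "\<lambda>i. e p i"] by (simp add: diag)
    \<comment> \<open>The Schur complement of the pivot. Its form at x is the minimum of the form of
      A over x + t \<open>e p\<close>, attained at t = -b / A p p, the step used below.\<close>
    define A' where "A' i j = A i j - A i p * A j p / A p p" for i j
    have "A' i j = A' j i" for i j using insert.prems(1)[of i j] by (simp add: A'_def mult.commute)
    moreover have "A' i j = 0" if "i \<notin> I" for i j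
    proof (cases "i = p")
      case True
      then show ?thesis using App insert.prems(1)[of p j] by (simp add: A'_def)
    next
      case False
      then show ?thesis using that insert.prems(2) by (simp add: A'_def)
    qed
    moreover have "0 \<le> Q A' x" for x
    proof -
      define b where "b = (\<Sum>i\<in>UNIV. x i * A i p)"
      have "Q A' x = (\<Sum>i\<in>UNIV. \<Sum>j\<in>UNIV. x i * A i j * x j - (x i * A i p) * (x j * A j p) / A p p)"
        unfolding Q_def A'_def by (intro sum.cong refl) (simp add: algebra_simps)
      also have "\<dots> = Q A x - b * b / A p p"
        unfolding Q_def b_def sum_product by (simp add: sum_subtractf sum_divide_distrib)
      also have "\<dots> = Q A (\<lambda>i. x i + (- b / A p p) * e p i)"
        using expand[of x "- b / A p p" p] App by (simp add: b_def[symmetric] field_simps power2_eq_square)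
      finally show ?thesis using pos by simp
    qed
    ultimately obtain v where v: "\<forall>i j. A' i j = (\<Sum>k\<in>I. v k i * v k j)"
      using insert.IH[of A'] unfolding Q_def by blast
    have "A i j = (\<Sum>k\<in>insert p I. (v(p := \<lambda>i. A i p / sqrt (A p p))) k i
        * (v(p := \<lambda>i. A i p / sqrt (A p p))) k j)" for i j
    proof -
      have "(\<Sum>k\<in>I. (v(p := \<lambda>i. A i p / sqrt (A p p))) k i * (v(p := \<lambda>i. A i p / sqrt (A p p))) k j)
          = A' i j"
        using v insert.hyps by (auto intro!: sum.cong)
      then show ?thesis using insert.hyps App by (simp add: A'_def)
    qed
    then show ?thesis by blast
  qed
qed

lemma psd_decomposition:
  fixes A :: "'i::finite \<Rightarrow> 'i \<Rightarrow> real"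
  assumes "\<And>i j. A i j = A j i"
    and "\<And>x. 0 \<le> (\<Sum>i\<in>UNIV. \<Sum>j\<in>UNIV. x i * A i j * x j)"
  obtains v :: "'i \<Rightarrow> 'i \<Rightarrow> real" where "\<And>i j. A i j = (\<Sum>k\<in>UNIV. v k i * v k j)"
  using psd_decomposition_on[of UNIV A] assms by auto

text \<open>If m were positive, \<open>g'\<close>, which vanishes at 0, would be positive just to
  the right, and the mean value theorem would push g above \<open>g 0\<close>.\<close>

lemma second_derivative_local_max:
  fixes g :: "real \<Rightarrow> real"
  assumes "0 < d" "\<And>t. \<bar>t\<bar> < d \<Longrightarrow> (g has_real_derivative g' t) (at t)"
    and "(g' has_real_derivative m) (at 0)" "\<And>t. \<bar>t\<bar> < d \<Longrightarrow> g t \<le> g 0"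
  shows "m \<le> 0"
proof (rule ccontr)
  assume "\<not> m \<le> 0"
  have "g' 0 = 0"
    using DERIV_local_max[OF assms(2)[of 0], of d] assms(1,4) by simp
  then obtain c where c: "0 < c" "\<And>h. 0 < h \<Longrightarrow> h < c \<Longrightarrow> 0 < g' h"
    using DERIV_pos_inc_right[OF assms(3)] \<open>\<not> m \<le> 0\<close> by auto
  define h where "h = min c d / 2"
  have h: "0 < h" "h < c" "h < d" using c(1) assms(1) by (auto simp: h_def)
  obtain z where z: "0 < z" "z < h" "g h - g 0 = (h - 0) * g' z"
    using MVT2[of 0 h g g'] assms(2) h by auto
  have "0 < h * g' z" using c(2)[of z] z h by simp
  then have "g h > g 0" using z by simp
  then show False using assms(4)[of h] h by simp
qed

section \<open>Quadratic forms and the reflection coupling\<close>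

lemma bilinear_form_abs_le:
  fixes M :: "real^'n::finite^'n"
  assumes "\<And>i j. \<bar>M $ i $ j\<bar> \<le> \<delta>"
  shows "\<bar>\<xi> \<bullet> (M *v \<eta>)\<bar> \<le> \<delta> * (real CARD('n))\<^sup>2 * norm \<xi> * norm \<eta>"
proof -
  have "\<xi> \<bullet> (M *v \<eta>) = (\<Sum>i\<in>UNIV. \<Sum>j\<in>UNIV. \<xi> $ i * (M $ i $ j * \<eta> $ j))"
    by (simp add: inner_vec_def matrix_vector_mult_def sum_distrib_left)
  also have "\<bar>\<dots>\<bar> \<le> (\<Sum>i\<in>(UNIV::'n set). \<Sum>j\<in>(UNIV::'n set). norm \<xi> * (\<delta> * norm \<eta>))"
  proof (intro order_trans[OF sum_abs] sum_mono)
    fix i j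
    have "0 \<le> \<delta>" using assms[of i j] by linarith
    then show "\<bar>\<xi> $ i * (M $ i $ j * \<eta> $ j)\<bar> \<le> norm \<xi> * (\<delta> * norm \<eta>)"
      using assms[of i j] component_le_norm_cart[of \<xi> i] component_le_norm_cart[of \<eta> j]
      by (simp add: abs_mult mult_mono)
  qed
  also have "\<dots> = \<delta> * (real CARD('n))\<^sup>2 * norm \<xi> * norm \<eta>"
    by (simp add: power2_eq_square)
  finally show ?thesis .
qed

lemma inner_symmetric_matrix:
  fixes M :: "real^'n::finite^'n"
  assumes "transpose M = M"
  shows "\<xi> \<bullet> (M *v \<eta>) = \<eta> \<bullet> (M *v \<xi>)"
  using dot_lmul_matrix[of \<xi> M \<eta>] assms by (metis inner_commute transpose_matrix_vector)

text \<open>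
  The reflection coupling: the off-diagonal block \<open>c\<close> is the average of the diagonal ones, lowered by
  a multiple of the projection to \<open>z\<close>, so that the block matrix stays positive semidefinite while
  \<open>X + Y - 2 c\<close> is at least \<open>\<mu>\<close> in direction \<open>z\<close>.
\<close>

lemma reflection_coupling_nonneg:
  fixes X Y :: "real^'n::finite^'n"
  assumes "transpose X = X" "transpose Y = Y" "0 < \<mu>"
    and "\<And>\<xi>. \<mu> * (norm \<xi>)\<^sup>2 \<le> \<xi> \<bullet> (X *v \<xi>)" "\<And>\<xi>. \<mu> * (norm \<xi>)\<^sup>2 \<le> \<xi> \<bullet> (Y *v \<xi>)"
    and "\<And>i j. \<bar>X $ i $ j - Y $ i $ j\<bar> \<le> 2 * \<delta>"
    and "\<epsilon> = \<delta> * (real CARD('n))\<^sup>2" "2 * \<epsilon>\<^sup>2 \<le> \<mu>\<^sup>2" "\<kappa> = \<epsilon>\<^sup>2 / \<mu>"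
  shows "0 \<le> \<xi> \<bullet> (X *v \<xi>) + \<eta> \<bullet> (Y *v \<eta>) + \<xi> \<bullet> (X *v \<eta>) + \<xi> \<bullet> (Y *v \<eta>)
      - \<mu> * (\<xi> \<bullet> z) * (\<eta> \<bullet> z) / (norm z)\<^sup>2 - 2 * \<kappa> * (\<xi> \<bullet> \<eta>)"
proof -
  \<comment> \<open>In sum and difference variables X + Y acts on p alone, and m enters only through
    the small matrix X - Y and the terms with z and \<open>\<kappa>\<close>.\<close>
  define p m where "p = \<xi> + \<eta>" and "m = \<xi> - \<eta>"
  have \<delta>: "0 \<le> \<delta>" using assms(6)[of undefined undefined] by linarith
  have E: "\<bar>m \<bullet> ((X - Y) *v p)\<bar> \<le> 2 * \<epsilon> * norm m * norm p"
    using bilinear_form_abs_le[of "X - Y" "2 * \<delta>" m p] assms(6,7) by (simp add: mult.assoc)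
  have id1: "\<xi> \<bullet> (X *v \<xi>) + \<eta> \<bullet> (Y *v \<eta>) + \<xi> \<bullet> (X *v \<eta>) + \<xi> \<bullet> (Y *v \<eta>)
      = (p \<bullet> (X *v p) + p \<bullet> (Y *v p) + m \<bullet> ((X - Y) *v p)) / 2"
    unfolding p_def m_def using inner_symmetric_matrix[OF assms(1), of \<xi> \<eta>]
      inner_symmetric_matrix[OF assms(2), of \<xi> \<eta>]
    by (simp add: matrix_vector_right_distrib matrix_vector_mult_diff_distrib matrix_vector_mult_diff_rdistrib inner_add_left
        inner_add_right inner_diff_left inner_diff_right)
  have id2: "4 * ((\<xi> \<bullet> z) * (\<eta> \<bullet> z)) = (p \<bullet> z)\<^sup>2 - (m \<bullet> z)\<^sup>2"
    by (simp add: p_def m_def inner_add_left inner_diff_left power2_eq_square algebra_simps)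
  have id3: "4 * (\<xi> \<bullet> \<eta>) = (norm p)\<^sup>2 - (norm m)\<^sup>2"
    by (simp add: p_def m_def power2_norm_eq_inner inner_add_left inner_add_right inner_diff_left
        inner_diff_right inner_commute)
  have proj: "((\<xi> \<bullet> z) * (\<eta> \<bullet> z)) / (norm z)\<^sup>2 \<le> (norm p)\<^sup>2 / 4"
  proof (cases "z = 0")
    case False
    have "(p \<bullet> z)\<^sup>2 \<le> (norm p * norm z)\<^sup>2"
      using Cauchy_Schwarz_ineq2[of p z] by (intro power2_le_iff_abs_le[THEN iffD2]) auto
    then have "4 * ((\<xi> \<bullet> z) * (\<eta> \<bullet> z)) \<le> (norm p)\<^sup>2 * (norm z)\<^sup>2"
      using id2 zero_le_power2[of "m \<bullet> z"] unfolding power_mult_distrib by linarith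
    then show ?thesis using False by (simp add: field_simps)
  qed simp
  \<comment> \<open>The budget in units of |p|^2: the two forms give \<open>\<mu>\<close>, of which
    the mixed term takes \<open>\<mu>\<close> / 2, the projection \<open>\<mu>\<close> / 4, and
    \<open>\<kappa>\<close> / 2 at most \<open>\<mu>\<close> / 4. The multiple of |m|^2 from Young's
    inequality is exactly what the term with \<open>\<kappa>\<close> returns.\<close>
  have "2 * \<epsilon>\<^sup>2 / \<mu> \<le> \<mu>\<^sup>2 / \<mu>" using assms(3,8) by (intro divide_right_mono) auto
  moreover have "\<mu>\<^sup>2 / \<mu> = \<mu>" using assms(3) by (simp add: power2_eq_square)
  ultimately have "\<kappa> \<le> \<mu> / 2" unfolding assms(9) by linarith
  then have "\<kappa> * (norm p)\<^sup>2 \<le> \<mu> / 2 * (norm p)\<^sup>2" by (intro mult_right_mono) auto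
  moreover have "\<epsilon> * norm m * norm p \<le> \<mu> / 2 * (norm p)\<^sup>2 + \<kappa> / 2 * (norm m)\<^sup>2"
  proof -
    have "0 \<le> (\<mu> * norm p - \<epsilon> * norm m)\<^sup>2 / (2 * \<mu>)" using assms(3) by simp
    also have "\<dots> = \<mu> / 2 * (norm p)\<^sup>2 + \<kappa> / 2 * (norm m)\<^sup>2 - \<epsilon> * norm m * norm p"
      using assms(3,9) by (simp add: power2_eq_square field_simps)
    finally show ?thesis by simp
  qed
  moreover have "\<mu> * (norm p)\<^sup>2 \<le> p \<bullet> (X *v p)" "\<mu> * (norm p)\<^sup>2 \<le> p \<bullet> (Y *v p)"
    using assms by auto
  moreover have "\<mu> * (((\<xi> \<bullet> z) * (\<eta> \<bullet> z)) / (norm z)\<^sup>2) \<le> \<mu> * ((norm p)\<^sup>2 / 4)"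
    using proj assms(3) by (intro mult_left_mono) auto
  moreover have "\<kappa> * (4 * (\<xi> \<bullet> \<eta>)) = \<kappa> * (norm p)\<^sup>2 - \<kappa> * (norm m)\<^sup>2"
    by (simp add: id3 right_diff_distrib)
  moreover have "\<mu> * (\<xi> \<bullet> z) * (\<eta> \<bullet> z) / (norm z)\<^sup>2 = \<mu> * (((\<xi> \<bullet> z) * (\<eta> \<bullet> z)) / (norm z)\<^sup>2)"
    by simp
  moreover have "2 * \<kappa> * (\<xi> \<bullet> \<eta>) = \<kappa> * (4 * (\<xi> \<bullet> \<eta>)) / 2" by simp
  moreover have "- (2 * (\<epsilon> * norm m * norm p)) \<le> m \<bullet> ((X - Y) *v p)" using E by linarith
  ultimately show ?thesis unfolding id1 by argo
qed

text \<open>The principal part in nondivergence form: \<open>L_op\<close> is minus this up to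
  first-order terms, see \<open>L_op_expand\<close>.\<close>

definition trace_hess :: "(real^'n::finite \<Rightarrow> real^'n^'n) \<Rightarrow> (real^'n \<Rightarrow> real) \<Rightarrow> real^'n \<Rightarrow> real" where
  "trace_hess a w x = (\<Sum>i\<in>UNIV. \<Sum>j\<in>UNIV. a x $ i $ j * pderiv_dir i (pderiv_dir j w) x)"

lemma sum_UNIV_sum_type:
  "(\<Sum>p\<in>(UNIV :: ('a::finite + 'b::finite) set). g p) = (\<Sum>i\<in>UNIV. g (Inl i)) + (\<Sum>i\<in>UNIV. g (Inr i))"
  by (simp add: UNIV_Plus_UNIV[symmetric] sum.Plus del: UNIV_Plus_UNIV)

lemma DERIV_second_along_line:
  fixes w :: "real^'n::finite \<Rightarrow> real"
  assumes "Ck_on 2 w U" "x \<in> U"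
  shows "((\<lambda>t. \<Sum>i\<in>UNIV. h $ i * pderiv_dir i w (x + t *\<^sub>R h)) has_real_derivative
     (\<Sum>i\<in>UNIV. h $ i * (\<Sum>j\<in>UNIV. h $ j * pderiv_dir j (pderiv_dir i w) x))) (at 0)"
proof (intro DERIV_sum DERIV_cmult)
  fix i :: 'n
  have "pderiv_dir i w differentiable (at (x + 0 *\<^sub>R h))"
    using assms by (simp add: numeral_2_eq_2)
  from DERIV_along_line[OF this]
  show "((\<lambda>t. pderiv_dir i w (x + t *\<^sub>R h)) has_real_derivative
      (\<Sum>j\<in>UNIV. h $ j * pderiv_dir j (pderiv_dir i w) x)) (at 0)" by simp
qed

lemma norm_sq_along_line:
  fixes z \<zeta> :: "'a::real_inner"
  shows "(norm (z + t *\<^sub>R \<zeta>))\<^sup>2 = (norm z)\<^sup>2 + 2 * t * (z \<bullet> \<zeta>) + t\<^sup>2 * (norm \<zeta>)\<^sup>2"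
  unfolding power2_norm_eq_inner
  by (simp add: inner_add_left inner_add_right inner_commute[of \<zeta> z] power2_eq_square algebra_simps)

text \<open>The block matrix with diagonal blocks X, Y and off-diagonal block c lives on the index
  type \<open>'n + 'n\<close>; the two halves of each of its decomposition vectors are the
  simultaneous displacements of x and y. Their differences have the Gram matrix X + Y - 2 c, in
  which only the projection to z and a small multiple of the identity survive.\<close>

lemma gram_of_coupling:
  fixes X Y :: "real^'n::finite^'n"
  assumes "transpose X = X" "transpose Y = Y" "0 < \<mu>"
    and "\<And>\<xi>. \<mu> * (norm \<xi>)\<^sup>2 \<le> \<xi> \<bullet> (X *v \<xi>)" "\<And>\<xi>. \<mu> * (norm \<xi>)\<^sup>2 \<le> \<xi> \<bullet> (Y *v \<xi>)"
    and "\<And>i j. \<bar>X $ i $ j - Y $ i $ j\<bar> \<le> 2 * \<delta>"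
    and "\<epsilon> = \<delta> * (real CARD('n))\<^sup>2" "2 * \<epsilon>\<^sup>2 \<le> \<mu>\<^sup>2" "\<kappa> = \<epsilon>\<^sup>2 / \<mu>"
  obtains \<xi> \<eta> :: "'n + 'n \<Rightarrow> real^'n" where
    "\<And>i j. (\<Sum>k\<in>UNIV. \<xi> k $ i * \<xi> k $ j) = X $ i $ j"
    "\<And>i j. (\<Sum>k\<in>UNIV. \<eta> k $ i * \<eta> k $ j) = Y $ i $ j"
    "\<And>i j. (\<Sum>k\<in>UNIV. (\<xi> k - \<eta> k) $ i * (\<xi> k - \<eta> k) $ j)
        = \<mu> * (z $ i * z $ j) / (norm z)\<^sup>2 + 2 * \<kappa> * (if i = j then 1 else 0)"
proof -
  define c where "c i j = (X $ i $ j + Y $ i $ j) / 2 - \<mu> / 2 * (z $ i * z $ j) / (norm z)\<^sup>2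
      - \<kappa> * (if i = j then 1 else 0)" for i j
  define A where "A p q = (case p of Inl i \<Rightarrow> (case q of Inl j \<Rightarrow> X $ i $ j | Inr j \<Rightarrow> c i j)
      | Inr i \<Rightarrow> (case q of Inl j \<Rightarrow> c i j | Inr j \<Rightarrow> Y $ i $ j))" for p q :: "'n + 'n"
  have symX: "X $ i $ j = X $ j $ i" and symY: "Y $ i $ j = Y $ j $ i" for i j
    using assms(1,2) by (metis transpose_def vec_lambda_beta)+
  have symc: "c i j = c j i" for i j by (simp add: c_def symX[of i] symY[of i] mult.commute)
  have "A p q = A q p" for p q
    by (simp add: A_def symX symY symc split: sum.split)
  moreover have "0 \<le> (\<Sum>p\<in>UNIV. \<Sum>q\<in>UNIV. x p * A p q * x q)" for x
  proof -
    define \<xi> \<eta> where "\<xi> = (\<chi> i. x (Inl i))" and "\<eta> = (\<chi> i. x (Inr i))"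
    have form: "v \<bullet> (M *v u) = (\<Sum>i\<in>UNIV. \<Sum>j\<in>UNIV. v $ i * M $ i $ j * u $ j)" for M :: "real^'n^'n" and v u
      by (simp add: inner_vec_def matrix_vector_mult_def sum_distrib_left mult.assoc)
    have inner_if: "v \<bullet> u = (\<Sum>i\<in>UNIV. \<Sum>j\<in>UNIV. v $ i * (if i = j then 1 else 0) * u $ j)" for v u :: "real^'n"
      by (simp add: inner_vec_def if_distrib[of "\<lambda>u. u * _"] if_distrib[of "\<lambda>u. _ * u"] cong: if_cong)
    have prod: "(v \<bullet> z) * (u \<bullet> z) = (\<Sum>i\<in>UNIV. \<Sum>j\<in>UNIV. v $ i * (z $ i * z $ j) * u $ j)" for v u :: "real^'n"
      unfolding inner_vec_def sum_product by (intro sum.cong refl) simp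
    have cform: "(\<Sum>i\<in>UNIV. \<Sum>j\<in>UNIV. v $ i * c i j * u $ j) = (v \<bullet> (X *v u) + v \<bullet> (Y *v u)) / 2
        - \<mu> / 2 * ((v \<bullet> z) * (u \<bullet> z)) / (norm z)\<^sup>2 - \<kappa> * (v \<bullet> u)" for v u
    proof -
      have "(\<Sum>i\<in>UNIV. \<Sum>j\<in>UNIV. v $ i * c i j * u $ j) = (\<Sum>i\<in>UNIV. \<Sum>j\<in>UNIV.
          1/2 * (v $ i * X $ i $ j * u $ j) + 1/2 * (v $ i * Y $ i $ j * u $ j)
          - \<mu> / 2 / (norm z)\<^sup>2 * (v $ i * (z $ i * z $ j) * u $ j)
          - \<kappa> * (v $ i * (if i = j then 1 else 0) * u $ j))"
        by (intro sum.cong refl) (simp add: c_def field_simps)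
      also have "\<dots> = 1/2 * (v \<bullet> (X *v u)) + 1/2 * (v \<bullet> (Y *v u))
          - \<mu> / 2 / (norm z)\<^sup>2 * ((v \<bullet> z) * (u \<bullet> z)) - \<kappa> * (v \<bullet> u)"
        unfolding form[symmetric] prod[symmetric] inner_if[of v u]
        by (simp only: sum.distrib sum_subtractf sum_distrib_left[symmetric] form[symmetric] prod[symmetric])
      finally show ?thesis by simp
    qed
    have "(\<Sum>p\<in>UNIV. \<Sum>q\<in>UNIV. x p * A p q * x q) = \<xi> \<bullet> (X *v \<xi>) + \<eta> \<bullet> (Y *v \<eta>)
        + (\<Sum>i\<in>UNIV. \<Sum>j\<in>UNIV. \<xi> $ i * c i j * \<eta> $ j) + (\<Sum>i\<in>UNIV. \<Sum>j\<in>UNIV. \<eta> $ i * c i j * \<xi> $ j)"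
      by (simp add: sum_UNIV_sum_type form A_def \<xi>_def \<eta>_def sum.distrib)
    also have "\<dots> = \<xi> \<bullet> (X *v \<xi>) + \<eta> \<bullet> (Y *v \<eta>) + \<xi> \<bullet> (X *v \<eta>) + \<xi> \<bullet> (Y *v \<eta>)
      - \<mu> * (\<xi> \<bullet> z) * (\<eta> \<bullet> z) / (norm z)\<^sup>2 - 2 * \<kappa> * (\<xi> \<bullet> \<eta>)"
      unfolding cform using inner_symmetric_matrix[OF assms(1), of \<xi> \<eta>]
        inner_symmetric_matrix[OF assms(2), of \<xi> \<eta>]
      by (simp add: field_simps inner_commute[of \<eta> \<xi>])
    finally show ?thesis using reflection_coupling_nonneg[OF assms] by simp
  qed
  ultimately obtain v :: "'n + 'n \<Rightarrow> 'n + 'n \<Rightarrow> real"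
    where v: "\<And>p q. A p q = (\<Sum>k\<in>UNIV. v k p * v k q)"
    by (rule psd_decomposition[of A]) auto
  define \<xi> \<eta> where "\<xi> k = (\<chi> i. v k (Inl i))" and "\<eta> k = (\<chi> i. v k (Inr i))" for k
  have "(\<Sum>k\<in>UNIV. \<xi> k $ i * \<xi> k $ j) = X $ i $ j" "(\<Sum>k\<in>UNIV. \<eta> k $ i * \<eta> k $ j) = Y $ i $ j" for i j
    using v[of "Inl i" "Inl j"] v[of "Inr i" "Inr j"] by (simp_all add: A_def \<xi>_def \<eta>_def)
  moreover have "(\<Sum>k\<in>UNIV. (\<xi> k - \<eta> k) $ i * (\<xi> k - \<eta> k) $ j)
        = \<mu> * (z $ i * z $ j) / (norm z)\<^sup>2 + 2 * \<kappa> * (if i = j then 1 else 0)" for i j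
  proof -
    have "(\<Sum>k\<in>UNIV. (\<xi> k - \<eta> k) $ i * (\<xi> k - \<eta> k) $ j)
        = (\<Sum>k\<in>UNIV. v k (Inl i) * v k (Inl j) - v k (Inl i) * v k (Inr j)
            - v k (Inr i) * v k (Inl j) + v k (Inr i) * v k (Inr j))"
      by (intro sum.cong refl) (simp add: \<xi>_def \<eta>_def algebra_simps)
    also have "\<dots> = A (Inl i) (Inl j) - A (Inl i) (Inr j) - A (Inr i) (Inl j) + A (Inr i) (Inr j)"
      unfolding v by (simp only: sum.distrib sum_subtractf)
    also have "\<dots> = \<mu> * (z $ i * z $ j) / (norm z)\<^sup>2 + 2 * \<kappa> * (if i = j then 1 else 0)"
      by (simp add: A_def c_def)
    finally show ?thesis .
  qed
  ultimately show thesis by (rule that)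
qed

text \<open>For s = |z|, b = z \<bullet> v and c = |v|^2 the radicand is |z + t v|^2, so these are
  the first two derivatives of the concave profile |.| - |.|^2 / (8 \<open>\<rho>\<close>) along a
  line. For v parallel to z the singular terms c / s and b^2 / s^3 cancel.\<close>

lemma DERIV_concave_distance:
  fixes s b c \<rho> :: real
  assumes "0 < s" "0 < \<rho>"
  shows "((\<lambda>t. (b + t * c) / sqrt (s\<^sup>2 + 2 * t * b + t\<^sup>2 * c) - (b + t * c) / (4 * \<rho>))
      has_real_derivative c / s - b\<^sup>2 / s ^ 3 - c / (4 * \<rho>)) (at 0)"
    and "0 < s\<^sup>2 + 2 * t * b + t\<^sup>2 * c \<Longrightarrow>
      ((\<lambda>t. sqrt (s\<^sup>2 + 2 * t * b + t\<^sup>2 * c) - (s\<^sup>2 + 2 * t * b + t\<^sup>2 * c) / (8 * \<rho>))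
      has_real_derivative (b + t * c) / sqrt (s\<^sup>2 + 2 * t * b + t\<^sup>2 * c) - (b + t * c) / (4 * \<rho>)) (at t)"
proof -
  show "((\<lambda>t. (b + t * c) / sqrt (s\<^sup>2 + 2 * t * b + t\<^sup>2 * c) - (b + t * c) / (4 * \<rho>))
      has_real_derivative c / s - b\<^sup>2 / s ^ 3 - c / (4 * \<rho>)) (at 0)"
    using assms by (auto intro!: derivative_eq_intros simp: field_simps power2_eq_square power3_eq_cube)
  show "((\<lambda>t. sqrt (s\<^sup>2 + 2 * t * b + t\<^sup>2 * c) - (s\<^sup>2 + 2 * t * b + t\<^sup>2 * c) / (8 * \<rho>))
      has_real_derivative (b + t * c) / sqrt (s\<^sup>2 + 2 * t * b + t\<^sup>2 * c) - (b + t * c) / (4 * \<rho>)) (at t)"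
    if "0 < s\<^sup>2 + 2 * t * b + t\<^sup>2 * c"
    using that by (auto intro!: derivative_eq_intros simp: divide_simps) (simp add: algebra_simps)
qed

text \<open>The second derivative test along a line through (x, y) in the doubled space. Both points
  move, by different vectors, which is what lets the mixed second derivatives of the distance term
  contribute.\<close>

lemma second_order_condition_doubling:
  fixes w :: "real^'n::finite \<Rightarrow> real"
  assumes "open V" "Ck_on 2 w V" "x \<in> V" "y \<in> V" "x \<noteq> y"
    and "0 < \<rho>"
    and max: "\<And>x' y'. x' \<in> V \<Longrightarrow> y' \<in> V \<Longrightarrow>
      w x' - w y' - L * (norm (x' - y') - (norm (x' - y'))\<^sup>2 / (8 * \<rho>)) - K * (norm (x' - x\<^sub>0))\<^sup>2 - K * (norm (y' - x\<^sub>0))\<^sup>2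
      \<le> w x - w y - L * (norm (x - y) - (norm (x - y))\<^sup>2 / (8 * \<rho>)) - K * (norm (x - x\<^sub>0))\<^sup>2 - K * (norm (y - x\<^sub>0))\<^sup>2"
  shows "(\<Sum>i\<in>UNIV. \<xi> $ i * (\<Sum>j\<in>UNIV. \<xi> $ j * pderiv_dir j (pderiv_dir i w) x))
    - (\<Sum>i\<in>UNIV. \<eta> $ i * (\<Sum>j\<in>UNIV. \<eta> $ j * pderiv_dir j (pderiv_dir i w) y))
    - L * ((norm (\<xi> - \<eta>))\<^sup>2 / norm (x - y) - ((x - y) \<bullet> (\<xi> - \<eta>))\<^sup>2 / norm (x - y) ^ 3 - (norm (\<xi> - \<eta>))\<^sup>2 / (4 * \<rho>))
    - K * (2 * (norm \<xi>)\<^sup>2) - K * (2 * (norm \<eta>)\<^sup>2) \<le> 0"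
proof -
  define s b c where "s = norm (x - y)" and "b = (x - y) \<bullet> (\<xi> - \<eta>)" and "c = (norm (\<xi> - \<eta>))\<^sup>2"
  have s: "0 < s" using assms(5) by (simp add: s_def)
  define q where "q = (\<lambda>t. s\<^sup>2 + 2 * t * b + t\<^sup>2 * c)"
  have q: "(norm (x + t *\<^sub>R \<xi> - (y + t *\<^sub>R \<eta>)))\<^sup>2 = q t" for t
    using norm_sq_along_line[of "x - y" t "\<xi> - \<eta>"] by (simp add: q_def s_def b_def c_def algebra_simps)
  then have sq: "norm (x + t *\<^sub>R \<xi> - (y + t *\<^sub>R \<eta>)) = sqrt (q t)" for t
    by (metis norm_ge_zero real_sqrt_abs abs_of_nonneg)
  define g where "g t = w (x + t *\<^sub>R \<xi>) - w (y + t *\<^sub>R \<eta>) - L * (sqrt (q t) - q t / (8 * \<rho>))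
     - K * (norm ((x - x\<^sub>0) + t *\<^sub>R \<xi>))\<^sup>2 - K * (norm ((y - x\<^sub>0) + t *\<^sub>R \<eta>))\<^sup>2" for t
  define g' where "g' t = (\<Sum>i\<in>UNIV. \<xi> $ i * pderiv_dir i w (x + t *\<^sub>R \<xi>))
     - (\<Sum>i\<in>UNIV. \<eta> $ i * pderiv_dir i w (y + t *\<^sub>R \<eta>))
     - L * ((b + t * c) / sqrt (q t) - (b + t * c) / (4 * \<rho>))
     - K * (2 * ((x - x\<^sub>0) \<bullet> \<xi>) + 2 * t * (norm \<xi>)\<^sup>2) - K * (2 * ((y - x\<^sub>0) \<bullet> \<eta>) + 2 * t * (norm \<eta>)\<^sup>2)" for t
  \<comment> \<open>Besides staying in V, the pair must not meet the diagonal, where the distance is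
    not differentiable.\<close>
  have "open ((\<lambda>t. x + t *\<^sub>R \<xi>) -` V \<inter> (\<lambda>t. y + t *\<^sub>R \<eta>) -` V \<inter> q -` {0<..})"
    unfolding q_def by (intro open_Int open_vimage assms(1) continuous_intros open_greaterThan)
  moreover have "0 \<in> (\<lambda>t. x + t *\<^sub>R \<xi>) -` V \<inter> (\<lambda>t. y + t *\<^sub>R \<eta>) -` V \<inter> q -` {0<..}"
    using assms(3,4) s by (simp add: q_def)
  ultimately obtain d where d: "0 < d" and
    "ball 0 d \<subseteq> (\<lambda>t. x + t *\<^sub>R \<xi>) -` V \<inter> (\<lambda>t. y + t *\<^sub>R \<eta>) -` V \<inter> q -` {0<..}"
    using open_contains_ball by blast
  then have dV: "x + t *\<^sub>R \<xi> \<in> V" "y + t *\<^sub>R \<eta> \<in> V" "0 < q t" if "\<bar>t\<bar> < d" for t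
    using that by (auto simp: subset_iff)
  have K: "((\<lambda>t. K * (norm (z + t *\<^sub>R v))\<^sup>2) has_real_derivative K * (2 * (z \<bullet> v) + 2 * t * (norm v)\<^sup>2)) (at t)"
    for z v :: "real^'n" and t
    unfolding norm_sq_along_line by (auto intro!: derivative_eq_intros simp: algebra_simps)
  have diff: "w differentiable (at z)" if "z \<in> V" for z
    using assms(2) that by (simp add: numeral_2_eq_2)
  have "(g has_real_derivative g' t) (at t)" if "\<bar>t\<bar> < d" for t
    unfolding g_def g'_def
    using DERIV_diff[OF DERIV_diff[OF DERIV_diff[OF DERIV_diff[OF
      DERIV_along_line[OF diff[OF dV(1)[OF that]]] DERIV_along_line[OF diff[OF dV(2)[OF that]]]]
      DERIV_cmult[OF DERIV_concave_distance(2)[OF s assms(6) dV(3)[OF that, unfolded q_def]], of L]] K] K]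
    by (simp only: q_def)
  moreover have "g t \<le> g 0" if "\<bar>t\<bar> < d" for t
    using max[OF dV(1,2)[OF that]] sq[of t] q[of t] sq[of 0] q[of 0] unfolding g_def by (simp add: algebra_simps)
  moreover have "(g' has_real_derivative
     (\<Sum>i\<in>UNIV. \<xi> $ i * (\<Sum>j\<in>UNIV. \<xi> $ j * pderiv_dir j (pderiv_dir i w) x))
    - (\<Sum>i\<in>UNIV. \<eta> $ i * (\<Sum>j\<in>UNIV. \<eta> $ j * pderiv_dir j (pderiv_dir i w) y))
    - L * (c / s - b\<^sup>2 / s ^ 3 - c / (4 * \<rho>))
    - K * (2 * (norm \<xi>)\<^sup>2) - K * (2 * (norm \<eta>)\<^sup>2)) (at 0)"
    unfolding g'_def
  proof -
    have lin: "((\<lambda>t. K * (2 * e + 2 * t * m)) has_real_derivative K * (2 * m)) (at 0)" for e m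
      by (auto intro!: derivative_eq_intros)
    show "((\<lambda>t. (\<Sum>i\<in>UNIV. \<xi> $ i * pderiv_dir i w (x + t *\<^sub>R \<xi>))
     - (\<Sum>i\<in>UNIV. \<eta> $ i * pderiv_dir i w (y + t *\<^sub>R \<eta>))
     - L * ((b + t * c) / sqrt (q t) - (b + t * c) / (4 * \<rho>))
     - K * (2 * ((x - x\<^sub>0) \<bullet> \<xi>) + 2 * t * (norm \<xi>)\<^sup>2) - K * (2 * ((y - x\<^sub>0) \<bullet> \<eta>) + 2 * t * (norm \<eta>)\<^sup>2))
     has_real_derivative
     (\<Sum>i\<in>UNIV. \<xi> $ i * (\<Sum>j\<in>UNIV. \<xi> $ j * pderiv_dir j (pderiv_dir i w) x))
    - (\<Sum>i\<in>UNIV. \<eta> $ i * (\<Sum>j\<in>UNIV. \<eta> $ j * pderiv_dir j (pderiv_dir i w) y))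
    - L * (c / s - b\<^sup>2 / s ^ 3 - c / (4 * \<rho>))
    - K * (2 * (norm \<xi>)\<^sup>2) - K * (2 * (norm \<eta>)\<^sup>2)) (at 0)"
      using DERIV_diff[OF DERIV_diff[OF DERIV_diff[OF DERIV_diff[OF
        DERIV_second_along_line[OF assms(2,3)] DERIV_second_along_line[OF assms(2,4)]]
        DERIV_cmult[OF DERIV_concave_distance(1)[OF s assms(6)], of L]] lin] lin]
      by (simp only: q_def)
  qed
  ultimately show ?thesis
    using second_derivative_local_max[OF d] unfolding s_def b_def c_def by blast
qed

text \<open>Summed over the vectors of a decomposition, second derivatives along lines become a
  trace against the decomposed matrix. The next two lemmas do the same for the squared lengths and
  for the components along z.\<close>

lemma sum_gram_quadratic:
  fixes \<xi> :: "'k::finite \<Rightarrow> real^'n::finite"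
  assumes "\<And>i j. (\<Sum>k\<in>UNIV. \<xi> k $ i * \<xi> k $ j) = M i j"
  shows "(\<Sum>k\<in>UNIV. \<Sum>i\<in>UNIV. \<xi> k $ i * (\<Sum>j\<in>UNIV. \<xi> k $ j * P j i)) = (\<Sum>i\<in>UNIV. \<Sum>j\<in>UNIV. M i j * P j i)"
proof -
  have "(\<Sum>k\<in>UNIV. \<Sum>i\<in>UNIV. \<xi> k $ i * (\<Sum>j\<in>UNIV. \<xi> k $ j * P j i))
      = (\<Sum>k\<in>UNIV. \<Sum>i\<in>UNIV. \<Sum>j\<in>UNIV. \<xi> k $ i * \<xi> k $ j * P j i)"
    by (simp add: sum_distrib_left mult.assoc)
  also have "\<dots> = (\<Sum>i\<in>UNIV. \<Sum>k\<in>UNIV. \<Sum>j\<in>UNIV. \<xi> k $ i * \<xi> k $ j * P j i)"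
    by (rule sum.swap)
  also have "\<dots> = (\<Sum>i\<in>UNIV. \<Sum>j\<in>UNIV. \<Sum>k\<in>UNIV. \<xi> k $ i * \<xi> k $ j * P j i)"
    by (intro sum.cong refl sum.swap)
  also have "\<dots> = (\<Sum>i\<in>UNIV. \<Sum>j\<in>UNIV. M i j * P j i)"
    by (simp add: sum_distrib_right[symmetric] assms)
  finally show ?thesis .
qed

lemma sum_gram_norm:
  fixes \<xi> :: "'k::finite \<Rightarrow> real^'n::finite"
  assumes "\<And>i j. (\<Sum>k\<in>UNIV. \<xi> k $ i * \<xi> k $ j) = M i j"
  shows "(\<Sum>k\<in>UNIV. (norm (\<xi> k))\<^sup>2) = (\<Sum>i\<in>UNIV. M i i)"
  using assms sum.swap[of "\<lambda>k i. \<xi> k $ i * \<xi> k $ i" UNIV UNIV]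
  by (simp add: power2_norm_eq_inner inner_vec_def)

lemma sum_gram_inner:
  fixes \<xi> :: "'k::finite \<Rightarrow> real^'n::finite"
  assumes "\<And>i j. (\<Sum>k\<in>UNIV. \<xi> k $ i * \<xi> k $ j) = M i j"
  shows "(\<Sum>k\<in>UNIV. (z \<bullet> \<xi> k)\<^sup>2) = (\<Sum>i\<in>UNIV. \<Sum>j\<in>UNIV. M i j * (z $ j * z $ i))"
proof -
  have "(z \<bullet> \<xi> k)\<^sup>2 = (\<Sum>i\<in>UNIV. \<xi> k $ i * (\<Sum>j\<in>UNIV. \<xi> k $ j * (z $ j * z $ i)))" for k
    unfolding inner_vec_def power2_eq_square sum_product by (simp add: sum_distrib_left ac_simps)
  then show ?thesis using sum_gram_quadratic[OF assms, of "\<lambda>j i. z $ j * z $ i"] by simp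
qed

definition coeff_bounds :: "real \<Rightarrow> real \<Rightarrow> real \<Rightarrow> (real^'n::finite \<Rightarrow> real^'n^'n) \<Rightarrow> (real^'n) set \<Rightarrow> bool" where
  "coeff_bounds \<mu> \<Lambda> \<tau> a B \<longleftrightarrow> 0 < \<mu> \<and> 0 \<le> \<Lambda> \<and> 0 \<le> \<tau> \<and>
     (\<forall>x\<in>B. transpose (a x) = a x \<and> (\<forall>\<xi>. \<mu> * (norm \<xi>)\<^sup>2 \<le> \<xi> \<bullet> (a x *v \<xi>)) \<and> (\<forall>i j. \<bar>a x $ i $ j\<bar> \<le> \<Lambda>)) \<and>
     (\<forall>x\<in>B. \<forall>y\<in>B. \<forall>i j. \<bar>a x $ i $ j - a y $ i $ j\<bar> \<le> \<tau> * norm (x - y))"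

lemma trace_hess_swap:
  assumes "transpose (a x) = a x"
  shows "(\<Sum>i\<in>UNIV. \<Sum>j\<in>UNIV. a x $ i $ j * pderiv_dir j (pderiv_dir i w) x) = trace_hess a w x"
proof -
  have "a x $ i $ j = a x $ j $ i" for i j using assms by (metis transpose_def vec_lambda_beta)
  then have "(\<Sum>i\<in>UNIV. \<Sum>j\<in>UNIV. a x $ i $ j * pderiv_dir j (pderiv_dir i w) x)
      = (\<Sum>i\<in>UNIV. \<Sum>j\<in>UNIV. a x $ j $ i * pderiv_dir j (pderiv_dir i w) x)" by simp
  also have "\<dots> = trace_hess a w x" unfolding trace_hess_def by (rule sum.swap)
  finally show ?thesis .
qed

text \<open>At an interior maximum the second-order conditions are summed over the decomposition
  vectors. In c / s - b^2 / s^3 the reflected part, of size \<open>\<mu>\<close> along x - y,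
  cancels and only the error 2 \<open>\<kappa>\<close> (n - 1) / s remains, while the square in the
  profile yields \<open>\<mu>\<close> / (4 \<open>\<rho>\<close>). Half of this absorbs the error,
  and the other half bounds L by the trace terms, against the choice of L.\<close>

lemma doubling_no_interior_max:
  fixes w :: "real^'n::finite \<Rightarrow> real"
  assumes a: "coeff_bounds \<mu> \<Lambda> \<tau> a V" and V: "open V" "Ck_on 2 w V" "x \<in> V" "y \<in> V" "x \<noteq> y"
    and \<rho>: "0 < \<rho>" "norm (x - y) \<le> \<rho>" "3 * \<tau> * (real CARD('n)) ^ 3 * \<rho> \<le> \<mu>"
    and R: "\<bar>trace_hess a w x\<bar> \<le> R" "\<bar>trace_hess a w y\<bar> \<le> R" and "0 \<le> K"
    and L: "0 < L" "8 * \<rho> / \<mu> * (2 * R + 4 * K * (real CARD('n) * \<Lambda>)) < L"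
    and max: "\<And>x' y'. x' \<in> V \<Longrightarrow> y' \<in> V \<Longrightarrow>
      w x' - w y' - L * (norm (x' - y') - (norm (x' - y'))\<^sup>2 / (8 * \<rho>)) - K * (norm (x' - x\<^sub>0))\<^sup>2 - K * (norm (y' - x\<^sub>0))\<^sup>2
      \<le> w x - w y - L * (norm (x - y) - (norm (x - y))\<^sup>2 / (8 * \<rho>)) - K * (norm (x - x\<^sub>0))\<^sup>2 - K * (norm (y - x\<^sub>0))\<^sup>2"
  shows False
proof -
  define n s z where "n = real CARD('n)" and "s = norm (x - y)" and "z = x - y"
  \<comment> \<open>\<open>gram_of_coupling\<close> allows the entries to differ by 2
    \<open>\<delta>\<close>, so \<open>\<delta>\<close> is \<open>\<tau>\<close> s / 2 here.\<close>
  define \<epsilon> \<kappa> where "\<epsilon> = (\<tau> * s / 2) * n\<^sup>2" and "\<kappa> = \<epsilon>\<^sup>2 / \<mu>"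
  have n: "1 \<le> n" unfolding n_def by simp
  have s: "0 < s" "s \<le> \<rho>" using V(5) \<rho>(2) by (simp_all add: s_def)
  have \<mu>: "0 < \<mu>" and \<tau>: "0 \<le> \<tau>" and ax: "transpose (a x) = a x" "\<And>\<xi>. \<mu> * (norm \<xi>)\<^sup>2 \<le> \<xi> \<bullet> (a x *v \<xi>)"
      "\<And>i j. \<bar>a x $ i $ j\<bar> \<le> \<Lambda>"
    and ay: "transpose (a y) = a y" "\<And>\<xi>. \<mu> * (norm \<xi>)\<^sup>2 \<le> \<xi> \<bullet> (a y *v \<xi>)" "\<And>i j. \<bar>a y $ i $ j\<bar> \<le> \<Lambda>"
    and axy: "\<And>i j. \<bar>a x $ i $ j - a y $ i $ j\<bar> \<le> 2 * (\<tau> * s / 2)"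
    using a V(3,4) by (auto simp: coeff_bounds_def s_def)
  \<comment> \<open>One crude smallness condition serves twice: it gives 2
    \<open>\<epsilon>\<close>^2 \<le> \<open>\<mu>\<close>^2 for the coupling, and, as 1/9 \<le>
    1/4, the bound that absorbs 2 \<open>\<kappa>\<close> n / s.\<close>
  have small: "(3 * \<tau> * n ^ 3 * \<rho>)\<^sup>2 \<le> \<mu>\<^sup>2"
    using \<rho> \<tau> n unfolding n_def by (intro power_mono) auto
  have n5: "\<tau>\<^sup>2 * \<rho>\<^sup>2 * n ^ 5 \<le> \<tau>\<^sup>2 * \<rho>\<^sup>2 * n ^ 6" "\<tau>\<^sup>2 * \<rho>\<^sup>2 * n ^ 4 \<le> \<tau>\<^sup>2 * \<rho>\<^sup>2 * n ^ 6"
    using n by (intro mult_left_mono power_increasing; simp)+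
  have small': "9 * (\<tau>\<^sup>2 * \<rho>\<^sup>2 * n ^ 6) \<le> \<mu>\<^sup>2" using small by (simp add: power_mult_distrib power_mult[symmetric] ac_simps)
  have "\<epsilon>\<^sup>2 = \<tau>\<^sup>2 * s\<^sup>2 * n ^ 4 / 4"
    by (simp add: \<epsilon>_def power_mult_distrib power_divide power_mult[symmetric])
  have \<epsilon>2: "\<tau>\<^sup>2 * s\<^sup>2 * n ^ 4 \<le> \<tau>\<^sup>2 * \<rho>\<^sup>2 * n ^ 4"
    using s n by (intro mult_right_mono mult_left_mono power_mono) auto
  have "2 * \<epsilon>\<^sup>2 \<le> \<mu>\<^sup>2"
    unfolding \<open>\<epsilon>\<^sup>2 = _\<close> using \<epsilon>2 n5 small' zero_le_power2[of \<mu>] by linarith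
  then obtain \<xi> \<eta> :: "'n + 'n \<Rightarrow> real^'n" where
    gram: "\<And>i j. (\<Sum>k\<in>UNIV. \<xi> k $ i * \<xi> k $ j) = a x $ i $ j"
    "\<And>i j. (\<Sum>k\<in>UNIV. \<eta> k $ i * \<eta> k $ j) = a y $ i $ j"
    "\<And>i j. (\<Sum>k\<in>UNIV. (\<xi> k - \<eta> k) $ i * (\<xi> k - \<eta> k) $ j)
        = \<mu> * (z $ i * z $ j) / (norm z)\<^sup>2 + 2 * \<kappa> * (if i = j then 1 else 0)"
    using gram_of_coupling[OF ax(1) ay(1) \<mu> ax(2) ay(2) axy, of \<epsilon> \<kappa> z] by (auto simp: \<epsilon>_def \<kappa>_def n_def)
  have nz: "(\<Sum>i\<in>UNIV. z $ i * z $ i) = (norm z)\<^sup>2" "norm z = s"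
    by (simp_all add: power2_norm_eq_inner inner_vec_def z_def s_def)
  have C: "(\<Sum>k\<in>UNIV. (norm (\<xi> k - \<eta> k))\<^sup>2) = \<mu> + 2 * \<kappa> * n"
    using sum_gram_norm[OF gram(3)] nz s by (simp add: sum.distrib sum_divide_distrib[symmetric]
        sum_distrib_left[symmetric] n_def)
  have Bq: "(\<Sum>k\<in>UNIV. (z \<bullet> (\<xi> k - \<eta> k))\<^sup>2) = (\<mu> + 2 * \<kappa>) * s\<^sup>2"
  proof -
    have "(\<Sum>k\<in>UNIV. (z \<bullet> (\<xi> k - \<eta> k))\<^sup>2)
        = (\<Sum>i\<in>UNIV. \<Sum>j\<in>UNIV. (\<mu> * (z $ i * z $ j) / (norm z)\<^sup>2 + 2 * \<kappa> * (if i = j then 1 else 0)) * (z $ j * z $ i))"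
      using sum_gram_inner[OF gram(3)] by simp
    also have "\<dots> = (\<Sum>i\<in>UNIV. \<Sum>j\<in>UNIV. \<mu> / (norm z)\<^sup>2 * ((z $ i * z $ i) * (z $ j * z $ j))
        + 2 * \<kappa> * (if i = j then z $ j * z $ i else 0))"
      by (intro sum.cong refl) (simp add: field_simps)
    also have "\<dots> = \<mu> / (norm z)\<^sup>2 * ((\<Sum>i\<in>UNIV. z $ i * z $ i) * (\<Sum>j\<in>UNIV. z $ j * z $ j))
        + 2 * \<kappa> * (\<Sum>i\<in>UNIV. z $ i * z $ i)"
      unfolding sum_product by (simp add: sum.distrib sum_distrib_left sum_divide_distrib if_distrib[of "\<lambda>u. 2 * \<kappa> * u"] cong: if_cong)
    also have "\<dots> = (\<mu> + 2 * \<kappa>) * s\<^sup>2" using s nz by (simp add: field_simps power2_eq_square)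
    finally show ?thesis .
  qed
  have trX: "(\<Sum>k\<in>UNIV. (norm (\<xi> k))\<^sup>2) \<le> n * \<Lambda>"
    unfolding sum_gram_norm[of \<xi>, OF gram(1)] using ax(3) sum_bounded_above[of UNIV "\<lambda>i. a x $ i $ i" \<Lambda>]
    by (simp add: n_def abs_le_iff)
  have trY: "(\<Sum>k\<in>UNIV. (norm (\<eta> k))\<^sup>2) \<le> n * \<Lambda>"
    unfolding sum_gram_norm[of \<eta>, OF gram(2)] using ay(3) sum_bounded_above[of UNIV "\<lambda>i. a y $ i $ i" \<Lambda>]
    by (simp add: n_def abs_le_iff)
  have "(\<Sum>k\<in>UNIV. (\<Sum>i\<in>UNIV. \<xi> k $ i * (\<Sum>j\<in>UNIV. \<xi> k $ j * pderiv_dir j (pderiv_dir i w) x))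
    - (\<Sum>i\<in>UNIV. \<eta> k $ i * (\<Sum>j\<in>UNIV. \<eta> k $ j * pderiv_dir j (pderiv_dir i w) y))
    - L * ((norm (\<xi> k - \<eta> k))\<^sup>2 / s - (z \<bullet> (\<xi> k - \<eta> k))\<^sup>2 / s ^ 3 - (norm (\<xi> k - \<eta> k))\<^sup>2 / (4 * \<rho>))
    - K * (2 * (norm (\<xi> k))\<^sup>2) - K * (2 * (norm (\<eta> k))\<^sup>2)) \<le> 0"
    using second_order_condition_doubling[OF V \<rho>(1) max] unfolding s_def z_def by (intro sum_nonpos) blast
  also have "(\<Sum>k\<in>UNIV. (\<Sum>i\<in>UNIV. \<xi> k $ i * (\<Sum>j\<in>UNIV. \<xi> k $ j * pderiv_dir j (pderiv_dir i w) x))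
    - (\<Sum>i\<in>UNIV. \<eta> k $ i * (\<Sum>j\<in>UNIV. \<eta> k $ j * pderiv_dir j (pderiv_dir i w) y))
    - L * ((norm (\<xi> k - \<eta> k))\<^sup>2 / s - (z \<bullet> (\<xi> k - \<eta> k))\<^sup>2 / s ^ 3 - (norm (\<xi> k - \<eta> k))\<^sup>2 / (4 * \<rho>))
    - K * (2 * (norm (\<xi> k))\<^sup>2) - K * (2 * (norm (\<eta> k))\<^sup>2))
    = trace_hess a w x - trace_hess a w y - L * ((\<mu> + 2 * \<kappa> * n) / s - (\<mu> + 2 * \<kappa>) * s\<^sup>2 / s ^ 3 - (\<mu> + 2 * \<kappa> * n) / (4 * \<rho>))
    - K * (2 * (\<Sum>k\<in>UNIV. (norm (\<xi> k))\<^sup>2)) - K * (2 * (\<Sum>k\<in>UNIV. (norm (\<eta> k))\<^sup>2))"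
    unfolding sum_subtractf sum_distrib_left[symmetric] sum_divide_distrib[symmetric] C Bq
      sum_gram_quadratic[of \<xi>, OF gram(1)] sum_gram_quadratic[of \<eta>, OF gram(2)]
      trace_hess_swap[of a x, OF ax(1)] trace_hess_swap[of a y, OF ay(1)] ..
  finally have main: "trace_hess a w x - trace_hess a w y - L * ((\<mu> + 2 * \<kappa> * n) / s - (\<mu> + 2 * \<kappa>) * s\<^sup>2 / s ^ 3 - (\<mu> + 2 * \<kappa> * n) / (4 * \<rho>))
    - K * (2 * (\<Sum>k\<in>UNIV. (norm (\<xi> k))\<^sup>2)) - K * (2 * (\<Sum>k\<in>UNIV. (norm (\<eta> k))\<^sup>2)) \<le> 0" .
  have \<kappa>: "0 \<le> \<kappa>" using \<mu> by (simp add: \<kappa>_def)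
  have "2 * \<kappa> * n / s \<le> \<mu> / (8 * \<rho>)"
  proof -
    have "2 * \<kappa> * n / s = \<tau>\<^sup>2 * s * n ^ 5 / (2 * \<mu>)"
      unfolding \<kappa>_def \<open>\<epsilon>\<^sup>2 = _\<close> using s \<mu> by (simp add: field_simps power2_eq_square eval_nat_numeral)
    also have "\<dots> \<le> \<tau>\<^sup>2 * \<rho> * n ^ 5 / (2 * \<mu>)"
      using s n \<mu> by (intro divide_right_mono mult_right_mono mult_left_mono) auto
    also have "\<dots> = (\<tau>\<^sup>2 * \<rho>\<^sup>2 * n ^ 5) / (2 * \<mu> * \<rho>)" using \<rho>(1) by (simp add: power2_eq_square)
    also have "\<dots> \<le> (\<mu>\<^sup>2 / 4) / (2 * \<mu> * \<rho>)"
    proof (rule divide_right_mono)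
      show "\<tau>\<^sup>2 * \<rho>\<^sup>2 * n ^ 5 \<le> \<mu>\<^sup>2 / 4" using n5(1) small' zero_le_power2[of \<mu>] by linarith
    qed (use \<mu> \<rho>(1) in simp)
    also have "\<dots> = \<mu> / (8 * \<rho>)" using \<mu> by (simp add: power2_eq_square)
    finally show ?thesis .
  qed
  moreover have "(\<mu> + 2 * \<kappa>) * s\<^sup>2 / s ^ 3 = (\<mu> + 2 * \<kappa>) / s"
    using s by (simp add: power2_eq_square power3_eq_cube)
  moreover have "(\<mu> + 2 * \<kappa> * n) / s - (\<mu> + 2 * \<kappa>) / s = 2 * \<kappa> * n / s - 2 * \<kappa> / s"
    by (simp add: diff_divide_distrib add_divide_distrib)
  moreover have "0 \<le> 2 * \<kappa> / s" using \<kappa> s by simp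
  moreover have "(\<mu> + 2 * \<kappa> * n) / (4 * \<rho>) = 2 * (\<mu> / (8 * \<rho>)) + 2 * \<kappa> * n / (4 * \<rho>)"
    by (simp add: add_divide_distrib)
  moreover have "0 \<le> 2 * \<kappa> * n / (4 * \<rho>)" using \<kappa> n \<rho>(1) by simp
  ultimately have "(\<mu> + 2 * \<kappa> * n) / s - (\<mu> + 2 * \<kappa>) * s\<^sup>2 / s ^ 3 - (\<mu> + 2 * \<kappa> * n) / (4 * \<rho>) \<le> - (\<mu> / (8 * \<rho>))"
    by linarith
  then have "L * ((\<mu> + 2 * \<kappa> * n) / s - (\<mu> + 2 * \<kappa>) * s\<^sup>2 / s ^ 3 - (\<mu> + 2 * \<kappa> * n) / (4 * \<rho>)) \<le> L * (- (\<mu> / (8 * \<rho>)))"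
    using L(1) by (intro mult_left_mono) auto
  moreover have "K * (2 * (\<Sum>k\<in>UNIV. (norm (\<xi> k))\<^sup>2)) \<le> K * (2 * (n * \<Lambda>))"
    "K * (2 * (\<Sum>k\<in>UNIV. (norm (\<eta> k))\<^sup>2)) \<le> K * (2 * (n * \<Lambda>))"
    using trX trY assms(12) by (intro mult_left_mono; linarith)+
  moreover have "4 * K * (n * \<Lambda>) = 2 * (K * (2 * (n * \<Lambda>)))" by simp
  ultimately have "L * (\<mu> / (8 * \<rho>)) \<le> 2 * R + 4 * K * (n * \<Lambda>)"
    using main R mult_minus_right[of L "\<mu> / (8 * \<rho>)"] unfolding abs_le_iff
    by linarith
  then show False using L(2) \<mu> \<rho>(1) unfolding n_def by (simp add: field_simps)
qed

text \<open>The doubled function G is maximised over a product of closed half balls. A positive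
  maximum would lie off the diagonal, and in the interior because the localising term reaches 2 W, a
  bound for w y - w z, on the boundary; \<open>doubling_no_interior_max\<close> excludes this. The
  claim follows from G (x, \<open>x\<^sub>0\<close>) \<le> 0.\<close>

lemma one_sided_growth_bound:
  fixes w :: "real^'n::finite \<Rightarrow> real"
  assumes a: "coeff_bounds \<mu> \<Lambda> \<tau> a (ball x\<^sub>0 \<rho>)" and w: "Ck_on 2 w (ball x\<^sub>0 \<rho>)"
    and \<rho>: "0 < \<rho>" "3 * \<tau> * (real CARD('n)) ^ 3 * \<rho> \<le> \<mu>"
    and W: "\<And>x. x \<in> ball x\<^sub>0 \<rho> \<Longrightarrow> \<bar>w x\<bar> \<le> W"
    and R: "\<And>x. x \<in> ball x\<^sub>0 \<rho> \<Longrightarrow> \<bar>trace_hess a w x\<bar> \<le> R"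
    and K: "K = 8 * W / \<rho>\<^sup>2"
    and L: "8 * \<rho> / \<mu> * (2 * R + 4 * K * (real CARD('n) * \<Lambda>)) < L"
    and x: "x \<in> cball x\<^sub>0 (\<rho> / 2)"
  shows "w x - w x\<^sub>0 \<le> L * norm (x - x\<^sub>0) + K * (norm (x - x\<^sub>0))\<^sup>2"
proof -
  define f where "f s = s - s\<^sup>2 / (8 * \<rho>)" for s
  define G where "G p = w (fst p) - w (snd p) - L * f (norm (fst p - snd p)) - K * (norm (fst p - x\<^sub>0))\<^sup>2
      - K * (norm (snd p - x\<^sub>0))\<^sup>2" for p
  define D where "D = cball x\<^sub>0 (\<rho> / 2) \<times> cball x\<^sub>0 (\<rho> / 2)"
  have W0: "0 \<le> W" and R0: "0 \<le> R" and pos: "0 < \<mu>" "0 \<le> \<Lambda>"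
    using W[of x\<^sub>0] R[of x\<^sub>0] \<rho>(1) a by (auto simp: coeff_bounds_def)
  have K0: "0 \<le> K" using W0 by (simp add: K)
  have L0: "0 < L"
    using R0 K0 pos \<rho>(1) by (intro le_less_trans[OF _ L]) simp
  have sub: "cball x\<^sub>0 (\<rho> / 2) \<subseteq> ball x\<^sub>0 \<rho>" using \<rho>(1) by auto
  have contw: "continuous_on (cball x\<^sub>0 (\<rho> / 2)) w"
    using continuous_on_subset[OF Ck_on_imp_continuous_on[OF w] sub] .
  have "continuous_on D (\<lambda>p. w (fst p))" "continuous_on D (\<lambda>p. w (snd p))"
    by (auto intro!: continuous_on_compose2[OF contw] continuous_intros simp: D_def)
  then have "continuous_on D G" unfolding G_def f_def
    using \<rho>(1) by (auto intro!: continuous_intros)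
  moreover have "compact D" "D \<noteq> {}" unfolding D_def using \<rho>(1) by (auto intro: compact_Times)
  ultimately obtain p where p: "p \<in> D" "\<And>q. q \<in> D \<Longrightarrow> G q \<le> G p"
    using continuous_attains_sup[of D G] by blast
  obtain y z where yz: "p = (y, z)" by (cases p)
  have y: "y \<in> cball x\<^sub>0 (\<rho> / 2)" and z: "z \<in> cball x\<^sub>0 (\<rho> / 2)" using p(1) by (auto simp: D_def yz)
  have dist: "norm (y' - z') \<le> \<rho>" if "y' \<in> cball x\<^sub>0 (\<rho> / 2)" "z' \<in> cball x\<^sub>0 (\<rho> / 2)" for y' z'
    using that dist_triangle2[of y' z' x\<^sub>0] unfolding dist_norm[symmetric]
    by (simp add: dist_commute)
  have f_bounds: "0 \<le> f s" "f s \<le> s" if "0 \<le> s" "s \<le> \<rho>" for s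
  proof -
    have "s * s \<le> s * (8 * \<rho>)" using that \<rho>(1) by (intro mult_left_mono) auto
    then show "0 \<le> f s" using \<rho>(1) by (simp add: f_def field_simps power2_eq_square)
    show "f s \<le> s" using \<rho>(1) by (simp add: f_def)
  qed
  have "G p \<le> 0"
  proof (rule ccontr)
    assume "\<not> G p \<le> 0"
    then have G: "0 < G (y, z)" by (simp add: yz)
    have "y \<noteq> z"
    proof
      assume "y = z"
      then have "G (y, z) = - (2 * K * (norm (z - x\<^sub>0))\<^sup>2)" by (simp add: G_def f_def)
      then show False using G mult_nonneg_nonneg[OF K0 zero_le_power2[of "norm (z - x\<^sub>0)"]] by linarith
    qed
    have fn: "0 \<le> L * f (norm (y - z))" using f_bounds(1) dist[OF y z] L0 by simp
    have WW: "w y - w z \<le> 2 * W" using W[of y] W[of z] y z sub by (smt (verit) subsetD)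
    have bd: "norm (v - x\<^sub>0) < \<rho> / 2" if "K * (norm (v - x\<^sub>0))\<^sup>2 < 2 * W" for v
    proof (rule ccontr)
      assume "\<not> ?thesis"
      then have "(\<rho> / 2)\<^sup>2 \<le> (norm (v - x\<^sub>0))\<^sup>2" using \<rho>(1) by (intro power_mono) auto
      then have "K * (\<rho> / 2)\<^sup>2 \<le> K * (norm (v - x\<^sub>0))\<^sup>2" using K0 by (rule mult_left_mono)
      moreover have "K * (\<rho> / 2)\<^sup>2 = 2 * W" using \<rho>(1) by (simp add: K power2_eq_square)
      ultimately show False using that by simp
    qed
    have KK: "0 \<le> K * (norm (y - x\<^sub>0))\<^sup>2" "0 \<le> K * (norm (z - x\<^sub>0))\<^sup>2" using K0 by auto
    have "norm (y - x\<^sub>0) < \<rho> / 2" "norm (z - x\<^sub>0) < \<rho> / 2"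
      using G fn WW KK unfolding G_def fst_conv snd_conv by (intro bd; linarith)+
    then have yzb: "y \<in> ball x\<^sub>0 (\<rho> / 2)" "z \<in> ball x\<^sub>0 (\<rho> / 2)"
      by (simp_all add: dist_norm norm_minus_commute)
    have subb: "ball x\<^sub>0 (\<rho> / 2) \<subseteq> ball x\<^sub>0 \<rho>" using \<rho>(1) by auto
    have ab: "coeff_bounds \<mu> \<Lambda> \<tau> a (ball x\<^sub>0 (\<rho> / 2))"
      using a subb unfolding coeff_bounds_def by (meson subsetD)
    show False
    proof (rule doubling_no_interior_max[OF ab _ Ck_on_subset[OF w subb] yzb \<open>y \<noteq> z\<close> \<rho>(1) dist[OF y z] \<rho>(2) R R K0 L0 L])
      fix y' z' assume "y' \<in> ball x\<^sub>0 (\<rho> / 2)" "z' \<in> ball x\<^sub>0 (\<rho> / 2)"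
      then have "G (y', z') \<le> G (y, z)" using p(2)[of "(y', z')"] by (auto simp: D_def yz)
      then show "w y' - w z' - L * (norm (y' - z') - (norm (y' - z'))\<^sup>2 / (8 * \<rho>)) - K * (norm (y' - x\<^sub>0))\<^sup>2 - K * (norm (z' - x\<^sub>0))\<^sup>2
      \<le> w y - w z - L * (norm (y - z) - (norm (y - z))\<^sup>2 / (8 * \<rho>)) - K * (norm (y - x\<^sub>0))\<^sup>2 - K * (norm (z - x\<^sub>0))\<^sup>2"
        by (simp add: G_def f_def)
    qed (use yzb subb in auto)
  qed
  moreover have "G (x, x\<^sub>0) \<le> G p" using x \<rho>(1) by (intro p(2)) (simp add: D_def)
  ultimately have "w x - w x\<^sub>0 \<le> L * f (norm (x - x\<^sub>0)) + K * (norm (x - x\<^sub>0))\<^sup>2" by (simp add: G_def)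
  moreover have "L * f (norm (x - x\<^sub>0)) \<le> L * norm (x - x\<^sub>0)"
    using f_bounds(2)[of "norm (x - x\<^sub>0)"] dist[OF x, of x\<^sub>0] \<rho>(1) L0 by simp
  ultimately show ?thesis by linarith
qed

text \<open>The quadratic term of the one-sided bound disappears in the derivative at
  \<open>x\<^sub>0\<close>. With K = 8 W / \<open>\<rho>\<close>^2 the critical slope is L = (16
  \<open>\<rho>\<close> R + 256 n \<open>\<Lambda>\<close> W / \<open>\<rho>\<close>) /
  \<open>\<mu>\<close>, whose two coefficients are then merged into one.\<close>

theorem gradient_estimate:
  fixes w :: "real^'n::finite \<Rightarrow> real"
  assumes a: "coeff_bounds \<mu> \<Lambda> \<tau> a (ball x\<^sub>0 \<rho>)" and w: "Ck_on 2 w (ball x\<^sub>0 \<rho>)"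
    and \<rho>: "0 < \<rho>" "3 * \<tau> * (real CARD('n)) ^ 3 * \<rho> \<le> \<mu>"
    and W: "\<And>x. x \<in> ball x\<^sub>0 \<rho> \<Longrightarrow> \<bar>w x\<bar> \<le> W"
    and R: "\<And>x. x \<in> ball x\<^sub>0 \<rho> \<Longrightarrow> \<bar>trace_hess a w x\<bar> \<le> R"
  shows "\<bar>pderiv_dir k w x\<^sub>0\<bar> \<le> (16 + 256 * real CARD('n) * \<Lambda>) / \<mu> * (W / \<rho> + \<rho> * R)"
proof -
  define K where "K = 8 * W / \<rho>\<^sup>2"
  define L where "L = 8 * \<rho> / \<mu> * (2 * R + 4 * K * (real CARD('n) * \<Lambda>))"
  have diff: "w differentiable (at (x\<^sub>0 + 0 *\<^sub>R h))" for h using w \<rho>(1) by (simp add: numeral_2_eq_2)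
  have dir: "(\<Sum>i\<in>UNIV. h $ i * pderiv_dir i w x\<^sub>0) \<le> L" if h: "norm h = 1" for h :: "real^'n"
  \<comment> \<open>The growth bound is available only for slopes strictly above L.\<close>
  proof (rule field_le_epsilon)
    fix e :: real assume e: "0 < e"
    define g where "g t = w (x\<^sub>0 + t *\<^sub>R h) - (L + e) * t - K * t\<^sup>2" for t
    have g: "(g has_real_derivative (\<Sum>i\<in>UNIV. h $ i * pderiv_dir i w x\<^sub>0) - (L + e)) (at 0)"
      unfolding g_def using DERIV_along_line[OF diff, of h] by (auto intro!: derivative_eq_intros)
    show "(\<Sum>i\<in>UNIV. h $ i * pderiv_dir i w x\<^sub>0) \<le> L + e"
    proof (rule ccontr)
      assume "\<not> ?thesis"
      then obtain d where d: "0 < d" "\<And>t. 0 < t \<Longrightarrow> t < d \<Longrightarrow> g 0 < g (0 + t)"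
        using DERIV_pos_inc_right[OF g] by auto
      define t where "t = min d \<rho> / 2"
      have t: "0 < t" "t < d" "t \<le> \<rho> / 2" using d(1) \<rho>(1) by (auto simp: t_def)
      have "x\<^sub>0 + t *\<^sub>R h \<in> cball x\<^sub>0 (\<rho> / 2)" using t h by (simp add: dist_norm)
      then have "w (x\<^sub>0 + t *\<^sub>R h) - w x\<^sub>0 \<le> (L + e) * t + K * t\<^sup>2"
        using one_sided_growth_bound[OF a w \<rho> W R K_def _ , of "L + e" "x\<^sub>0 + t *\<^sub>R h"] e t h
        by (simp add: L_def)
      then show False using d(2)[of t] t by (simp add: g_def)
    qed
  qed
  have sum1: "(\<Sum>i\<in>UNIV. (axis k c :: real^'n) $ i * g i) = c * g k" for c :: real and g
    by (simp add: axis_def if_distrib[of "\<lambda>u. u * _"] cong: if_cong)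
  have "\<bar>pderiv_dir k w x\<^sub>0\<bar> \<le> L"
    using dir[of "axis k 1"] dir[of "- axis k 1"] by (simp add: sum1 sum_negf)
  also have "L = 16 / \<mu> * (\<rho> * R) + 256 * real CARD('n) * \<Lambda> / \<mu> * (W / \<rho>)"
    using \<rho>(1) a by (simp add: L_def K_def field_simps power2_eq_square coeff_bounds_def)
  also have "\<dots> \<le> (16 + 256 * real CARD('n) * \<Lambda>) / \<mu> * (W / \<rho> + \<rho> * R)"
  proof -
    have "0 \<le> W" "0 \<le> R" "0 < \<mu>" "0 \<le> \<Lambda>" using W[of x\<^sub>0] R[of x\<^sub>0] \<rho>(1) a by (auto simp: coeff_bounds_def)
    then have "0 \<le> 256 * real CARD('n) * \<Lambda> / \<mu> * (\<rho> * R)" "0 \<le> 16 / \<mu> * (W / \<rho>)" using \<rho>(1) by auto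
    then show ?thesis by (simp add: add_divide_distrib distrib_left distrib_right)
  qed
  finally show ?thesis .
qed

section \<open>Equations for the derivatives of a solution\<close>

text \<open>A linear differential operator of order at most q with coefficients of class C^p. Being
  a predicate, it hides the lower-order coefficients, whose explicit form becomes unwieldy after
  repeated differentiation.\<close>

definition lin_op :: "(real^'n::finite) set \<Rightarrow> nat \<Rightarrow> nat \<Rightarrow> ((real^'n \<Rightarrow> real) \<Rightarrow> real^'n \<Rightarrow> real) \<Rightarrow> bool" where
  "lin_op \<Omega> p q F \<longleftrightarrow> (\<exists>c. (\<forall>l. Ck_on p (c l) \<Omega>) \<and>
     F = (\<lambda>u x. \<Sum>l | length l \<le> q. c l x * iter_deriv l u x))"

lemma finite_lists_length_le': "finite {l :: 'n::finite list. length l \<le> q}"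
  using finite_lists_length_le[of "UNIV :: 'n set" q] by simp

lemma lin_op_term:
  assumes "Ck_on p c \<Omega>" "length l \<le> q"
  shows "lin_op \<Omega> p q (\<lambda>u x. c x * iter_deriv l u x)"
proof -
  have "(\<Sum>l' | length l' \<le> q. (if l' = l then c else (\<lambda>_. 0)) x * iter_deriv l' u x)
      = (\<Sum>l' | length l' \<le> q. if l' = l then c x * iter_deriv l u x else 0)" for u x
    by (intro sum.cong) auto
  then have "(\<Sum>l' | length l' \<le> q. (if l' = l then c else (\<lambda>_. 0)) x * iter_deriv l' u x)
      = c x * iter_deriv l u x" for u x
    using assms(2) by (simp add: finite_lists_length_le')
  then show ?thesis
    unfolding lin_op_def using assms(1)
    by (intro exI[of _ "\<lambda>l'. if l' = l then c else (\<lambda>_. 0)"]) (auto simp: Ck_on_const)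
qed

lemma lin_op_add:
  assumes "open \<Omega>" "lin_op \<Omega> p q F" "lin_op \<Omega> p q G"
  shows "lin_op \<Omega> p q (\<lambda>u x. F u x + G u x)"
proof -
  obtain c d where "\<forall>l. Ck_on p (c l) \<Omega>" "F = (\<lambda>u x. \<Sum>l | length l \<le> q. c l x * iter_deriv l u x)"
    "\<forall>l. Ck_on p (d l) \<Omega>" "G = (\<lambda>u x. \<Sum>l | length l \<le> q. d l x * iter_deriv l u x)"
    using assms(2,3) unfolding lin_op_def by blast
  then show ?thesis
    unfolding lin_op_def
    by (intro exI[of _ "\<lambda>l x. c l x + d l x"]) (auto simp: Ck_on_add[OF assms(1)] distrib_right sum.distrib)
qed

lemma lin_op_sum:
  assumes "open \<Omega>" "\<And>i. i \<in> I \<Longrightarrow> lin_op \<Omega> p q (F i)"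
  shows "lin_op \<Omega> p q (\<lambda>u x. \<Sum>i\<in>I. F i u x)"
proof -
  have zero: "lin_op \<Omega> p q (\<lambda>u x. 0)"
    using lin_op_term[of p "\<lambda>_. 0" \<Omega> "[]" q] by (simp add: Ck_on_const)
  show ?thesis using assms(2)
    by (induction I rule: infinite_finite_induct) (auto simp: zero intro!: lin_op_add assms(1))
qed

text \<open>The product rule trades one derivative of the coefficients for one order of the
  operator.\<close>

lemma pderiv_dir_lin_op:
  assumes "open \<Omega>" "lin_op \<Omega> (Suc p) q F"
  shows "\<exists>G. lin_op \<Omega> p (Suc q) G \<and> (\<forall>U u. open U \<longrightarrow> U \<subseteq> \<Omega> \<longrightarrow> Ck_on (Suc q) u U \<longrightarrow>
     (\<forall>x\<in>U. pderiv_dir j (F u) x = G u x))"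
proof -
  obtain c where c: "\<And>l. Ck_on (Suc p) (c l) \<Omega>" "F = (\<lambda>u x. \<Sum>l | length l \<le> q. c l x * iter_deriv l u x)"
    using assms(2) unfolding lin_op_def by blast
  define G where "G u x = (\<Sum>l | length l \<le> q. c l x * iter_deriv (j # l) u x + pderiv_dir j (c l) x * iter_deriv l u x)" for u x
  have "lin_op \<Omega> p (Suc q) (\<lambda>u x. c l x * iter_deriv (j # l) u x + pderiv_dir j (c l) x * iter_deriv l u x)"
    if "length l \<le> q" for l
    using that c(1)[of l] by (intro lin_op_add assms(1) lin_op_term Ck_on_Suc_imp_Ck_on[OF c(1)]) auto
  then have "lin_op \<Omega> p (Suc q) G" unfolding G_def by (intro lin_op_sum assms(1)) simp
  moreover have "pderiv_dir j (F u) x = G u x" if "open U" "U \<subseteq> \<Omega>" "Ck_on (Suc q) u U" "x \<in> U" for U u x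
  proof -
    have d: "c l differentiable at x" for l using c(1)[of l] that by auto
    have d': "iter_deriv l u differentiable at x" if "length l \<le> q" for l
      using iter_deriv_differentiable[OF \<open>Ck_on (Suc q) u U\<close> _ \<open>x \<in> U\<close>] that by simp
    show ?thesis unfolding G_def c(2) using d d'
      by (subst pderiv_dir_sum) (auto simp: finite_lists_length_le' pderiv_dir_mult iter_deriv_Cons intro!: sum.cong differentiable_mult)
  qed
  ultimately show ?thesis by blast
qed

lemma L_op_expand:
  assumes "\<And>i j. Ck_on 1 (\<lambda>x. a x $ i $ j) U" "Ck_on 2 u U" "x \<in> U"
  shows "L_op a u x = - trace_hess a u x - (\<Sum>i\<in>UNIV. \<Sum>j\<in>UNIV. pderiv_dir i (\<lambda>y. a y $ i $ j) x * pderiv_dir j u x)"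
proof -
  have "(\<lambda>x. a x $ i $ j) differentiable at x" "pderiv_dir j u differentiable at x" for i j
    using assms(1)[of i j] assms(2,3) by (auto simp: numeral_2_eq_2)
  then show ?thesis
    by (simp add: L_op_def trace_hess_def pderiv_dir_mult sum.distrib)
qed

text \<open>When the equation for the derivative along l is differentiated in direction j, what is
  left besides the new principal part is the derivative of the old right-hand side and first
  derivatives of the coefficients times derivatives of order |l| + 2. The latter order is one more
  than |j # l|, so the bound on the order of F persists.\<close>

lemma trace_hess_iter_deriv:
  fixes a :: "real^'n::finite \<Rightarrow> real^'n^'n"
  assumes "open \<Omega>" "\<And>i j. Ck_on (Suc M) (\<lambda>x. a x $ i $ j) \<Omega>" "length l \<le> M"
  shows "\<exists>F. lin_op \<Omega> (M - length l) (Suc (length l)) F \<and>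
    (\<forall>U u. open U \<longrightarrow> U \<subseteq> \<Omega> \<longrightarrow> Ck_on (length l + 2) u U \<longrightarrow> (\<forall>x\<in>U. L_op a u x = 0) \<longrightarrow>
      (\<forall>x\<in>U. trace_hess a (iter_deriv l u) x = F u x))"
  using assms(3)
proof (induction l)
  case Nil
  define F where "F u x = (\<Sum>i\<in>UNIV. \<Sum>j\<in>UNIV. (-1 * pderiv_dir i (\<lambda>y. a y $ i $ j) x) * iter_deriv [j] u x)" for u x
  have "lin_op \<Omega> M (Suc 0) F"
    unfolding F_def using assms(2) by (intro lin_op_sum assms(1) lin_op_term Ck_on_cmult) auto
  moreover have "trace_hess a u x = F u x" if "U \<subseteq> \<Omega>" "Ck_on 2 u U" "\<forall>x\<in>U. L_op a u x = 0" "x \<in> U" for U u x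
  proof -
    have "Ck_on 1 (\<lambda>x. a x $ i $ j) U" for i j
      by (rule Ck_on_subset[OF Ck_on_le[OF assms(2)] that(1)]) simp
    from L_op_expand[OF this that(2,4)] that show ?thesis
      by (simp add: F_def iter_deriv_Cons sum_negf)
  qed
  ultimately show ?case by (intro exI[of _ F]) (auto simp del: Ck_on.simps simp: numeral_2_eq_2)
next
  case (Cons j l)
  then obtain F where F: "lin_op \<Omega> (M - length l) (Suc (length l)) F" and
    eq: "\<And>U u x. open U \<Longrightarrow> U \<subseteq> \<Omega> \<Longrightarrow> Ck_on (length l + 2) u U \<Longrightarrow> (\<forall>x\<in>U. L_op a u x = 0) \<Longrightarrow>
      x \<in> U \<Longrightarrow> trace_hess a (iter_deriv l u) x = F u x"
    by auto
  let ?p = "M - length (j # l)"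
  have "M - length l = Suc ?p" using Cons.prems by simp
  with F pderiv_dir_lin_op[OF assms(1), of ?p "Suc (length l)" F j]
  obtain G where G: "lin_op \<Omega> ?p (Suc (length (j # l))) G"
    and Geq: "\<And>U u x. open U \<Longrightarrow> U \<subseteq> \<Omega> \<Longrightarrow> Ck_on (length l + 2) u U \<Longrightarrow> x \<in> U \<Longrightarrow> pderiv_dir j (F u) x = G u x"
    by auto
  define H where "H u x = G u x + (\<Sum>p\<in>UNIV. \<Sum>q\<in>UNIV. (-1 * pderiv_dir j (\<lambda>y. a y $ p $ q) x) * iter_deriv (p # q # l) u x)" for u x
  have aC: "Ck_on (Suc ?p) (\<lambda>x. a x $ i $ j) \<Omega>" for i j
    by (rule Ck_on_le[OF assms(2)]) simp
  have "lin_op \<Omega> ?p (Suc (length (j # l))) H"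
    unfolding H_def using aC by (intro lin_op_add G lin_op_sum assms(1) lin_op_term Ck_on_cmult) auto
  moreover have "trace_hess a (iter_deriv (j # l) u) x = H u x"
    if U: "open U" "U \<subseteq> \<Omega>" "Ck_on (length (j # l) + 2) u U" "\<forall>x\<in>U. L_op a u x = 0" "x \<in> U" for U u x
  proof -
    have u: "Ck_on (length l + 2) u U" by (rule Ck_on_le[OF U(3)]) simp
    have C3: "Ck_on 3 (iter_deriv l u) U" using Ck_on_iter_deriv_le[OF U(3), of 3 l] by simp
    \<comment> \<open>The new derivative passes the two of the principal part one at a time; each
      exchange uses \<open>Ck_on 2\<close> of the function that is differentiated twice.\<close>
    have comm: "pderiv_dir j (pderiv_dir p (pderiv_dir q (iter_deriv l u))) x
        = pderiv_dir p (pderiv_dir q (iter_deriv (j # l) u)) x" for p q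
    proof -
      have "pderiv_dir j (pderiv_dir p (pderiv_dir q (iter_deriv l u))) x
          = pderiv_dir p (pderiv_dir j (pderiv_dir q (iter_deriv l u))) x"
        using C3 by (intro pderiv_dir_commute[OF U(1) _ U(5)]) (simp add: numeral_3_eq_3 numeral_2_eq_2)
      also have "\<dots> = pderiv_dir p (pderiv_dir q (pderiv_dir j (iter_deriv l u))) x"
        using C3 Ck_on_le[OF C3, of 2] by (intro pderiv_dir_cong[OF U(1,5)] pderiv_dir_commute[OF U(1)]) auto
      finally show ?thesis by (simp add: iter_deriv_Cons)
    qed
    have da: "(\<lambda>y. a y $ p $ q) differentiable at x" for p q
      using assms(2)[of p q] U by auto
    have du: "pderiv_dir p (pderiv_dir q (iter_deriv l u)) differentiable at x" for p q
      using C3 U(5) by (simp add: numeral_3_eq_3)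
    have "G u x = pderiv_dir j (F u) x" using Geq[OF U(1,2) u U(5)] by simp
    also have "\<dots> = pderiv_dir j (trace_hess a (iter_deriv l u)) x"
      by (intro pderiv_dir_cong[OF U(1,5)]) (simp add: eq[OF U(1,2) u U(4)])
    also have "\<dots> = (\<Sum>p\<in>UNIV. \<Sum>q\<in>UNIV. a x $ p $ q * pderiv_dir j (pderiv_dir p (pderiv_dir q (iter_deriv l u))) x
        + pderiv_dir j (\<lambda>y. a y $ p $ q) x * pderiv_dir p (pderiv_dir q (iter_deriv l u)) x)"
      unfolding trace_hess_def[abs_def] using da du
      by (simp add: pderiv_dir_sum differentiable_sum differentiable_mult pderiv_dir_mult)
    finally show ?thesis
      by (simp add: H_def comm trace_hess_def sum.distrib sum_negf iter_deriv_Cons)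
  qed
  ultimately show ?case by (intro exI[of _ H]) auto
qed

lemma lin_op_bound:
  fixes P :: "(real^'n::finite) set"
  assumes "lin_op \<Omega> p q F" "compact P" "P \<subseteq> \<Omega>"
  shows "\<exists>C\<ge>0. \<forall>u x B. x \<in> P \<longrightarrow> (\<forall>l. length l \<le> q \<longrightarrow> \<bar>iter_deriv l u x\<bar> \<le> B) \<longrightarrow> \<bar>F u x\<bar> \<le> C * B"
proof -
  obtain c where c: "\<And>l. Ck_on p (c l) \<Omega>" "F = (\<lambda>u x. \<Sum>l | length l \<le> q. c l x * iter_deriv l u x)"
    using assms(1) unfolding lin_op_def by blast
  have "\<exists>b. 0 \<le> b \<and> (\<forall>x\<in>P. \<bar>c l x\<bar> \<le> b)" for l
  proof -
    have "continuous_on P (c l)" using continuous_on_subset[OF Ck_on_imp_continuous_on[OF c(1)] assms(3)] .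
    then have "bounded (c l ` P)" using assms(2) by (intro compact_imp_bounded compact_continuous_image)
    then show ?thesis unfolding bounded_pos by (auto intro: less_imp_le)
  qed
  then obtain b where b: "\<And>l. 0 \<le> b l" "\<And>l x. x \<in> P \<Longrightarrow> \<bar>c l x\<bar> \<le> b l" by metis
  have "\<bar>F u x\<bar> \<le> (\<Sum>l :: 'n list | length l \<le> q. b l) * B"
    if "x \<in> P" "\<forall>l. length l \<le> q \<longrightarrow> \<bar>iter_deriv l u x\<bar> \<le> B" for u x B
    unfolding c(2) sum_distrib_right using that b
    by (intro order_trans[OF sum_abs] sum_mono) (auto simp: abs_mult intro!: mult_mono)
  moreover have "0 \<le> (\<Sum>l :: 'n list | length l \<le> q. b l)" using b(1) by (intro sum_nonneg)
  ultimately show ?thesis by blast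
qed

text \<open>The Lipschitz bound comes from the mean value theorem and so lives on convex sets, hence
  the formulation with balls inside P, with constants common to all of them. The ellipticity
  constant is the minimum of the quadratic form over P times the unit sphere.\<close>

lemma compact_imp_coeff_bounds:
  fixes a :: "real^'n::finite \<Rightarrow> real^'n^'n"
  assumes ell: "elliptic_operator m a \<Omega>" "1 \<le> m" and "open \<Omega>" "compact P" "P \<subseteq> \<Omega>"
  shows "\<exists>\<mu> \<Lambda> \<tau>. \<forall>x \<rho>. 0 < \<rho> \<longrightarrow> ball x \<rho> \<subseteq> P \<longrightarrow> coeff_bounds \<mu> \<Lambda> \<tau> a (ball x \<rho>)"
proof (cases "P = {}")
  case False
  have C1: "Ck_on 1 (\<lambda>x. a x $ i $ j) \<Omega>" for i j
    using ell Ck_on_le[of m _ \<Omega> 1] by (auto simp: elliptic_operator_def)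
  have cont: "continuous_on P (\<lambda>x. a x $ i $ j)" "continuous_on P (pderiv_dir k (\<lambda>x. a x $ i $ j))" for i j k
    using C1[of i j] continuous_on_subset[OF Ck_on_imp_continuous_on[OF C1[of i j]] assms(5)]
      continuous_on_subset[OF _ assms(5), of "pderiv_dir k (\<lambda>x. a x $ i $ j)"] by auto
  have bd: "\<exists>b\<ge>0. \<forall>x\<in>P. \<bar>g x\<bar> \<le> b" if "continuous_on P g" for g :: "real^'n \<Rightarrow> real"
  proof -
    have "bounded (g ` P)" using that assms(4) by (intro compact_imp_bounded compact_continuous_image)
    then show ?thesis unfolding bounded_pos by (auto intro: less_imp_le)
  qed
  have "\<forall>i j. \<exists>b\<ge>0. \<forall>x\<in>P. \<bar>a x $ i $ j\<bar> \<le> b" using bd cont(1) by blast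
  then obtain b where b: "\<And>i j. 0 \<le> b i j" "\<And>i j x. x \<in> P \<Longrightarrow> \<bar>a x $ i $ j\<bar> \<le> b i j" by metis
  have "\<forall>i j k. \<exists>b\<ge>0. \<forall>x\<in>P. \<bar>pderiv_dir k (\<lambda>x. a x $ i $ j) x\<bar> \<le> b" using bd cont(2) by blast
  then obtain d where d: "\<And>i j k. 0 \<le> d i j k" "\<And>i j k x. x \<in> P \<Longrightarrow> \<bar>pderiv_dir k (\<lambda>x. a x $ i $ j) x\<bar> \<le> d i j k" by metis
  define \<Lambda> where "\<Lambda> = (\<Sum>i\<in>UNIV. \<Sum>j\<in>UNIV. b i j)"
  define D where "D = (\<Sum>i\<in>UNIV. \<Sum>j\<in>UNIV. \<Sum>k\<in>UNIV. d i j k)"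
  have bL: "b i j \<le> \<Lambda>" for i j
  proof -
    have "b i j \<le> (\<Sum>j\<in>UNIV. b i j)" using b(1) by (intro member_le_sum) auto
    also have "\<dots> \<le> \<Lambda>" unfolding \<Lambda>_def using b(1) by (intro member_le_sum[of i UNIV "\<lambda>i. \<Sum>j\<in>UNIV. b i j"]) (auto intro: sum_nonneg)
    finally show ?thesis .
  qed
  have dD: "d i j k \<le> D" for i j k
  proof -
    have "d i j k \<le> (\<Sum>k\<in>UNIV. d i j k)" using d(1) by (intro member_le_sum) auto
    also have "\<dots> \<le> (\<Sum>j\<in>UNIV. \<Sum>k\<in>UNIV. d i j k)"
      using d(1) by (intro member_le_sum[of j UNIV "\<lambda>j. \<Sum>k\<in>UNIV. d i j k"]) (auto intro: sum_nonneg)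
    also have "\<dots> \<le> D" unfolding D_def
      using d(1) by (intro member_le_sum[of i UNIV "\<lambda>i. \<Sum>j\<in>UNIV. \<Sum>k\<in>UNIV. d i j k"]) (auto intro!: sum_nonneg)
    finally show ?thesis .
  qed
  define Q where "Q p = snd p \<bullet> (a (fst p) *v snd p)" for p :: "(real^'n) \<times> (real^'n)"
  have c1: "continuous_on (P \<times> sphere 0 1) (\<lambda>p :: (real^'n) \<times> (real^'n). a (fst p) $ i $ j)" for i j
    by (rule continuous_on_compose2[OF cont(1)]) (auto intro!: continuous_intros)
  have c2: "continuous_on (P \<times> sphere 0 1) (\<lambda>p :: (real^'n) \<times> (real^'n). snd p $ i)" for i
    by (intro continuous_intros)
  have "Q = (\<lambda>p. \<Sum>i\<in>UNIV. snd p $ i * (\<Sum>j\<in>UNIV. a (fst p) $ i $ j * snd p $ j))"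
    by (simp add: fun_eq_iff Q_def inner_vec_def matrix_vector_mult_def)
  then have "continuous_on (P \<times> sphere 0 1) Q"
    by (simp only:) (intro continuous_on_sum continuous_on_mult c1 c2)
  moreover have "compact (P \<times> sphere 0 1 :: ((real^'n) \<times> (real^'n)) set)" using assms(4) by (auto intro: compact_Times)
  moreover have "axis undefined 1 \<in> (sphere 0 1 :: (real^'n) set)" by simp
  then have "P \<times> (sphere 0 1 :: (real^'n) set) \<noteq> {}" using False by blast
  ultimately obtain p where p: "p \<in> P \<times> sphere 0 1" "\<And>q. q \<in> P \<times> sphere 0 1 \<Longrightarrow> Q p \<le> Q q"
    using continuous_attains_inf[of "P \<times> sphere 0 1" Q] by blast
  define \<mu> where "\<mu> = Q p"
  have "snd p \<noteq> 0" "fst p \<in> \<Omega>" using p(1) assms(5) by auto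
  then have \<mu>: "0 < \<mu>" using ell(1) by (auto simp: \<mu>_def Q_def elliptic_operator_def)
  have quad: "\<mu> * (norm \<xi>)\<^sup>2 \<le> \<xi> \<bullet> (a x *v \<xi>)" if "x \<in> P" for x \<xi>
  proof (cases "\<xi> = 0")
    case False
    have "\<mu> \<le> Q (x, (1 / norm \<xi>) *\<^sub>R \<xi>)" unfolding \<mu>_def using that False by (intro p(2)) auto
    also have "\<dots> = (\<xi> \<bullet> (a x *v \<xi>)) / (norm \<xi>)\<^sup>2"
      by (simp add: Q_def matrix_vector_mult_scaleR power2_eq_square)
    finally show ?thesis using False by (simp add: field_simps)
  qed simp
  have "coeff_bounds \<mu> \<Lambda> (real CARD('n) * D) a (ball x \<rho>)" if ball: "ball x \<rho> \<subseteq> P" for x \<rho>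
  proof -
    have "\<bar>a y $ i $ j - a z $ i $ j\<bar> \<le> real CARD('n) * D * norm (y - z)" if "y \<in> ball x \<rho>" "z \<in> ball x \<rho>" for y z i j
    proof -
      have diff: "(\<lambda>x. a x $ i $ j) differentiable at v" if "v \<in> ball x \<rho>" for v
        using C1[of i j] subsetD[OF assms(5) subsetD[OF ball that]] by auto
      have "\<bar>pderiv_dir k (\<lambda>x. a x $ i $ j) v\<bar> \<le> D" if "v \<in> ball x \<rho>" for v k
        using d(2)[of v k i j] dD[of i j k] that ball by fastforce
      from mean_value_bound[of "ball x \<rho>" z "y - z", OF convex_ball _ _ diff this] that
      show ?thesis by (simp add: ac_simps)
    qed
    moreover have "0 \<le> \<Lambda>" "0 \<le> D" using b(1) d(1) by (auto simp: \<Lambda>_def D_def intro!: sum_nonneg)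
    ultimately show ?thesis
      unfolding coeff_bounds_def using \<mu> quad ball b(2) order_trans[OF b(2) bL] assms(5) ell(1)
      by (auto simp: elliptic_operator_def subset_iff)
  qed
  then show ?thesis by blast
next
  case True
  then show ?thesis by auto
qed

section \<open>Interior estimates\<close>

declare Ck_on.simps(2) [simp del]

text \<open>There are finitely many lists of length k, so the sum of their constants serves all of
  them.\<close>

lemma trace_hess_iter_deriv_bound:
  fixes a :: "real^'n::finite \<Rightarrow> real^'n^'n"
  assumes "open \<Omega>" "elliptic_operator (Suc M) a \<Omega>" "compact P" "P \<subseteq> \<Omega>" "k \<le> M"
  shows "\<exists>C\<ge>0. \<forall>U u x B l. open U \<longrightarrow> U \<subseteq> \<Omega> \<longrightarrow> Ck_on (k + 2) u U \<longrightarrow> (\<forall>x\<in>U. L_op a u x = 0) \<longrightarrow>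
     x \<in> U \<longrightarrow> x \<in> P \<longrightarrow> length l = k \<longrightarrow> (\<forall>l'. length l' \<le> Suc k \<longrightarrow> \<bar>iter_deriv l' u x\<bar> \<le> B) \<longrightarrow>
     \<bar>trace_hess a (iter_deriv l u) x\<bar> \<le> C * B"
proof -
  have aC: "\<And>i j. Ck_on (Suc M) (\<lambda>x. a x $ i $ j) \<Omega>" using assms(2) by (simp add: elliptic_operator_def)
  have "\<exists>C\<ge>0. \<forall>U u x B. open U \<longrightarrow> U \<subseteq> \<Omega> \<longrightarrow> Ck_on (k + 2) u U \<longrightarrow> (\<forall>x\<in>U. L_op a u x = 0) \<longrightarrow>
     x \<in> U \<longrightarrow> x \<in> P \<longrightarrow> (\<forall>l'. length l' \<le> Suc k \<longrightarrow> \<bar>iter_deriv l' u x\<bar> \<le> B) \<longrightarrow>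
     \<bar>trace_hess a (iter_deriv l u) x\<bar> \<le> C * B" if l: "length l = k" for l
  proof -
    obtain F where F: "lin_op \<Omega> (M - k) (Suc k) F"
      and eq: "\<And>U u x. open U \<Longrightarrow> U \<subseteq> \<Omega> \<Longrightarrow> Ck_on (k + 2) u U \<Longrightarrow> (\<forall>x\<in>U. L_op a u x = 0) \<Longrightarrow>
        x \<in> U \<Longrightarrow> trace_hess a (iter_deriv l u) x = F u x"
      using trace_hess_iter_deriv[OF assms(1) aC, of l] l assms(5) by auto
    obtain C where C: "0 \<le> C" "\<And>u x B. x \<in> P \<Longrightarrow> (\<And>l. length l \<le> Suc k \<Longrightarrow> \<bar>iter_deriv l u x\<bar> \<le> B) \<Longrightarrow> \<bar>F u x\<bar> \<le> C * B"
      using lin_op_bound[OF F assms(3,4)] by blast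
    show ?thesis
    proof (intro exI[of _ C] conjI C(1) allI impI)
      fix U u x B
      assume *: "open U" "U \<subseteq> \<Omega>" "Ck_on (k + 2) u U" "\<forall>x\<in>U. L_op a u x = 0" "x \<in> U" "x \<in> P"
        "\<forall>l'. length l' \<le> Suc k \<longrightarrow> \<bar>iter_deriv l' u x\<bar> \<le> B"
      show "\<bar>trace_hess a (iter_deriv l u) x\<bar> \<le> C * B"
        unfolding eq[OF *(1-5)] using *(6,7) by (intro C(2)) auto
    qed
  qed
  then obtain C where C: "\<And>l. length l = k \<Longrightarrow> 0 \<le> C l"
    "\<And>l U u x B. length l = k \<Longrightarrow> open U \<Longrightarrow> U \<subseteq> \<Omega> \<Longrightarrow> Ck_on (k + 2) u U \<Longrightarrow> (\<forall>x\<in>U. L_op a u x = 0) \<Longrightarrow>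
     x \<in> U \<Longrightarrow> x \<in> P \<Longrightarrow> (\<forall>l'. length l' \<le> Suc k \<longrightarrow> \<bar>iter_deriv l' u x\<bar> \<le> B) \<Longrightarrow>
     \<bar>trace_hess a (iter_deriv l u) x\<bar> \<le> C l * B" by metis
  have fin: "finite {l :: 'n list. length l = k}"
    by (rule finite_subset[OF _ finite_lists_length_le'[of k]]) auto
  show ?thesis
  proof (intro exI[of _ "\<Sum>l :: 'n list | length l = k. C l"] conjI allI impI)
    show "0 \<le> (\<Sum>l :: 'n list | length l = k. C l)" using C(1) by (intro sum_nonneg) auto
    fix U u x B and l :: "'n list"
    assume *: "open U" "U \<subseteq> \<Omega>" "Ck_on (k + 2) u U" "\<forall>x\<in>U. L_op a u x = 0" "x \<in> U" "x \<in> P" "length l = k"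
        "\<forall>l'. length l' \<le> Suc k \<longrightarrow> \<bar>iter_deriv l' u x\<bar> \<le> B"
    have "0 \<le> B" using *(8)[rule_format, of "[]"] by auto
    moreover have "C l \<le> (\<Sum>l :: 'n list | length l = k. C l)" using C(1) * fin by (intro member_le_sum) auto
    ultimately have "C l * B \<le> (\<Sum>l :: 'n list | length l = k. C l) * B" by (intro mult_right_mono)
    then show "\<bar>trace_hess a (iter_deriv l u) x\<bar> \<le> (\<Sum>l :: 'n list | length l = k. C l) * B"
      using C(2)[OF *(7,1-6,8)] by simp
  qed
qed

text \<open>The equation for a derivative of order k has on its right-hand side derivatives of order
  k + 1, the very ones to be estimated. The sum h of their absolute values is weighted with d^(k +
  1), d being the distance to the boundary of the half ball, and maximised at y. On the ball of
  radius e = d y / 2 about y all of them are then at most g y / e^(k + 1), and the gradient estimate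
  puts another factor e in front of them, so that they are absorbed for small radii.\<close>

lemma interior_estimate_small_radius:
  fixes a :: "real^'n::finite \<Rightarrow> real^'n^'n"
  assumes "open \<Omega>" "elliptic_operator (Suc M) a \<Omega>" "compact P" "P \<subseteq> \<Omega>" "k \<le> Suc M"
  shows "\<exists>C \<rho>\<^sub>0. 0 \<le> C \<and> 0 < \<rho>\<^sub>0 \<and> \<rho>\<^sub>0 \<le> 1 \<and> (\<forall>x \<rho> u B l. 0 < \<rho> \<longrightarrow> \<rho> \<le> \<rho>\<^sub>0 \<longrightarrow> ball x \<rho> \<subseteq> P \<longrightarrow>
     Ck_on (Suc k) u (ball x \<rho>) \<longrightarrow> (\<forall>y\<in>ball x \<rho>. L_op a u y = 0) \<longrightarrow> (\<forall>y\<in>ball x \<rho>. \<bar>u y\<bar> \<le> B) \<longrightarrow>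
     length l \<le> k \<longrightarrow> \<bar>iter_deriv l u x\<bar> * \<rho> ^ length l \<le> C * B)"
  using assms(5)
proof (induction k)
  case 0
  show ?case by (intro exI[of _ 1] conjI allI impI) auto
next
  case (Suc k)
  then obtain C\<^sub>0 \<rho>\<^sub>1 where C0: "0 \<le> C\<^sub>0" "0 < \<rho>\<^sub>1" "\<rho>\<^sub>1 \<le> 1"
    and IH: "\<And>x \<rho> u B l. 0 < \<rho> \<Longrightarrow> \<rho> \<le> \<rho>\<^sub>1 \<Longrightarrow> ball x \<rho> \<subseteq> P \<Longrightarrow>
     Ck_on (Suc k) u (ball x \<rho>) \<Longrightarrow> (\<forall>y\<in>ball x \<rho>. L_op a u y = 0) \<Longrightarrow> (\<forall>y\<in>ball x \<rho>. \<bar>u y\<bar> \<le> B) \<Longrightarrow>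
     length l \<le> k \<Longrightarrow> \<bar>iter_deriv l u x\<bar> * \<rho> ^ length l \<le> C\<^sub>0 * B"
    by (auto simp only: Suc_leD) blast
  obtain \<mu> \<Lambda> \<tau> where cb: "\<And>x \<rho>. 0 < \<rho> \<Longrightarrow> ball x \<rho> \<subseteq> P \<Longrightarrow> coeff_bounds \<mu> \<Lambda> \<tau> a (ball x \<rho>)"
    using compact_imp_coeff_bounds[OF assms(2) _ assms(1,3,4)] by auto
  obtain T where T: "0 \<le> T" and trace: "\<And>U u x B l. open U \<Longrightarrow> U \<subseteq> \<Omega> \<Longrightarrow> Ck_on (k + 2) u U \<Longrightarrow> (\<forall>x\<in>U. L_op a u x = 0) \<Longrightarrow>
     x \<in> U \<Longrightarrow> x \<in> P \<Longrightarrow> length l = k \<Longrightarrow> (\<forall>l'. length l' \<le> Suc k \<longrightarrow> \<bar>iter_deriv l' u x\<bar> \<le> B) \<Longrightarrow>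
     \<bar>trace_hess a (iter_deriv l u) x\<bar> \<le> T * B"
    using trace_hess_iter_deriv_bound[OF assms(1-4), of k] Suc.prems by auto
  show ?case
  proof (cases "\<exists>x \<rho>. 0 < \<rho> \<and> ball x \<rho> \<subseteq> P")
    \<comment> \<open>Without a ball in P the claim is vacuous, and \<open>cb\<close> says nothing
      about the signs of the constants.\<close>
    case False
    then show ?thesis by (intro exI[of _ 1]) auto
  next
    case True
    then have pos: "0 < \<mu>" "0 \<le> \<Lambda>" "0 \<le> \<tau>" using cb by (auto simp: coeff_bounds_def)
    define G where "G = (16 + 256 * real CARD('n) * \<Lambda>) / \<mu>"
    define \<L> where "\<L> = {l :: 'n list. length l = Suc k}"
    have finL: "finite \<L>" unfolding \<L>_def
      by (rule finite_subset[OF _ finite_lists_length_le'[of "Suc k"]]) auto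
    \<comment> \<open>The number of derivatives of order k + 1, times the gradient constant, times
      2^(k + 1) from d y = 2 e.\<close>
    define N where "N = real (card \<L>) * G * 2 ^ Suc k"
    have G: "0 \<le> G" and N: "0 \<le> N" using pos by (auto simp: G_def N_def)
    \<comment> \<open>The factor 2 is the price of absorbing half of \<open>g y\<close>.\<close>
    define A where "A = 2 * N * ((1 + T) * C\<^sub>0)"
    define s where "s = 3 * \<tau> * real CARD('n) ^ 3"
    have s: "0 \<le> s" using pos by (simp add: s_def)
    \<comment> \<open>The three bounds serve the induction hypothesis, the smallness condition of
      the gradient estimate, and the absorption \<open>N * T * e \<le> 1 / 2\<close>.\<close>
    define \<rho>\<^sub>0 where "\<rho>\<^sub>0 = min \<rho>\<^sub>1 (min (\<mu> / (s + 1)) (1 / (2 * (N * T + 1))))"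
    have NT: "0 \<le> N * T" using N T by simp
    have \<rho>0: "0 < \<rho>\<^sub>0" "\<rho>\<^sub>0 \<le> \<rho>\<^sub>1" "\<rho>\<^sub>0 \<le> 1"
      using C0 pos s NT by (auto simp: \<rho>\<^sub>0_def add_nonneg_pos)
    have s\<rho>: "s * e \<le> \<mu>" "N * T * e \<le> 1 / 2" if "0 < e" "e \<le> \<rho>\<^sub>0" for e
    proof -
      have "e \<le> \<mu> / (s + 1)" "e \<le> 1 / (2 * (N * T + 1))" using that by (auto simp: \<rho>\<^sub>0_def)
      then have "e * (s + 1) \<le> \<mu>" "e * (2 * (N * T + 1)) \<le> 1"
        using s NT by (simp_all add: le_divide_eq mult.commute)
      then show "s * e \<le> \<mu>" "N * T * e \<le> 1 / 2" using that by (simp_all add: algebra_simps)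
    qed
    have main: "\<bar>iter_deriv l u x\<bar> * \<rho> ^ length l \<le> (C\<^sub>0 + 2 ^ Suc k * A) * B"
      if \<rho>: "0 < \<rho>" "\<rho> \<le> \<rho>\<^sub>0" and P: "ball x \<rho> \<subseteq> P" and u: "Ck_on (Suc (Suc k)) u (ball x \<rho>)"
        and Lu: "\<forall>y\<in>ball x \<rho>. L_op a u y = 0" and B: "\<forall>y\<in>ball x \<rho>. \<bar>u y\<bar> \<le> B" and l: "length l \<le> Suc k"
      for x \<rho> u B l
    proof -
      have B0: "0 \<le> B" using B \<rho>(1) by (auto dest: bspec[of _ _ x])
      have A0: "0 \<le> A" using N T C0 by (simp add: A_def)
      define h where "h y = (\<Sum>l\<in>\<L>. \<bar>iter_deriv l u y\<bar>)" for y
      define d where "d y = \<rho> / 2 - norm (y - x)" for y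
      define g where "g y = d y ^ Suc k * h y" for y
      have sub: "cball x (\<rho> / 2) \<subseteq> ball x \<rho>" using \<rho>(1) by auto
      have "continuous_on (cball x (\<rho> / 2)) (iter_deriv l u)" if "l \<in> \<L>" for l
        using Ck_on_iter_deriv_le[OF u, of 0 l] that continuous_on_subset[OF _ sub] by (auto simp: \<L>_def)
      then have "continuous_on (cball x (\<rho> / 2)) g"
        unfolding g_def h_def d_def by (intro continuous_intros) auto
      then obtain y where y: "y \<in> cball x (\<rho> / 2)" "\<And>z. z \<in> cball x (\<rho> / 2) \<Longrightarrow> g z \<le> g y"
        using continuous_attains_sup[of "cball x (\<rho> / 2)" g] \<rho>(1) by auto
      have h0: "0 \<le> h z" for z by (simp add: h_def sum_nonneg)
      have d0: "0 \<le> d y" using y(1) by (simp add: d_def dist_norm norm_minus_commute)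
      have "g y \<le> A * B"
      proof (cases "d y = 0")
        case True
        then show ?thesis using A0 B0 by (simp add: g_def)
      next
        case False
        define e where "e = d y / 2"
        have e4: "0 < e" "e \<le> \<rho> / 4"
          using False d0 norm_ge_zero[of "y - x"] by (auto simp: e_def d_def)
        then have e: "0 < e" "e \<le> \<rho> / 4" "e \<le> \<rho>\<^sub>0" "e \<le> 1" "e \<le> \<rho>\<^sub>1"
          using \<rho> \<rho>0 by auto
        have e2: "s * e \<le> \<mu>" "N * T * e \<le> 1 / 2" using s\<rho> e by auto
        have gy0: "0 \<le> g y" using h0 d0 by (simp add: g_def)
        have z: "z \<in> cball x (\<rho> / 2)" "ball z e \<subseteq> ball x \<rho>" "e \<le> d z" if "z \<in> ball y e" for z
        proof -
          have t: "dist z x \<le> dist y x + dist y z" "dist y z < e"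
            using dist_triangle3[of z x y] that by (simp_all add: dist_commute)
          moreover have dd: "dist y x = \<rho> / 2 - 2 * e" by (simp add: e_def d_def dist_norm field_simps)
          ultimately have zx: "dist z x \<le> \<rho> / 2 - e" by linarith
          then show "z \<in> cball x (\<rho> / 2)" using e by (simp add: dist_commute)
          show "e \<le> d z" using zx by (simp add: d_def dist_norm)
          show "ball z e \<subseteq> ball x \<rho>"
          proof
            fix v assume "v \<in> ball z e"
            then show "v \<in> ball x \<rho>"
              using dist_triangle[of x v z] zx \<rho>(1) by (simp add: dist_commute)
          qed
        qed
        have low: "\<bar>iter_deriv l' u z\<bar> \<le> C\<^sub>0 * B / e ^ k" if "z \<in> ball y e" "length l' \<le> k" for z l'
        proof -
          have "\<bar>iter_deriv l' u z\<bar> * e ^ k \<le> \<bar>iter_deriv l' u z\<bar> * e ^ length l'"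
            using e that by (intro mult_left_mono power_decreasing) auto
          also have "\<dots> \<le> C\<^sub>0 * B"
            using z(2)[OF that(1)] P u Lu B e that(2)
            by (intro IH) (auto intro: Ck_on_subset[OF Ck_on_le[OF u]])
          finally show ?thesis using e by (simp add: le_divide_eq)
        qed
        \<comment> \<open>Maximality of y: the weight at z is still at least e^(k + 1).\<close>
        have high: "\<bar>iter_deriv l' u z\<bar> \<le> g y / e ^ Suc k" if "z \<in> ball y e" "length l' = Suc k" for z l'
        proof -
          have "\<bar>iter_deriv l' u z\<bar> \<le> h z"
            unfolding h_def using that finL by (intro member_le_sum[of l' \<L> "\<lambda>l. \<bar>iter_deriv l u z\<bar>"]) (auto simp: \<L>_def)
          then have "\<bar>iter_deriv l' u z\<bar> * e ^ Suc k \<le> h z * d z ^ Suc k"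
            using z(3)[OF that(1)] e h0 by (intro mult_mono power_mono) auto
          also have "\<dots> \<le> g y" using y(2)[OF z(1)[OF that(1)]] by (simp add: g_def mult.commute)
          finally show ?thesis using e by (simp add: le_divide_eq)
        qed
        have CB: "0 \<le> C\<^sub>0 * B" using C0 B0 by simp
        have "C\<^sub>0 * B / e ^ k \<le> C\<^sub>0 * B / e ^ Suc k"
          using e CB by (intro divide_left_mono power_decreasing) auto
        then have all: "\<bar>iter_deriv l' u z\<bar> \<le> (C\<^sub>0 * B + g y) / e ^ Suc k" if "z \<in> ball y e" "length l' \<le> Suc k" for z l'
        proof (cases "length l' \<le> k")
          case True
          have "0 \<le> g y / e ^ Suc k" using gy0 e by simp
          then show ?thesis using low[OF that(1) True] \<open>C\<^sub>0 * B / e ^ k \<le> _\<close> by (simp add: add_divide_distrib)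
        next
          case False
          have "0 \<le> C\<^sub>0 * B / e ^ Suc k" using CB e by simp
          moreover have "length l' = Suc k" using that(2) False by simp
          ultimately show ?thesis using high[OF that(1), of l'] by (simp only: add_divide_distrib) linarith
        qed
        have sube: "ball y e \<subseteq> ball x \<rho>" using z(2)[of y] e by simp
        have ue: "Ck_on (k + 2) u (ball y e)" using Ck_on_subset[OF u sube] by simp
        have grad: "\<bar>iter_deriv l' u y\<bar> \<le> G * (C\<^sub>0 * B / e ^ k / e + e * (T * ((C\<^sub>0 * B + g y) / e ^ Suc k)))" if "l' \<in> \<L>" for l'
        proof -
          obtain j l'' where l'': "l' = j # l''" "length l'' = k" using \<open>l' \<in> \<L>\<close> by (cases l') (auto simp: \<L>_def)
          have "\<bar>pderiv_dir j (iter_deriv l'' u) y\<bar> \<le> G * (C\<^sub>0 * B / e ^ k / e + e * (T * ((C\<^sub>0 * B + g y) / e ^ Suc k)))"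
            unfolding G_def
          proof (rule gradient_estimate)
            show "coeff_bounds \<mu> \<Lambda> \<tau> a (ball y e)" using cb e sube P by blast
            show "Ck_on 2 (iter_deriv l'' u) (ball y e)" using ue l'' by (intro Ck_on_iter_deriv_le[OF ue]) auto
            show "3 * \<tau> * real CARD('n) ^ 3 * e \<le> \<mu>" using e2 by (simp add: s_def)
            show "\<bar>iter_deriv l'' u z\<bar> \<le> C\<^sub>0 * B / e ^ k" if "z \<in> ball y e" for z using low that l'' by simp
            show "\<bar>trace_hess a (iter_deriv l'' u) z\<bar> \<le> T * ((C\<^sub>0 * B + g y) / e ^ Suc k)" if "z \<in> ball y e" for z
              using that sube P assms(4) Lu all l'' by (intro trace[of "ball y e"] ue) auto
          qed (use e in auto)
          then show ?thesis by (simp add: l'' iter_deriv_Cons)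
        qed
        have "h y \<le> (\<Sum>l'\<in>\<L>. G * (C\<^sub>0 * B / e ^ k / e + e * (T * ((C\<^sub>0 * B + g y) / e ^ Suc k))))"
          unfolding h_def by (intro sum_mono grad)
        then have hy: "h y \<le> real (card \<L>) * (G * (C\<^sub>0 * B / e ^ k / e + e * (T * ((C\<^sub>0 * B + g y) / e ^ Suc k))))"
          by simp
        have "g y = (2 ^ Suc k * e ^ Suc k) * h y" by (simp add: g_def e_def power_mult_distrib[symmetric] del: power_Suc)
        also have "\<dots> \<le> (2 ^ Suc k * e ^ Suc k) * (real (card \<L>) * (G * (C\<^sub>0 * B / e ^ k / e + e * (T * ((C\<^sub>0 * B + g y) / e ^ Suc k)))))"
          using e by (intro mult_left_mono hy) auto
        also have "\<dots> = N * (C\<^sub>0 * B + e * (T * (C\<^sub>0 * B + g y)))"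
          using e by (simp add: N_def field_simps)
        also have "\<dots> = N * (C\<^sub>0 * B) + N * T * (C\<^sub>0 * B) * e + (N * T * e) * g y" by (simp add: algebra_simps)
        also have "\<dots> \<le> N * (C\<^sub>0 * B) + N * T * (C\<^sub>0 * B) * 1 + 1 / 2 * g y"
          using e e2 gy0 NT CB by (intro add_mono mult_left_mono mult_right_mono) auto
        finally show ?thesis by (simp add: A_def algebra_simps)
      qed
      moreover have "g x \<le> g y" using \<rho>(1) by (intro y(2)) simp
      moreover have "g x = (\<rho> / 2) ^ Suc k * h x" by (simp add: g_def d_def)
      ultimately have "(\<rho> / 2) ^ Suc k * h x \<le> A * B" by simp
      then have hx: "h x * \<rho> ^ Suc k \<le> 2 ^ Suc k * A * B" by (simp add: power_divide field_simps)
      show ?thesis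
      proof (cases "length l \<le> k")
        case True
        have "\<bar>iter_deriv l u x\<bar> * \<rho> ^ length l \<le> C\<^sub>0 * B"
          using \<rho> \<rho>0 P Lu B True Ck_on_le[OF u] by (intro IH) auto
        moreover have "0 \<le> 2 ^ Suc k * A * B" using A0 B0 by simp
        ultimately show ?thesis unfolding distrib_right by linarith
      next
        case False
        then have "l \<in> \<L>" using l by (simp add: \<L>_def)
        then have "\<bar>iter_deriv l u x\<bar> \<le> h x"
          unfolding h_def using finL by (intro member_le_sum[of l \<L> "\<lambda>l. \<bar>iter_deriv l u x\<bar>"]) auto
        then have "\<bar>iter_deriv l u x\<bar> * \<rho> ^ Suc k \<le> h x * \<rho> ^ Suc k" using \<rho>(1) by (intro mult_right_mono) auto
        moreover have "0 \<le> C\<^sub>0 * B" using C0 B0 by simp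
        ultimately show ?thesis using hx \<open>l \<in> \<L>\<close> unfolding \<L>_def distrib_right mem_Collect_eq by simp
      qed
    qed
    have "0 \<le> C\<^sub>0 + 2 ^ Suc k * A" using C0 N T by (simp add: A_def)
    then show ?thesis using main \<rho>0 by (intro exI[of _ "C\<^sub>0 + 2 ^ Suc k * A"] exI[of _ \<rho>\<^sub>0]) blast
  qed
qed

text \<open>For large radii the small-radius estimate is applied on a concentric ball, at the cost
  of powers of \<open>D / \<rho>\<^sub>0\<close>.\<close>

theorem interior_estimate:
  fixes a :: "real^'n::finite \<Rightarrow> real^'n^'n"
  assumes "open \<Omega>" "elliptic_operator (Suc M) a \<Omega>" "compact P" "P \<subseteq> \<Omega>" "k \<le> Suc M"
  shows "\<exists>C\<ge>0. \<forall>x \<rho> u B l. 0 < \<rho> \<longrightarrow> \<rho> \<le> D \<longrightarrow> ball x \<rho> \<subseteq> P \<longrightarrow>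
     Ck_on (Suc k) u (ball x \<rho>) \<longrightarrow> (\<forall>y\<in>ball x \<rho>. L_op a u y = 0) \<longrightarrow> (\<forall>y\<in>ball x \<rho>. \<bar>u y\<bar> \<le> B) \<longrightarrow>
     length l \<le> k \<longrightarrow> \<bar>iter_deriv l u x\<bar> * \<rho> ^ length l \<le> C * B"
proof -
  obtain C \<rho>\<^sub>0 where C: "0 \<le> C" "0 < \<rho>\<^sub>0" and est: "\<And>x \<rho> u B l. 0 < \<rho> \<Longrightarrow> \<rho> \<le> \<rho>\<^sub>0 \<Longrightarrow> ball x \<rho> \<subseteq> P \<Longrightarrow>
     Ck_on (Suc k) u (ball x \<rho>) \<Longrightarrow> (\<forall>y\<in>ball x \<rho>. L_op a u y = 0) \<Longrightarrow> (\<forall>y\<in>ball x \<rho>. \<bar>u y\<bar> \<le> B) \<Longrightarrow>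
     length l \<le> k \<Longrightarrow> \<bar>iter_deriv l u x\<bar> * \<rho> ^ length l \<le> C * B"
    using interior_estimate_small_radius[OF assms] by blast
  define s where "s = max 1 (D / \<rho>\<^sub>0)"
  have s: "1 \<le> s" by (simp add: s_def)
  have "\<bar>iter_deriv l u x\<bar> * \<rho> ^ length l \<le> (s ^ k * C) * B"
    if \<rho>: "0 < \<rho>" "\<rho> \<le> D" and P: "ball x \<rho> \<subseteq> P" and u: "Ck_on (Suc k) u (ball x \<rho>)"
      and Lu: "\<forall>y\<in>ball x \<rho>. L_op a u y = 0" and B: "\<forall>y\<in>ball x \<rho>. \<bar>u y\<bar> \<le> B" and l: "length l \<le> k"
    for x \<rho> u B l
  proof -
    define r where "r = min \<rho> \<rho>\<^sub>0"
    have r: "0 < r" "r \<le> \<rho>" "r \<le> \<rho>\<^sub>0" using \<rho> C by (auto simp: r_def)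
    have sub: "ball x r \<subseteq> ball x \<rho>" using r by auto
    have "\<rho> \<le> s * r"
    proof (cases "\<rho> \<le> \<rho>\<^sub>0")
      case True
      then show ?thesis using s \<rho>(1) by (simp add: r_def mult_le_cancel_right1)
    next
      case False
      have "\<rho> \<le> (D / \<rho>\<^sub>0) * \<rho>\<^sub>0" using \<rho> C by simp
      also have "\<dots> \<le> s * \<rho>\<^sub>0" using C by (intro mult_right_mono) (auto simp: s_def)
      finally show ?thesis using False by (simp add: r_def)
    qed
    then have "\<rho> ^ length l \<le> s ^ length l * r ^ length l"
      using \<rho>(1) power_mono[of \<rho> "s * r" "length l"] by (simp add: power_mult_distrib)
    also have "\<dots> \<le> s ^ k * r ^ length l" using s l r by (intro mult_right_mono power_increasing) auto
    finally have "\<bar>iter_deriv l u x\<bar> * \<rho> ^ length l \<le> \<bar>iter_deriv l u x\<bar> * (s ^ k * r ^ length l)"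
      by (intro mult_left_mono) auto
    also have "\<dots> = s ^ k * (\<bar>iter_deriv l u x\<bar> * r ^ length l)" by simp
    also have "\<dots> \<le> s ^ k * (C * B)"
      using s r P Lu B l sub by (intro mult_left_mono est Ck_on_subset[OF u]) auto
    finally show ?thesis by simp
  qed
  moreover have "0 \<le> s ^ k * C" using s C by simp
  ultimately show ?thesis by blast
qed

section \<open>Finite differences and Zygmund classes\<close>

definition fdiff :: "'a::ab_group_add \<Rightarrow> ('a \<Rightarrow> real) \<Rightarrow> 'a \<Rightarrow> real" where
  "fdiff h g x = g (x + h) - g x"

abbreviation fdiffs :: "'a::ab_group_add list \<Rightarrow> ('a \<Rightarrow> real) \<Rightarrow> 'a \<Rightarrow> real" where
  "fdiffs hs g \<equiv> foldr fdiff hs g"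

lemma fdiffs_Cons: "fdiffs (h # hs) g x = fdiffs hs g (x + h) - fdiffs hs g x"
  by (simp only: foldr.simps comp_def fdiff_def)

text \<open>Mixed differences with arbitrary increments, all measured by one scale s. For j = 1 this
  is a Hoelder condition, for larger j and \<open>\<gamma>\<close> below j one of Zygmund type. The
  points of evaluation may leave the ball by up to j s.\<close>

definition diff_bound_on :: "real \<Rightarrow> real \<Rightarrow> nat \<Rightarrow> real \<Rightarrow> ('a::real_normed_vector \<Rightarrow> real) \<Rightarrow> 'a \<Rightarrow> bool" where
  "diff_bound_on r C j \<gamma> g x\<^sub>0 \<longleftrightarrow> (\<forall>s x hs. 0 < s \<longrightarrow> s \<le> r \<longrightarrow> x \<in> ball x\<^sub>0 r \<longrightarrow>
     length hs = j \<longrightarrow> (\<forall>h\<in>set hs. norm h \<le> s) \<longrightarrow> \<bar>fdiffs hs g x\<bar> \<le> C * s powr \<gamma>)"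

text \<open>The radius is left open because it shrinks with every operation; by
  \<open>diff_bound_cong\<close> only the germ at \<open>x\<^sub>0\<close> matters.\<close>

definition diff_bound :: "nat \<Rightarrow> real \<Rightarrow> ('a::real_normed_vector \<Rightarrow> real) \<Rightarrow> 'a \<Rightarrow> bool" where
  "diff_bound j \<gamma> g x\<^sub>0 \<longleftrightarrow> (\<exists>r>0. \<exists>C\<ge>0. diff_bound_on r C j \<gamma> g x\<^sub>0)"

lemma diff_boundE:
  assumes "diff_bound j \<gamma> g x\<^sub>0"
  obtains r C where "0 < r" "0 \<le> C" "diff_bound_on r C j \<gamma> g x\<^sub>0"
  using assms unfolding diff_bound_def by blast

lemma diff_bound_onD:
  assumes "diff_bound_on r C j \<gamma> g x\<^sub>0" "r' \<le> r" "0 < s" "s \<le> r'" "x \<in> ball x\<^sub>0 r'"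
    and "length hs = j" "\<And>h. h \<in> set hs \<Longrightarrow> norm h \<le> s"
  shows "\<bar>fdiffs hs g x\<bar> \<le> C * s powr \<gamma>"
  using assms unfolding diff_bound_on_def by auto

lemma diff_boundI:
  assumes "0 < r" "0 \<le> C" "\<And>s x hs. 0 < s \<Longrightarrow> s \<le> r \<Longrightarrow> x \<in> ball x\<^sub>0 r \<Longrightarrow>
     length hs = j \<Longrightarrow> (\<And>h. h \<in> set hs \<Longrightarrow> norm h \<le> s) \<Longrightarrow> \<bar>fdiffs hs g x\<bar> \<le> C * s powr \<gamma>"
  shows "diff_bound j \<gamma> g x\<^sub>0"
  using assms unfolding diff_bound_def diff_bound_on_def by blast

lemma diff_bound_mono:
  assumes "diff_bound j \<gamma> g x\<^sub>0" "\<gamma>' \<le> \<gamma>"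
  shows "diff_bound j \<gamma>' g x\<^sub>0"
proof -
  obtain r C where rC: "0 < r" "0 \<le> C" and *: "diff_bound_on r C j \<gamma> g x\<^sub>0"
    by (rule diff_boundE[OF assms(1)]) blast
  show ?thesis
  proof (rule diff_boundI)
    show "0 < min r 1" "0 \<le> C" using rC by auto
    fix s x and hs :: "'a list"
    assume s: "0 < s" "s \<le> min r 1" "x \<in> ball x\<^sub>0 (min r 1)" "length hs = j" "\<And>h. h \<in> set hs \<Longrightarrow> norm h \<le> s"
    have "\<bar>fdiffs hs g x\<bar> \<le> C * s powr \<gamma>" using s by (intro diff_bound_onD[OF *, of "min r 1"]) auto
    also have "\<dots> \<le> C * s powr \<gamma>'" using rC s assms(2) by (intro mult_left_mono powr_mono') auto
    finally show "\<bar>fdiffs hs g x\<bar> \<le> C * s powr \<gamma>'" .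
  qed
qed

lemma diff_bound_cong:
  assumes "diff_bound j \<gamma> g x\<^sub>0" "open U" "x\<^sub>0 \<in> U" "\<And>x. x \<in> U \<Longrightarrow> g x = g' x"
  shows "diff_bound j \<gamma> g' x\<^sub>0"
proof -
  obtain r C where rC: "0 < r" "0 \<le> C" and *: "diff_bound_on r C j \<gamma> g x\<^sub>0"
    by (rule diff_boundE[OF assms(1)]) blast
  obtain e where e: "0 < e" "ball x\<^sub>0 e \<subseteq> U" using assms(2,3) open_contains_ball by blast
  have eq: "fdiffs hs g x = fdiffs hs g' x"
    if "norm (x - x\<^sub>0) + real (length hs) * s < e" "\<And>h. h \<in> set hs \<Longrightarrow> norm h \<le> s" for hs x s
    using that
  proof (induction hs arbitrary: x)
    case Nil
    then show ?case using e(2) assms(4)[of x] by (auto simp: dist_norm norm_minus_commute subset_iff)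
  next
    case (Cons h hs)
    have h: "norm h \<le> s" using Cons.prems(2) by simp
    then have "0 \<le> s" by (rule order_trans[OF norm_ge_zero])
    have "norm (x + h - x\<^sub>0) \<le> norm (x - x\<^sub>0) + norm h"
      using norm_triangle_ineq[of "x - x\<^sub>0" h] by (simp add: algebra_simps)
    then have "norm (x + h - x\<^sub>0) + real (length hs) * s < e" "norm (x - x\<^sub>0) + real (length hs) * s < e"
      using Cons.prems(1) h \<open>0 \<le> s\<close> by (auto simp: distrib_right)
    then have "fdiffs hs g (x + h) = fdiffs hs g' (x + h)" "fdiffs hs g x = fdiffs hs g' x"
      using Cons.prems(2) by (auto intro!: Cons.IH)
    then show ?case by (simp only: fdiffs_Cons)
  qed
  \<comment> \<open>Small enough for all points of a j-fold difference to stay in U.\<close>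
  define r' where "r' = min r (e / (real j + 2))"
  show ?thesis
  proof (rule diff_boundI)
    show "0 < r'" "0 \<le> C" using rC e by (auto simp: r'_def)
    fix s x and hs :: "'a list"
    assume s: "0 < s" "s \<le> r'" "x \<in> ball x\<^sub>0 r'" "length hs = j" "\<And>h. h \<in> set hs \<Longrightarrow> norm h \<le> s"
    have "r' \<le> e / (real j + 2)" by (simp add: r'_def)
    then have "r' * (real j + 2) \<le> e" by (simp add: le_divide_eq)
    moreover have "real j * s \<le> real j * r'" using s by (intro mult_left_mono) auto
    moreover have "norm (x - x\<^sub>0) < r'" using s(3) by (simp add: dist_norm norm_minus_commute)
    ultimately have "norm (x - x\<^sub>0) + real (length hs) * s < e"
      using s(1,2,4) by (simp add: algebra_simps)
    then have "fdiffs hs g x = fdiffs hs g' x" using s(5) by (rule eq)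
    moreover have "\<bar>fdiffs hs g x\<bar> \<le> C * s powr \<gamma>" using s by (intro diff_bound_onD[OF *, of r']) (auto simp: r'_def)
    ultimately show "\<bar>fdiffs hs g' x\<bar> \<le> C * s powr \<gamma>" by simp
  qed
qed

lemma diff_bound_Suc:
  assumes "diff_bound j \<gamma> g x\<^sub>0"
  shows "diff_bound (Suc j) \<gamma> g x\<^sub>0"
proof -
  obtain r C where rC: "0 < r" "0 \<le> C" and *: "diff_bound_on r C j \<gamma> g x\<^sub>0"
    by (rule diff_boundE[OF assms(1)]) blast
  show ?thesis
  proof (rule diff_boundI)
    show "0 < r / 2" "0 \<le> 2 * C" using rC by auto
    fix s x and hs :: "'a list"
    assume s: "0 < s" "s \<le> r / 2" "x \<in> ball x\<^sub>0 (r / 2)" "length hs = Suc j" "\<And>h. h \<in> set hs \<Longrightarrow> norm h \<le> s"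
    then obtain h hs' where hs: "hs = h # hs'" by (cases hs) auto
    have "norm h \<le> s" using s(5) hs by simp
    then have "x + h \<in> ball x\<^sub>0 r" using s(2,3) dist_triangle[of x\<^sub>0 "x + h" x] by (simp add: dist_norm)
    then have "\<bar>fdiffs hs' g (x + h)\<bar> \<le> C * s powr \<gamma>" "\<bar>fdiffs hs' g x\<bar> \<le> C * s powr \<gamma>"
      using s hs by (auto intro!: diff_bound_onD[OF *, of r])
    then show "\<bar>fdiffs hs g x\<bar> \<le> 2 * C * s powr \<gamma>" by (simp add: hs fdiffs_Cons del: foldr.simps)
  qed
qed

lemma diff_bound_continuous:
  fixes g :: "'a::euclidean_space \<Rightarrow> real"
  assumes "open U" "x\<^sub>0 \<in> U" "continuous_on U g"
  shows "diff_bound 0 0 g x\<^sub>0"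
proof -
  have "isCont g x\<^sub>0" using assms continuous_on_eq_continuous_at by blast
  then obtain d where d: "0 < d" "\<And>x. dist x x\<^sub>0 < d \<Longrightarrow> \<bar>g x - g x\<^sub>0\<bar> < 1"
    using continuous_at_eps_delta[of x\<^sub>0 g] by (auto simp: dist_norm) (metis zero_less_one)
  show ?thesis
    using d by (intro diff_boundI[of d "\<bar>g x\<^sub>0\<bar> + 1"]) (force simp: dist_commute)+
qed

lemma fdiffs_add: "fdiffs hs (\<lambda>x. g x + g' x) x = fdiffs hs g x + fdiffs hs g' x"
  by (induction hs arbitrary: x) (simp_all add: fdiffs_Cons del: foldr.simps(2))

lemma diff_bound_add:
  fixes g g' :: "'a::real_normed_vector \<Rightarrow> real"
  assumes "diff_bound j \<gamma> g x\<^sub>0" "diff_bound j \<gamma> g' x\<^sub>0"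
  shows "diff_bound j \<gamma> (\<lambda>x. g x + g' x) x\<^sub>0"
proof -
  obtain r C where rC: "0 < r" "0 \<le> C" and 1: "diff_bound_on r C j \<gamma> g x\<^sub>0"
    by (rule diff_boundE[OF assms(1)]) blast
  obtain r' C' where rC': "0 < r'" "0 \<le> C'" and 2: "diff_bound_on r' C' j \<gamma> g' x\<^sub>0"
    by (rule diff_boundE[OF assms(2)]) blast
  show ?thesis
  proof (rule diff_boundI)
    show "0 < min r r'" "0 \<le> C + C'" using rC rC' by auto
    fix s x and hs :: "'a list"
    assume s: "0 < s" "s \<le> min r r'" "x \<in> ball x\<^sub>0 (min r r')" "length hs = j" "\<And>h. h \<in> set hs \<Longrightarrow> norm h \<le> s"
    have "\<bar>fdiffs hs g x\<bar> \<le> C * s powr \<gamma>" "\<bar>fdiffs hs g' x\<bar> \<le> C' * s powr \<gamma>"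
      using s by (auto intro!: diff_bound_onD[OF 1, of "min r r'"] diff_bound_onD[OF 2, of "min r r'"])
    then show "\<bar>fdiffs hs (\<lambda>x. g x + g' x) x\<bar> \<le> (C + C') * s powr \<gamma>"
      unfolding fdiffs_add distrib_right by linarith
  qed
qed

lemma diff_bound_sum:
  fixes f :: "'i \<Rightarrow> 'a::real_normed_vector \<Rightarrow> real"
  assumes "finite I" "\<And>i. i \<in> I \<Longrightarrow> diff_bound j \<gamma> (f i) x\<^sub>0"
  shows "diff_bound j \<gamma> (\<lambda>x. \<Sum>i\<in>I. f i x) x\<^sub>0"
  using assms
proof (induction I)
  case empty
  have "fdiffs hs (\<lambda>x. 0) x = 0" for hs and x :: 'a by (induction hs arbitrary: x) (simp_all add: fdiffs_Cons del: foldr.simps(2))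
  then show ?case by (intro diff_boundI[of 1 0]) auto
next
  case (insert i I)
  then show ?case by (simp add: diff_bound_add)
qed

section \<open>Differences of derivatives and of products\<close>

lemma fdiffs_pderiv_dir:
  fixes g :: "real^'n::finite \<Rightarrow> real"
  assumes "\<And>y. y \<in> ball x\<^sub>0 R \<Longrightarrow> g differentiable (at y)"
    and "norm (x - x\<^sub>0) + real (length hs) * s < R" "\<And>h. h \<in> set hs \<Longrightarrow> norm h \<le> s"
  shows "fdiffs hs g differentiable (at x) \<and> pderiv_dir i (fdiffs hs g) x = fdiffs hs (pderiv_dir i g) x"
  using assms(2,3)
proof (induction hs arbitrary: x)
  case Nil
  then show ?case using assms(1)[of x] by (simp add: dist_norm norm_minus_commute)
next
  case (Cons h hs)
  have h: "norm h \<le> s" using Cons.prems(2) by simp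
  then have "0 \<le> s" by (rule order_trans[OF norm_ge_zero])
  have "norm (x + h - x\<^sub>0) \<le> norm (x - x\<^sub>0) + norm h"
    using norm_triangle_ineq[of "x - x\<^sub>0" h] by (simp add: algebra_simps)
  then have "norm (x + h - x\<^sub>0) + real (length hs) * s < R" "norm (x - x\<^sub>0) + real (length hs) * s < R"
    using Cons.prems(1) h \<open>0 \<le> s\<close> by (auto simp: distrib_right)
  then have IH: "fdiffs hs g differentiable (at (x + h))" "pderiv_dir i (fdiffs hs g) (x + h) = fdiffs hs (pderiv_dir i g) (x + h)"
     "fdiffs hs g differentiable (at x)" "pderiv_dir i (fdiffs hs g) x = fdiffs hs (pderiv_dir i g) x"
    using Cons.prems(2) Cons.IH[of "x + h"] Cons.IH[of x] by auto
  have eq: "fdiffs (h # hs) g = (\<lambda>x. fdiffs hs g (x + h) - fdiffs hs g x)" by (rule ext) (rule fdiffs_Cons)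
  show ?case
    unfolding eq using differentiable_shift[OF IH(1)] IH(3)
    by (auto simp: pderiv_dir_diff pderiv_dir_shift IH fdiffs_Cons simp del: foldr.simps intro: differentiable_diff)
qed

text \<open>One difference is converted into a derivative by the mean value theorem and contributes
  the factor s.\<close>

lemma diff_bound_antiderivative:
  fixes g :: "real^'n::finite \<Rightarrow> real"
  assumes "open U" "x\<^sub>0 \<in> U" "\<And>x. x \<in> U \<Longrightarrow> g differentiable (at x)"
    and "\<And>i. diff_bound j \<gamma> (pderiv_dir i g) x\<^sub>0"
  shows "diff_bound (Suc j) (\<gamma> + 1) g x\<^sub>0"
proof -
  have "\<exists>r C. 0 < r \<and> 0 \<le> C \<and> diff_bound_on r C j \<gamma> (pderiv_dir i g) x\<^sub>0" for i
    using assms(4)[of i] unfolding diff_bound_def by blast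
  then obtain r C where r: "\<And>i. 0 < r i" "\<And>i. 0 \<le> C i" and bd: "\<And>i. diff_bound_on (r i) (C i) j \<gamma> (pderiv_dir i g) x\<^sub>0"
    by metis
  obtain e where e: "0 < e" "ball x\<^sub>0 e \<subseteq> U" using assms(1,2) open_contains_ball by blast
  define \<rho> where "\<rho> = min (Min (range r)) (e / (real j + 2))"
  have \<rho>: "0 < \<rho>" "\<rho> \<le> r i" "\<rho> * (real j + 2) \<le> e" for i
  proof -
    show "0 < \<rho>" using r(1) e(1) by (simp add: \<rho>_def)
    show "\<rho> \<le> r i" by (simp add: \<rho>_def min.coboundedI1)
    have "\<rho> \<le> e / (real j + 2)" by (simp add: \<rho>_def)
    then show "\<rho> * (real j + 2) \<le> e" by (simp add: le_divide_eq)
  qed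
  define D where "D = (\<Sum>i\<in>UNIV. C i)"
  have D: "0 \<le> D" "C i \<le> D" for i using r(2) by (auto simp: D_def intro: sum_nonneg member_le_sum)
  show ?thesis
  proof (rule diff_boundI)
    show "0 < \<rho> / 2" "0 \<le> real CARD('n) * D" using \<rho> D by auto
    fix s x and hs :: "(real^'n) list"
    assume s: "0 < s" "s \<le> \<rho> / 2" "x \<in> ball x\<^sub>0 (\<rho> / 2)" "length hs = Suc j" "\<And>h. h \<in> set hs \<Longrightarrow> norm h \<le> s"
    then obtain h hs' where hs: "hs = h # hs'" by (cases hs) auto
    have h: "norm h \<le> s" and hs': "\<And>h. h \<in> set hs' \<Longrightarrow> norm h \<le> s" "length hs' = j" using s hs by auto
    have G: "fdiffs hs' g differentiable at y" "pderiv_dir i (fdiffs hs' g) y = fdiffs hs' (pderiv_dir i g) y"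
      if "y \<in> ball x\<^sub>0 \<rho>" for y i
    proof -
      have "real j * s \<le> real j * \<rho>" using s \<rho>(1) by (intro mult_left_mono) auto
      then have "norm (y - x\<^sub>0) + real (length hs') * s < e"
        using that \<rho>(1) \<rho>(3) hs'(2) by (simp add: dist_norm norm_minus_commute algebra_simps)
      from fdiffs_pderiv_dir[of x\<^sub>0 e g y hs' s i, OF _ this hs'(1)]
      show "fdiffs hs' g differentiable at y" "pderiv_dir i (fdiffs hs' g) y = fdiffs hs' (pderiv_dir i g) y"
        using e(2) assms(3) by blast+
    qed
    have "x + h \<in> ball x\<^sub>0 \<rho>" "x \<in> ball x\<^sub>0 \<rho>"
      using s(1,2,3) h dist_triangle[of x\<^sub>0 "x + h" x] by (auto simp: dist_norm)
    then have "\<bar>fdiffs hs' g (x + h) - fdiffs hs' g x\<bar> \<le> real CARD('n) * norm h * (D * s powr \<gamma>)"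
    proof (intro mean_value_bound[of "ball x\<^sub>0 \<rho>"])
      fix y i assume y: "y \<in> ball x\<^sub>0 \<rho>"
      have "\<bar>pderiv_dir i (fdiffs hs' g) y\<bar> \<le> C i * s powr \<gamma>"
        unfolding G(2)[OF y] using s \<rho> hs' y by (intro diff_bound_onD[OF bd, of \<rho>]) auto
      also have "\<dots> \<le> D * s powr \<gamma>" using D by (intro mult_right_mono) auto
      finally show "\<bar>pderiv_dir i (fdiffs hs' g) y\<bar> \<le> D * s powr \<gamma>" .
    qed (use G in auto)
    also have "\<dots> \<le> real CARD('n) * s * (D * s powr \<gamma>)" using h D by (intro mult_right_mono mult_left_mono) auto
    also have "\<dots> = real CARD('n) * D * s powr (\<gamma> + 1)" using s(1) by (simp add: powr_add)
    finally show "\<bar>fdiffs hs g x\<bar> \<le> real CARD('n) * D * s powr (\<gamma> + 1)" by (simp add: hs fdiffs_Cons del: foldr.simps)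
  qed
qed

lemma Ck_on_imp_diff_bound:
  fixes g :: "real^'n::finite \<Rightarrow> real"
  assumes "open U" "x\<^sub>0 \<in> U" "Ck_on k g U"
  shows "diff_bound k (real k) g x\<^sub>0"
  using assms(3)
proof (induction k arbitrary: g)
  case 0
  then show ?case using diff_bound_continuous[OF assms(1,2)] by simp
next
  case (Suc k)
  then show ?case
    using diff_bound_antiderivative[OF assms(1,2), of g k "real k"] by (auto simp: Ck_on.simps add.commute)
qed

lemma fdiffs_mult2:
  "fdiffs [h, k] (\<lambda>x. c x * g x) x = c x * fdiffs [h, k] g x + fdiffs [h] c x * fdiffs [k] g (x + h)
     + fdiffs [k] c x * fdiffs [h] g (x + k) + fdiffs [h, k] c x * g (x + h + k)"
  by (simp add: fdiffs_Cons algebra_simps del: foldr.simps(2))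

text \<open>The Leibniz rule, arranged so that the one term without a difference on f stands on the
  left; it is the one that stays in the equation.\<close>

lemma fdiffs_mult3:
  "fdiffs [h, k, l] (\<lambda>x. f x * g x) x - f x * fdiffs [h, k, l] g x =
     fdiffs [h] f x * fdiffs [k, l] g (x + h) + fdiffs [k] f x * fdiffs [h, l] g (x + k)
     + fdiffs [l] f x * fdiffs [h, k] g (x + l) + fdiffs [h, k] f x * fdiffs [l] g (x + h + k)
     + fdiffs [h, l] f x * fdiffs [k] g (x + h + l) + fdiffs [k, l] f x * fdiffs [h] g (x + k + l)
     + fdiffs [h, k, l] f x * g (x + h + k + l)"
proof -
  have eqs: "x + k + h = x + h + k" "x + l + h = x + h + l" "x + l + k = x + k + l" "x + h + l + k = x + h + k + l" "x + k + l + h = x + h + k + l"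
    by (simp_all add: ac_simps)
  show ?thesis
    by (simp only: fdiffs_Cons foldr.simps(1) id_apply eqs) algebra
qed

lemma mem_ball_shift:
  fixes x :: "'a::real_normed_vector"
  assumes "x \<in> ball x\<^sub>0 r" "norm h \<le> s"
  shows "x + h \<in> ball x\<^sub>0 (r + s)"
  using assms dist_triangle[of x\<^sub>0 "x + h" x] by (simp add: dist_norm)

lemma powr_le_powr_1: "0 < (s::real) \<Longrightarrow> s \<le> 1 \<Longrightarrow> \<gamma>' \<le> \<gamma> \<Longrightarrow> s powr \<gamma> \<le> s powr \<gamma>'"
  by (rule powr_mono') auto

text \<open>However the two differences are distributed over c and g, at least the power 1 +
  \<open>\<theta>\<close> of s results; \<open>\<theta>\<close> \<le> 1 covers the terms that give
  s^2.\<close>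

lemma diff_bound_mult:
  fixes c g :: "'a::real_normed_vector \<Rightarrow> real"
  assumes "\<theta> \<le> 1" and c: "diff_bound 0 0 c x\<^sub>0" "diff_bound 1 1 c x\<^sub>0" "diff_bound 2 2 c x\<^sub>0"
    and g: "diff_bound 0 0 g x\<^sub>0" "diff_bound 1 1 g x\<^sub>0" "diff_bound 2 (1 + \<theta>) g x\<^sub>0"
  shows "diff_bound 2 (1 + \<theta>) (\<lambda>x. c x * g x) x\<^sub>0"
proof -
  obtain r0 C0 where c0: "0 < r0" "0 \<le> C0" "diff_bound_on r0 C0 0 0 c x\<^sub>0"
    by (rule diff_boundE[OF c(1)]) blast
  obtain r1 C1 where c1: "0 < r1" "0 \<le> C1" "diff_bound_on r1 C1 1 1 c x\<^sub>0"
    by (rule diff_boundE[OF c(2)]) blast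
  obtain r2 C2 where c2: "0 < r2" "0 \<le> C2" "diff_bound_on r2 C2 2 2 c x\<^sub>0"
    by (rule diff_boundE[OF c(3)]) blast
  obtain q0 D0 where g0: "0 < q0" "0 \<le> D0" "diff_bound_on q0 D0 0 0 g x\<^sub>0"
    by (rule diff_boundE[OF g(1)]) blast
  obtain q1 D1 where g1: "0 < q1" "0 \<le> D1" "diff_bound_on q1 D1 1 1 g x\<^sub>0"
    by (rule diff_boundE[OF g(2)]) blast
  obtain q2 D2 where g2: "0 < q2" "0 \<le> D2" "diff_bound_on q2 D2 2 (1 + \<theta>) g x\<^sub>0"
    by (rule diff_boundE[OF g(3)]) blast
  define r where "r = min 1 (min r0 (min r1 (min r2 (min q0 (min q1 q2)))))"
  show ?thesis
  proof (rule diff_boundI)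
    show "0 < r / 4" using c0 c1 c2 g0 g1 g2 by (simp add: r_def)
    show "0 \<le> C0 * D2 + C1 * D1 + C1 * D1 + C2 * D0" using c0 c1 c2 g0 g1 g2 by simp
    fix s x and hs :: "'a list"
    assume s: "0 < s" "s \<le> r / 4" "x \<in> ball x\<^sub>0 (r / 4)" "length hs = 2" and nh: "\<And>h. h \<in> set hs \<Longrightarrow> norm h \<le> s"
    obtain h k where hs: "hs = [h, k]" using s(4) by (auto simp: length_Suc_conv numeral_2_eq_2)
    have hk: "norm h \<le> s" "norm k \<le> s" using nh by (auto simp: hs)
    have r: "r \<le> 1" "r \<le> r0" "r \<le> r1" "r \<le> r2" "r \<le> q0" "r \<le> q1" "r \<le> q2" by (auto simp: r_def min_le_iff_disj)
    have sr: "s \<le> r" "s \<le> 1" using s r by auto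
    have pts: "x \<in> ball x\<^sub>0 r" "x + h \<in> ball x\<^sub>0 r" "x + k \<in> ball x\<^sub>0 r" "x + h + k \<in> ball x\<^sub>0 r"
    proof -
      have "x + h \<in> ball x\<^sub>0 (r / 4 + s)" "x + k \<in> ball x\<^sub>0 (r / 4 + s)" "x + h + k \<in> ball x\<^sub>0 (r / 4 + s + s)"
        by (intro mem_ball_shift s(3) hk)+
      then show "x \<in> ball x\<^sub>0 r" "x + h \<in> ball x\<^sub>0 r" "x + k \<in> ball x\<^sub>0 r" "x + h + k \<in> ball x\<^sub>0 r"
        using s by auto
    qed
    define E where "E = s powr (1 + \<theta>)"
    have E: "s powr 1 * s powr 1 \<le> E" "s powr 2 \<le> E"
      using powr_le_powr_1[OF s(1) sr(2), of "1 + \<theta>" 2] assms(1) s(1) by (auto simp: E_def powr_add[symmetric] power2_eq_square)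
    have 1: "\<bar>c x\<bar> \<le> C0" using diff_bound_onD[OF c0(3), of r s x "[]"] r s sr pts by simp
    have 2: "\<bar>g (x + h + k)\<bar> \<le> D0" using diff_bound_onD[OF g0(3), of r s "x + h + k" "[]"] r s sr pts by simp
    have 3: "\<bar>fdiffs [h] c x\<bar> \<le> C1 * s powr 1" "\<bar>fdiffs [k] c x\<bar> \<le> C1 * s powr 1"
      using r s sr pts hk by (intro diff_bound_onD[OF c1(3), of r]; auto)+
    have 4: "\<bar>fdiffs [k] g (x + h)\<bar> \<le> D1 * s powr 1" "\<bar>fdiffs [h] g (x + k)\<bar> \<le> D1 * s powr 1"
      using r s sr pts hk by (intro diff_bound_onD[OF g1(3), of r]; auto)+
    have 5: "\<bar>fdiffs [h, k] c x\<bar> \<le> C2 * s powr 2"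
      using r s sr pts hk by (intro diff_bound_onD[OF c2(3), of r]) auto
    have 6: "\<bar>fdiffs [h, k] g x\<bar> \<le> D2 * E"
      unfolding E_def using r s sr pts hk by (intro diff_bound_onD[OF g2(3), of r]) auto
    have "\<bar>fdiffs hs (\<lambda>x. c x * g x) x\<bar> \<le> \<bar>c x\<bar> * \<bar>fdiffs [h, k] g x\<bar> + \<bar>fdiffs [h] c x\<bar> * \<bar>fdiffs [k] g (x + h)\<bar>
        + \<bar>fdiffs [k] c x\<bar> * \<bar>fdiffs [h] g (x + k)\<bar> + \<bar>fdiffs [h, k] c x\<bar> * \<bar>g (x + h + k)\<bar>"
      unfolding hs fdiffs_mult2 abs_mult[symmetric] by linarith
    also have "\<dots> \<le> C0 * (D2 * E) + (C1 * s powr 1) * (D1 * s powr 1) + (C1 * s powr 1) * (D1 * s powr 1) + (C2 * s powr 2) * D0"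
      by (intro add_mono mult_mono 1 2 3 4 5 6) (use c0 c1 c2 g0 g1 g2 E_def in auto)
    also have "\<dots> = C0 * D2 * E + C1 * D1 * (s powr 1 * s powr 1) + C1 * D1 * (s powr 1 * s powr 1) + C2 * D0 * s powr 2"
      by simp
    also have "\<dots> \<le> C0 * D2 * E + C1 * D1 * E + C1 * D1 * E + C2 * D0 * E"
      using E c0 c1 c2 g0 g1 g2 by (intro add_mono mult_left_mono) auto
    finally show "\<bar>fdiffs hs (\<lambda>x. c x * g x) x\<bar> \<le> (C0 * D2 + C1 * D1 + C1 * D1 + C2 * D0) * s powr (1 + \<theta>)"
      by (simp add: E_def distrib_right)
  qed
qed

text \<open>At least one difference falls on f and gives a factor s, so a Hoelder bound for g
  suffices although third differences are taken. Smaller radii are included so that finitely many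
  such bounds can be used on a common ball.\<close>

lemma diff_bound_commutator:
  fixes f g :: "'a::real_normed_vector \<Rightarrow> real"
  assumes "0 \<le> \<theta>" "\<theta> \<le> 1" and f: "diff_bound 1 1 f x\<^sub>0" "diff_bound 2 2 f x\<^sub>0"
    and g: "diff_bound 0 0 g x\<^sub>0" "diff_bound 1 \<theta> g x\<^sub>0"
  shows "\<exists>r>0. \<exists>C\<ge>0. \<forall>r' s x h k l. r' \<le> r \<longrightarrow> 0 < s \<longrightarrow> s \<le> r' \<longrightarrow> x \<in> ball x\<^sub>0 r' \<longrightarrow> norm h \<le> s \<longrightarrow> norm k \<le> s \<longrightarrow> norm l \<le> s \<longrightarrow>
     \<bar>fdiffs [h, k, l] (\<lambda>x. f x * g x) x - f x * fdiffs [h, k, l] g x\<bar> \<le> C * s powr (1 + \<theta>)"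
proof -
  have f3: "diff_bound 3 2 f x\<^sub>0" using diff_bound_Suc[OF f(2)] by simp
  have g2': "diff_bound 2 \<theta> g x\<^sub>0" using diff_bound_Suc[OF g(2)] by (simp add: numeral_2_eq_2)
  obtain r1 C1 where c1: "0 < r1" "0 \<le> C1" "diff_bound_on r1 C1 1 1 f x\<^sub>0"
    by (rule diff_boundE[OF f(1)]) blast
  obtain r2 C2 where c2: "0 < r2" "0 \<le> C2" "diff_bound_on r2 C2 2 2 f x\<^sub>0"
    by (rule diff_boundE[OF f(2)]) blast
  obtain r3 C3 where c3: "0 < r3" "0 \<le> C3" "diff_bound_on r3 C3 3 2 f x\<^sub>0"
    by (rule diff_boundE[OF f3])
  obtain q0 D0 where g0: "0 < q0" "0 \<le> D0" "diff_bound_on q0 D0 0 0 g x\<^sub>0"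
    by (rule diff_boundE[OF g(1)]) blast
  obtain q1 D1 where g1: "0 < q1" "0 \<le> D1" "diff_bound_on q1 D1 1 \<theta> g x\<^sub>0"
    by (rule diff_boundE[OF g(2)]) blast
  obtain q2 D2 where g2: "0 < q2" "0 \<le> D2" "diff_bound_on q2 D2 2 \<theta> g x\<^sub>0"
    by (rule diff_boundE[OF g2'])
  define r where "r = min 1 (min r1 (min r2 (min r3 (min q0 (min q1 q2)))))"
  define C where "C = 3 * (C1 * D2) + 3 * (C2 * D1) + C3 * D0"
  have bound: "\<bar>fdiffs [h, k, l] (\<lambda>x. f x * g x) x - f x * fdiffs [h, k, l] g x\<bar> \<le> C * s powr (1 + \<theta>)"
    if s: "r' \<le> r / 4" "0 < s" "s \<le> r'" "x \<in> ball x\<^sub>0 r'" and hk: "norm h \<le> s" "norm k \<le> s" "norm l \<le> s" for r' s x h k l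
  proof -
    have r: "r \<le> 1" "r \<le> r3" "r \<le> r1" "r \<le> r2" "r \<le> q0" "r \<le> q1" "r \<le> q2" by (auto simp: r_def min_le_iff_disj)
    have sr: "s \<le> r" "s \<le> 1" "4 * s \<le> r" using s r by auto
    have xb: "x \<in> ball x\<^sub>0 (r / 4)" using s by auto
    have sub: "ball x\<^sub>0 (r / 4 + s) \<subseteq> ball x\<^sub>0 r" "ball x\<^sub>0 (r / 4 + s + s) \<subseteq> ball x\<^sub>0 r" "ball x\<^sub>0 (r / 4 + s + s + s) \<subseteq> ball x\<^sub>0 r"
      using sr s by (auto intro!: subset_ball)
    have hkl: "norm u \<le> s" if "u \<in> {h, k, l}" for u using that hk by auto
    have pt1: "x + u \<in> ball x\<^sub>0 (r / 4 + s)" if "u \<in> {h, k, l}" for u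
      by (rule mem_ball_shift[OF xb hkl[OF that]])
    have pt2: "x + u + v \<in> ball x\<^sub>0 (r / 4 + s + s)" if "u \<in> {h, k, l}" "v \<in> {h, k, l}" for u v
      by (rule mem_ball_shift[OF pt1 hkl]) (use that in auto)
    have pt3: "x + u + v + w \<in> ball x\<^sub>0 (r / 4 + s + s + s)" if "u \<in> {h, k, l}" "v \<in> {h, k, l}" "w \<in> {h, k, l}" for u v w
      by (rule mem_ball_shift[OF pt2 hkl]) (use that in auto)
    have pts: "x \<in> ball x\<^sub>0 r" "x + h \<in> ball x\<^sub>0 r" "x + k \<in> ball x\<^sub>0 r" "x + l \<in> ball x\<^sub>0 r"
      "x + h + k \<in> ball x\<^sub>0 r" "x + h + l \<in> ball x\<^sub>0 r" "x + k + l \<in> ball x\<^sub>0 r" "x + h + k + l \<in> ball x\<^sub>0 r"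
      by (use s sr in simp)
        ((rule subsetD[OF sub(1) pt1] subsetD[OF sub(2) pt2] subsetD[OF sub(3) pt3]; simp)+)
    define E where "E = s powr (1 + \<theta>)"
    have E: "s powr 1 * s powr \<theta> = E" "s powr 2 * s powr \<theta> \<le> E" "s powr 2 * s powr 0 \<le> E"
      unfolding E_def powr_add[symmetric] using assms(1,2) by (auto intro!: powr_le_powr_1[OF s(2) sr(2)])
    have F1: "\<bar>fdiffs [u] f x\<bar> \<le> C1 * s powr 1" if "u \<in> {h, k, l}" for u
      using r s sr pts hk that by (intro diff_bound_onD[OF c1(3), of r]) auto
    have F2: "\<bar>fdiffs [u, v] f x\<bar> \<le> C2 * s powr 2" if "u \<in> {h, k, l}" "v \<in> {h, k, l}" for u v
      using r s sr pts hk that by (intro diff_bound_onD[OF c2(3), of r]) auto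
    have F3: "\<bar>fdiffs [h, k, l] f x\<bar> \<le> C3 * s powr 2"
      using r s sr pts hk by (intro diff_bound_onD[OF c3(3), of r]) auto
    have G0: "\<bar>g p\<bar> \<le> D0 * s powr 0" if "p \<in> ball x\<^sub>0 r" for p
      using diff_bound_onD[OF g0(3), of r s p "[]"] r s sr that by simp
    have G1: "\<bar>fdiffs [u] g p\<bar> \<le> D1 * s powr \<theta>" if "u \<in> {h, k, l}" "p \<in> ball x\<^sub>0 r" for u p
      using r s sr hk that by (intro diff_bound_onD[OF g1(3), of r]) auto
    have G2: "\<bar>fdiffs [u, v] g p\<bar> \<le> D2 * s powr \<theta>" if "u \<in> {h, k, l}" "v \<in> {h, k, l}" "p \<in> ball x\<^sub>0 r" for u v p
      using r s sr hk that by (intro diff_bound_onD[OF g2(3), of r]) auto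
    have "\<bar>fdiffs [h, k, l] (\<lambda>x. f x * g x) x - f x * fdiffs [h, k, l] g x\<bar>
      \<le> \<bar>fdiffs [h] f x\<bar> * \<bar>fdiffs [k, l] g (x + h)\<bar> + \<bar>fdiffs [k] f x\<bar> * \<bar>fdiffs [h, l] g (x + k)\<bar>
     + \<bar>fdiffs [l] f x\<bar> * \<bar>fdiffs [h, k] g (x + l)\<bar> + \<bar>fdiffs [h, k] f x\<bar> * \<bar>fdiffs [l] g (x + h + k)\<bar>
     + \<bar>fdiffs [h, l] f x\<bar> * \<bar>fdiffs [k] g (x + h + l)\<bar> + \<bar>fdiffs [k, l] f x\<bar> * \<bar>fdiffs [h] g (x + k + l)\<bar>
     + \<bar>fdiffs [h, k, l] f x\<bar> * \<bar>g (x + h + k + l)\<bar>"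
      unfolding fdiffs_mult3 abs_mult[symmetric] by linarith
    also have "\<dots> \<le> (C1 * s powr 1) * (D2 * s powr \<theta>) + (C1 * s powr 1) * (D2 * s powr \<theta>) + (C1 * s powr 1) * (D2 * s powr \<theta>)
      + (C2 * s powr 2) * (D1 * s powr \<theta>) + (C2 * s powr 2) * (D1 * s powr \<theta>) + (C2 * s powr 2) * (D1 * s powr \<theta>)
      + (C3 * s powr 2) * (D0 * s powr 0)"
      by (intro add_mono mult_mono F1 F2 F3 G0 G1 G2 pts) (use c1 c2 c3 g0 g1 g2 in auto)
    also have "\<dots> = 3 * (C1 * D2) * (s powr 1 * s powr \<theta>) + 3 * (C2 * D1) * (s powr 2 * s powr \<theta>) + C3 * D0 * (s powr 2 * s powr 0)"
      by simp
    also have "\<dots> \<le> 3 * (C1 * D2) * E + 3 * (C2 * D1) * E + C3 * D0 * E"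
      using E c1 c2 c3 g0 g1 g2 by (intro add_mono mult_left_mono) auto
    finally show ?thesis by (simp add: C_def E_def distrib_right)
  qed
  have "0 < r / 4" "0 \<le> C" using c1 c2 c3 g0 g1 g2 by (auto simp: r_def C_def)
  then show ?thesis using bound by blast
qed

text \<open>Marchaud's inequality, from \<open>\<Delta>\<^bsub>2 h\<^esub> = 2 \<Delta>\<^sub>h + \<Delta>\<^sub>h\<^sup>2\<close>.\<close>

lemma diff_bound_marchaud:
  fixes g :: "'a::real_normed_vector \<Rightarrow> real"
  assumes "\<beta> < 1" "0 < \<beta>" and g: "diff_bound 3 (1 + \<beta>) g x\<^sub>0" "diff_bound 0 0 g x\<^sub>0"
  shows "diff_bound 2 (1 + \<beta>) g x\<^sub>0"
proof -
  obtain r3 C where c3: "0 < r3" "0 \<le> C" "diff_bound_on r3 C 3 (1 + \<beta>) g x\<^sub>0"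
    by (rule diff_boundE[OF g(1)]) blast
  have "diff_bound 2 0 g x\<^sub>0" using diff_bound_Suc[OF diff_bound_Suc[OF g(2)]] by (simp add: numeral_2_eq_2)
  then obtain r2 B where c2: "0 < r2" "0 \<le> B" "diff_bound_on r2 B 2 0 g x\<^sub>0"
    by (rule diff_boundE)
  define R where "R = min r2 r3 / 2"
  have R: "0 < R" "2 * R \<le> r2" "2 * R \<le> r3" using c2 c3 by (auto simp: R_def)
  \<comment> \<open>Doubling the increments reproduces the constant with the factor
    2^(\<open>\<beta>\<close> - 1) < 1. A is taken so large that this contraction closes and that
    the coarsest scales, from R / 2 to R, are covered.\<close>
  define \<epsilon> where "\<epsilon> = 1 - 2 powr (\<beta> - 1)"
  have \<epsilon>: "0 < \<epsilon>" using assms powr_less_mono[of "\<beta> - 1" 0 2] by (simp add: \<epsilon>_def)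
  define A where "A = max (B / (R / 2) powr (1 + \<beta>)) (3 / 2 * C / \<epsilon>)"
  have "3 / 2 * C / \<epsilon> \<le> A" by (simp add: A_def)
  then have "3 / 2 * C \<le> A * \<epsilon>" using \<epsilon> by (simp add: divide_le_eq)
  then have A: "2 powr (\<beta> - 1) * A + 3 / 2 * C \<le> A" by (simp add: \<epsilon>_def algebra_simps)
  have "B / (R / 2) powr (1 + \<beta>) \<le> A" by (simp add: A_def)
  then have AB: "B \<le> A * (R / 2) powr (1 + \<beta>)" using R by (simp add: divide_le_eq)
  have A0: "0 \<le> A" using \<epsilon> c3 by (auto simp: A_def le_max_iff_disj)
  \<comment> \<open>Induction from coarse to fine scales, n counting the halvings of R.\<close>
  have claim: "\<bar>fdiffs [h, k] g x\<bar> \<le> A * s powr (1 + \<beta>)"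
    if "R / 2 ^ Suc n < s" "s \<le> R" "x \<in> ball x\<^sub>0 R" "norm h \<le> s" "norm k \<le> s" for n s x h k
    using that
  proof (induction n arbitrary: s h k)
    case 0
    have s: "0 < s" using 0(1) R(1) by simp
    have "\<bar>fdiffs [h, k] g x\<bar> \<le> B * s powr 0" using 0 s R by (intro diff_bound_onD[OF c2(3), of "2 * R"]) auto
    also have "\<dots> \<le> A * (R / 2) powr (1 + \<beta>)" using AB s by simp
    also have "\<dots> \<le> A * s powr (1 + \<beta>)" using 0(1) R(1) A0 assms by (intro mult_left_mono powr_mono2) auto
    finally show ?case .
  next
    case (Suc n)
    have "0 < R / 2 ^ Suc (Suc n)" using R(1) by simp
    then have s: "0 < s" using Suc.prems(1) by linarith
    show ?case
    proof (cases "R / 2 ^ Suc n < s")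
      case True
      then show ?thesis using Suc.IH Suc.prems by simp
    next
      case False
      have "R / 2 ^ Suc n \<le> R / 2" using R(1) by (intro divide_left_mono) auto
      then have s2: "2 * s \<le> R" using False by linarith
      have s3: "R / 2 ^ Suc n < 2 * s" using Suc.prems(1) by (simp add: field_simps)
      have "norm (h + h) \<le> 2 * s" "norm (k + k) \<le> 2 * s"
        using Suc.prems(4,5) norm_triangle_ineq[of h h] norm_triangle_ineq[of k k] by linarith+
      then have IH: "\<bar>fdiffs [h + h, k + k] g x\<bar> \<le> A * (2 * s) powr (1 + \<beta>)"
        using Suc.IH[of "2 * s" "h + h" "k + k"] s2 s3 Suc.prems(3) by simp
      have "\<bar>fdiffs [u, v, w] g p\<bar> \<le> C * s powr (1 + \<beta>)" if "{u, v, w} \<subseteq> {h, k}" "p \<in> ball x\<^sub>0 (2 * R)" for u v w p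
        using that Suc.prems R s by (intro diff_bound_onD[OF c3(3), of "2 * R"]) auto
      moreover have "x + k \<in> ball x\<^sub>0 (2 * R)" "x \<in> ball x\<^sub>0 (2 * R)"
        using mem_ball_shift[OF Suc.prems(3,5)] Suc.prems(2,3) R(1) by auto
      ultimately have T: "\<bar>fdiffs [h, k, k] g x\<bar> \<le> C * s powr (1 + \<beta>)" "\<bar>fdiffs [h, h, k] g x\<bar> \<le> C * s powr (1 + \<beta>)"
         "\<bar>fdiffs [h, h, k] g (x + k)\<bar> \<le> C * s powr (1 + \<beta>)" by blast+
      \<comment> \<open>The doubling formula applied to both increments; the fourth-order term is
        written as a difference of third-order ones.\<close>
      have "fdiffs [h + h, k + k] g x = 4 * fdiffs [h, k] g x + 2 * fdiffs [h, k, k] g x + 2 * fdiffs [h, h, k] g x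
          + (fdiffs [h, h, k] g (x + k) - fdiffs [h, h, k] g x)"
        by (simp add: fdiffs_Cons algebra_simps del: foldr.simps(2))
      then have "4 * \<bar>fdiffs [h, k] g x\<bar> \<le> A * (2 * s) powr (1 + \<beta>) + 6 * (C * s powr (1 + \<beta>))"
        using IH T by linarith
      also have "A * (2 * s) powr (1 + \<beta>) = 4 * (2 powr (\<beta> - 1) * A * s powr (1 + \<beta>))"
        using s by (simp add: powr_mult powr_diff powr_add)
      finally have "\<bar>fdiffs [h, k] g x\<bar> \<le> (2 powr (\<beta> - 1) * A + 3 / 2 * C) * s powr (1 + \<beta>)"
        by (simp add: distrib_right)
      also have "\<dots> \<le> A * s powr (1 + \<beta>)" using A by (intro mult_right_mono) auto
      finally show ?thesis .
    qed
  qed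
  show ?thesis
  proof (rule diff_boundI[OF R(1) A0])
    fix s x and hs :: "'a list"
    assume s: "0 < s" "s \<le> R" "x \<in> ball x\<^sub>0 R" "length hs = 2" and nh: "\<And>h. h \<in> set hs \<Longrightarrow> norm h \<le> s"
    obtain h k where hs: "hs = [h, k]" using s(4) by (auto simp: length_Suc_conv numeral_2_eq_2)
    obtain n where "R / s < 2 ^ n" using real_arch_pow[of 2 "R / s"] by auto
    also have "(2::real) ^ n \<le> 2 ^ Suc n" by simp
    finally have "R / 2 ^ Suc n < s" using s(1) by (simp add: field_simps)
    then show "\<bar>fdiffs hs g x\<bar> \<le> A * s powr (1 + \<beta>)"
      unfolding hs using s nh by (intro claim) (auto simp: hs)
  qed
qed

section \<open>From difference bounds to derivatives\<close>

text \<open>Halving the increment changes the quotient by 2^n times a second difference, which is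
  bounded by a geometric sequence with ratio 2^(-\<open>\<beta>\<close>). So the quotients converge,
  and the sum of the series bounds the distance from the first one to the limit.\<close>

lemma dyadic_difference_quotients:
  fixes g :: "'a::real_normed_vector \<Rightarrow> real"
  assumes "0 < \<beta>" "0 \<le> A"
    and bound: "\<And>n. \<bar>fdiffs [(1 / 2 ^ n) *\<^sub>R h, (1 / 2 ^ n) *\<^sub>R h] g x\<bar> \<le> A * (1 / 2 ^ n) powr (1 + \<beta>)"
  shows "convergent (\<lambda>n. 2 ^ n * (g (x + (1 / 2 ^ n) *\<^sub>R h) - g x))"
    and "(\<lambda>n. 2 ^ n * (g (x + (1 / 2 ^ n) *\<^sub>R h) - g x)) \<longlonglongrightarrow> L \<Longrightarrow>
      \<bar>g (x + h) - g x - L\<bar> \<le> A / (1 - 2 powr (- \<beta>))"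
proof -
  define \<phi> where "\<phi> n = 2 ^ n * (g (x + (1 / 2 ^ n) *\<^sub>R h) - g x)" for n :: nat
  define q where "q = 2 powr (- \<beta>)"
  have q: "0 < q" "q < 1" using assms(1) powr_less_mono[of "- \<beta>" 0 2] by (auto simp: q_def)
  have step: "\<bar>\<phi> n - \<phi> (Suc n)\<bar> \<le> A * q ^ n" for n
  proof -
    let ?k = "(1 / 2 ^ Suc n) *\<^sub>R h"
    have "?k + ?k = (1 / 2 ^ n) *\<^sub>R h" by (simp add: scaleR_left_distrib[symmetric])
    then have "\<phi> n - \<phi> (Suc n) = 2 ^ n * fdiffs [?k, ?k] g x"
      by (simp add: \<phi>_def fdiffs_Cons algebra_simps del: foldr.simps(2))
    then have "\<bar>\<phi> n - \<phi> (Suc n)\<bar> \<le> 2 ^ n * (A * (1 / 2 ^ Suc n) powr (1 + \<beta>))"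
      using bound[of "Suc n"] by (simp add: abs_mult)
    also have "(1 / 2 ^ Suc n) powr (1 + \<beta>) \<le> (1 / 2 ^ n) powr (1 + \<beta>)"
      using assms(1) by (intro powr_mono2) (auto simp: divide_simps)
    also have "(1 / 2 ^ n :: real) powr (1 + \<beta>) = (1 / 2 ^ n) * q ^ n"
    proof -
      have "(1 / 2 ^ n :: real) = 2 powr (- real n)" by (simp add: powr_minus_divide powr_realpow)
      then show ?thesis by (simp add: powr_powr q_def powr_add[symmetric] powr_realpow[symmetric] algebra_simps)
    qed
    finally show ?thesis using assms(2) by (simp add: mult_left_mono)
  qed
  have sm: "summable (\<lambda>n. A * q ^ n)" using q by (intro summable_mult summable_geometric) auto
  have "summable (\<lambda>n. \<phi> n - \<phi> (Suc n))"
    by (rule summable_comparison_test[OF _ sm]) (use step in auto)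
  then have "convergent (\<lambda>n. \<Sum>i<n. \<phi> i - \<phi> (Suc i))" by (simp add: summable_iff_convergent)
  then have "convergent (\<lambda>n. \<phi> 0 - \<phi> n)" by (simp add: sum_lessThan_telescope')
  from convergent_diff[OF convergent_const this, of "\<phi> 0"]
  have "convergent (\<lambda>n. \<phi> 0 - (\<phi> 0 - \<phi> n))" .
  moreover have "(\<lambda>n. \<phi> 0 - (\<phi> 0 - \<phi> n)) = \<phi>" by auto
  ultimately have "convergent \<phi>" by (simp only:)
  then show "convergent (\<lambda>n. 2 ^ n * (g (x + (1 / 2 ^ n) *\<^sub>R h) - g x))" by (simp add: \<phi>_def[abs_def])
  assume L: "(\<lambda>n. 2 ^ n * (g (x + (1 / 2 ^ n) *\<^sub>R h) - g x)) \<longlonglongrightarrow> L"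
  have "\<bar>\<phi> 0 - \<phi> n\<bar> \<le> A / (1 - q)" for n
  proof -
    have "\<phi> 0 - \<phi> n = (\<Sum>i<n. \<phi> i - \<phi> (Suc i))" by (simp add: sum_lessThan_telescope')
    also have "\<bar>\<dots>\<bar> \<le> (\<Sum>i<n. A * q ^ i)" using step by (intro order_trans[OF sum_abs] sum_mono)
    also have "\<dots> \<le> (\<Sum>i. A * q ^ i)" using q assms(2) by (intro sum_le_suminf sm) auto
    also have "\<dots> = A / (1 - q)" using q by (simp add: suminf_mult suminf_geometric)
    finally show ?thesis .
  qed
  moreover have "(\<lambda>n. \<bar>\<phi> 0 - \<phi> n\<bar>) \<longlonglongrightarrow> \<bar>\<phi> 0 - L\<bar>"
    using L unfolding \<phi>_def[abs_def] by (intro tendsto_intros)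
  ultimately have "\<bar>\<phi> 0 - L\<bar> \<le> A / (1 - q)" by (intro LIMSEQ_le_const2) auto
  then show "\<bar>g (x + h) - g x - L\<bar> \<le> A / (1 - 2 powr (- \<beta>))" by (simp add: \<phi>_def q_def)
qed

lemma dyadic_quotients_tendsto_derivative:
  fixes g :: "real^'n::finite \<Rightarrow> real"
  assumes "g differentiable (at x)"
  shows "(\<lambda>n. 2 ^ n * (g (x + (1 / 2 ^ n) *\<^sub>R h) - g x)) \<longlonglongrightarrow> (\<Sum>i\<in>UNIV. h $ i * pderiv_dir i g x)"
proof -
  have "((\<lambda>t. g (x + t *\<^sub>R h)) has_real_derivative (\<Sum>i\<in>UNIV. h $ i * pderiv_dir i g x)) (at 0)"
    using DERIV_along_line[of g x 0 h] assms by simp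
  then have lim: "((\<lambda>t. (g (x + t *\<^sub>R h) - g x) / t) \<longlongrightarrow> (\<Sum>i\<in>UNIV. h $ i * pderiv_dir i g x)) (at 0)"
    by (simp add: DERIV_def)
  have "(\<lambda>n. (1 / 2) ^ n :: real) \<longlonglongrightarrow> 0" by (intro LIMSEQ_power_zero) simp
  then have "filterlim (\<lambda>n. (1 / 2) ^ n :: real) (at 0) sequentially"
    by (intro filterlim_atI) auto
  have "(\<lambda>n. (g (x + (1 / 2) ^ n *\<^sub>R h) - g x) / (1 / 2) ^ n) \<longlonglongrightarrow> (\<Sum>i\<in>UNIV. h $ i * pderiv_dir i g x)"
    by (rule filterlim_compose[where g = "\<lambda>t. (g (x + t *\<^sub>R h) - g x) / t" and f = "\<lambda>n. (1 / 2) ^ n"]) fact+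
  moreover have "(g (x + (1 / 2) ^ n *\<^sub>R h) - g x) / (1 / 2) ^ n = 2 ^ n * (g (x + (1 / 2 ^ n) *\<^sub>R h) - g x)" for n
    by (simp add: power_one_over)
  ultimately show ?thesis by (simp only:)
qed

lemma powr_dyadic: "0 < (s::real) \<Longrightarrow> (s / 2 ^ n) powr \<gamma> = s powr \<gamma> * (1 / 2 ^ n) powr \<gamma>"
  using powr_mult[of s "1 / 2 ^ n" \<gamma>] by simp

lemma first_order_taylor_bound:
  fixes g :: "real^'n::finite \<Rightarrow> real"
  assumes "0 < \<beta>" "open U" "x\<^sub>0 \<in> U" "\<And>x. x \<in> U \<Longrightarrow> g differentiable (at x)" "diff_bound 2 (1 + \<beta>) g x\<^sub>0"
  shows "\<exists>r>0. \<exists>C\<ge>0. \<forall>r' s x h. r' \<le> r \<longrightarrow> 0 < s \<longrightarrow> s \<le> r' \<longrightarrow> x \<in> ball x\<^sub>0 r' \<longrightarrow> norm h \<le> s \<longrightarrow>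
    \<bar>g (x + h) - g x - (\<Sum>i\<in>UNIV. h $ i * pderiv_dir i g x)\<bar> \<le> C * s powr (1 + \<beta>)"
proof -
  obtain r C where rC: "0 < r" "0 \<le> C" and *: "diff_bound_on r C 2 (1 + \<beta>) g x\<^sub>0"
    by (rule diff_boundE[OF assms(5)]) blast
  obtain e where e: "0 < e" "ball x\<^sub>0 e \<subseteq> U" using assms(2,3) open_contains_ball by blast
  define D where "D = C / (1 - 2 powr (- \<beta>))"
  have "\<bar>g (x + h) - g x - (\<Sum>i\<in>UNIV. h $ i * pderiv_dir i g x)\<bar> \<le> D * s powr (1 + \<beta>)"
    if s: "r' \<le> min r e" "0 < s" "s \<le> r'" "x \<in> ball x\<^sub>0 r'" "norm h \<le> s" for r' s x h
  proof -
    have "\<bar>fdiffs [(1 / 2 ^ n) *\<^sub>R h, (1 / 2 ^ n) *\<^sub>R h] g x\<bar> \<le> C * s powr (1 + \<beta>) * (1 / 2 ^ n) powr (1 + \<beta>)" for n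
    proof -
      have n: "s / 2 ^ n \<le> s" "norm ((1 / 2 ^ n) *\<^sub>R h) \<le> s / 2 ^ n"
        using s by (auto simp: divide_simps mult_le_cancel_left1)
      have "\<bar>fdiffs [(1 / 2 ^ n) *\<^sub>R h, (1 / 2 ^ n) *\<^sub>R h] g x\<bar> \<le> C * (s / 2 ^ n) powr (1 + \<beta>)"
        using s n by (intro diff_bound_onD[OF *, of r']) auto
      then show ?thesis by (simp only: powr_dyadic[OF s(2)] mult.assoc)
    qed
    moreover have "g differentiable (at x)" using s e(2) by (intro assms(4) subsetD[OF e(2)]) auto
    ultimately have "\<bar>g (x + h) - g x - (\<Sum>i\<in>UNIV. h $ i * pderiv_dir i g x)\<bar> \<le> C * s powr (1 + \<beta>) / (1 - 2 powr (- \<beta>))"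
      using rC assms(1) dyadic_quotients_tendsto_derivative[of g x h]
      by (intro dyadic_difference_quotients(2)) auto
    then show ?thesis by (simp add: D_def)
  qed
  moreover have "0 \<le> D" using rC assms(1) powr_less_mono[of "- \<beta>" 0 2] by (simp add: D_def)
  ultimately show ?thesis using rC e by (intro exI[of _ "min r e"] conjI exI[of _ D]) auto
qed

lemma norm_axis: "norm (axis i s :: real^'n::finite) = \<bar>s\<bar>"
  by (simp add: norm_eq_sqrt_inner inner_axis_axis)

lemma sum_axis_mult: "(\<Sum>k\<in>UNIV. (axis i c :: real^'n::finite) $ k * g k) = c * g i"
  by (simp add: axis_def if_distrib[of "\<lambda>u. u * _"] cong: if_cong)

text \<open>The first-order expansions at x and x + h, in direction i with a step of the full length
  s, are subtracted; division by s costs exactly one power.\<close>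

lemma diff_bound_pderiv_dir1:
  fixes g :: "real^'n::finite \<Rightarrow> real"
  assumes "0 < \<beta>" "open U" "x\<^sub>0 \<in> U" "\<And>x. x \<in> U \<Longrightarrow> g differentiable (at x)" "diff_bound 2 (1 + \<beta>) g x\<^sub>0"
  shows "diff_bound 1 \<beta> (pderiv_dir i g) x\<^sub>0"
proof -
  obtain r C where rC: "0 < r" "0 \<le> C" and *: "diff_bound_on r C 2 (1 + \<beta>) g x\<^sub>0"
    by (rule diff_boundE[OF assms(5)]) blast
  obtain q D where qD: "0 < q" "0 \<le> D" and T: "\<And>r' s x h. r' \<le> q \<Longrightarrow> 0 < s \<Longrightarrow> s \<le> r' \<Longrightarrow> x \<in> ball x\<^sub>0 r' \<Longrightarrow> norm h \<le> s \<Longrightarrow>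
    \<bar>g (x + h) - g x - (\<Sum>i\<in>UNIV. h $ i * pderiv_dir i g x)\<bar> \<le> D * s powr (1 + \<beta>)"
    using first_order_taylor_bound[OF assms] by blast
  define R where "R = min r q"
  have R: "0 < R" "R \<le> r" "R \<le> q" using rC qD by (auto simp: R_def)
  show ?thesis
  proof (rule diff_boundI)
    show "0 < R / 2" "0 \<le> C + 2 * D" using R rC qD by auto
    fix s x and hs :: "(real^'n) list"
    assume s: "0 < s" "s \<le> R / 2" "x \<in> ball x\<^sub>0 (R / 2)" "length hs = 1" and nh: "\<And>h. h \<in> set hs \<Longrightarrow> norm h \<le> s"
    obtain h where hs: "hs = [h]" using s(4) by (auto simp: length_Suc_conv)
    have h: "norm h \<le> s" using nh by (simp add: hs)
    have xb: "x \<in> ball x\<^sub>0 R" using s(3) R(1) by auto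
    have xhb: "x + h \<in> ball x\<^sub>0 R" using mem_ball_shift[OF s(3) h] s(2) by auto
    have nk: "norm (axis i s :: real^'n) \<le> s" using s(1) by (simp add: norm_axis)
    let ?k = "axis i s :: real^'n"
    have "\<bar>fdiffs [h, ?k] g x\<bar> \<le> C * s powr (1 + \<beta>)" using s(1,2) R xb h nk by (intro diff_bound_onD[OF *, of R]) auto
    moreover have "\<bar>g (x + ?k) - g x - s * pderiv_dir i g x\<bar> \<le> D * s powr (1 + \<beta>)"
      using T[of R s x ?k] s(1,2) R xb nk by (simp add: sum_axis_mult)
    moreover have "\<bar>g (x + h + ?k) - g (x + h) - s * pderiv_dir i g (x + h)\<bar> \<le> D * s powr (1 + \<beta>)"
      using T[of R s "x + h" ?k] s(1,2) R xhb nk by (simp add: sum_axis_mult)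
    moreover have "fdiffs [h, ?k] g x = g (x + h + ?k) - g (x + h) - (g (x + ?k) - g x)"
      by (simp add: fdiffs_Cons del: foldr.simps(2))
    ultimately have "\<bar>s * pderiv_dir i g (x + h) - s * pderiv_dir i g x\<bar> \<le> C * s powr (1 + \<beta>) + 2 * (D * s powr (1 + \<beta>))"
      by linarith
    also have "\<dots> = s * ((C + 2 * D) * s powr \<beta>)" using s(1) by (simp add: powr_add algebra_simps)
    finally have "s * \<bar>pderiv_dir i g (x + h) - pderiv_dir i g x\<bar> \<le> s * ((C + 2 * D) * s powr \<beta>)"
      using s(1) by (simp add: right_diff_distrib[symmetric] abs_mult)
    then show "\<bar>fdiffs hs (pderiv_dir i g) x\<bar> \<le> (C + 2 * D) * s powr \<beta>"
      using s(1) by (simp add: hs fdiffs_Cons del: foldr.simps(2))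
  qed
qed

lemma fdiff_subdivide:
  fixes F :: "'a::real_normed_vector \<Rightarrow> real"
  assumes "0 < N" "\<And>i. i < N \<Longrightarrow> \<bar>F (x + (real i / real N) *\<^sub>R h + (1 / real N) *\<^sub>R h) - F (x + (real i / real N) *\<^sub>R h)\<bar> \<le> B"
  shows "\<bar>F (x + h) - F x\<bar> \<le> real N * B"
proof -
  have eq: "x + (real i / real N) *\<^sub>R h + (1 / real N) *\<^sub>R h = x + (real (Suc i) / real N) *\<^sub>R h" for i
    by (simp add: add_divide_distrib scaleR_left_distrib)
  have "F (x + h) - F x = (\<Sum>i<N. F (x + (real (Suc i) / real N) *\<^sub>R h) - F (x + (real i / real N) *\<^sub>R h))"
    using sum_lessThan_telescope[of "\<lambda>i. F (x + (real i / real N) *\<^sub>R h)" N] assms(1) by simp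
  also have "\<bar>\<dots>\<bar> \<le> (\<Sum>i<N. B)"
    using assms(2) unfolding eq by (intro order_trans[OF sum_abs] sum_mono) auto
  finally show ?thesis by simp
qed

text \<open>
  The bound of order \<open>2 + \<beta>\<close> for increments of equal size gives, after subdividing the outer
  increment \<open>h\<close>, one of order \<open>1 + \<beta>\<close> for the second differences of \<open>\<Delta>\<^sub>h g\<close> at all finer scales.
\<close>

lemma diff_bound_pderiv_dir2:
  fixes g :: "real^'n::finite \<Rightarrow> real"
  assumes "0 < \<beta>" "open U" "x\<^sub>0 \<in> U" "\<And>x. x \<in> U \<Longrightarrow> g differentiable (at x)" "diff_bound 3 (2 + \<beta>) g x\<^sub>0"
  shows "diff_bound 2 (1 + \<beta>) (pderiv_dir i g) x\<^sub>0"
proof -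
  obtain r C where rC: "0 < r" "0 \<le> C" and *: "diff_bound_on r C 3 (2 + \<beta>) g x\<^sub>0"
    by (rule diff_boundE[OF assms(5)]) blast
  obtain e where e: "0 < e" "ball x\<^sub>0 e \<subseteq> U" using assms(2,3) open_contains_ball by blast
  define R where "R = min r e"
  have R: "0 < R" "R \<le> r" "R \<le> e" using rC e by (auto simp: R_def)
  define D where "D = C / (1 - 2 powr (- \<beta>))"
  have D0: "0 \<le> D" using rC assms(1) powr_less_mono[of "- \<beta>" 0 2] by (simp add: D_def)
  have taylor: "\<bar>fdiffs [h] g (x + k) - fdiffs [h] g x - (\<Sum>i\<in>UNIV. k $ i * fdiffs [h] (pderiv_dir i g) x)\<bar> \<le> D * s powr (2 + \<beta>)"
    if s: "0 < s" "s \<le> R / 4" "x \<in> ball x\<^sub>0 (R / 2)" "norm h \<le> s" "norm k \<le> s" for s x h k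
  proof -
    have bound: "\<bar>fdiffs [(1 / 2 ^ n) *\<^sub>R k, (1 / 2 ^ n) *\<^sub>R k] (fdiffs [h] g) x\<bar> \<le> C * s powr (2 + \<beta>) * (1 / 2 ^ n) powr (1 + \<beta>)" for n
    proof -
      let ?k = "(1 / 2 ^ n) *\<^sub>R k"
      have n: "s / 2 ^ n \<le> s" "norm ?k \<le> s / 2 ^ n" "norm ((1 / 2 ^ n) *\<^sub>R h) \<le> s / 2 ^ n"
        using s by (auto simp: divide_simps mult_le_cancel_left1)
      have step: "\<bar>fdiffs [?k, ?k] g (x + (real i / real (2 ^ n)) *\<^sub>R h + (1 / real (2 ^ n)) *\<^sub>R h)
          - fdiffs [?k, ?k] g (x + (real i / real (2 ^ n)) *\<^sub>R h)\<bar> \<le> C * (s / 2 ^ n) powr (2 + \<beta>)" if "i < 2 ^ n" for i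
      proof -
        have "real i < 2 ^ n" using that by (metis of_nat_less_iff of_nat_numeral of_nat_power)
        then have "real i / 2 ^ n * norm h \<le> 1 * s" using s by (intro mult_mono) (auto simp: divide_simps)
        then have "norm ((real i / real (2 ^ n)) *\<^sub>R h) \<le> s" by simp
        then have "x + (real i / real (2 ^ n)) *\<^sub>R h \<in> ball x\<^sub>0 (R / 2 + s)" using s(3) by (intro mem_ball_shift)
        then have "x + (real i / real (2 ^ n)) *\<^sub>R h \<in> ball x\<^sub>0 R" using s(2) R(1) by auto
        then have "\<bar>fdiffs [(1 / 2 ^ n) *\<^sub>R h, ?k, ?k] g (x + (real i / real (2 ^ n)) *\<^sub>R h)\<bar> \<le> C * (s / 2 ^ n) powr (2 + \<beta>)"
          using s n R by (intro diff_bound_onD[OF *, of R]) auto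
        then show ?thesis by (simp add: fdiffs_Cons[of "(1 / 2 ^ n) *\<^sub>R h"] del: foldr.simps(2))
      qed
      have "fdiffs [?k, ?k] (fdiffs [h] g) x = fdiffs [?k, ?k] g (x + h) - fdiffs [?k, ?k] g x"
        by (simp add: fdiffs_Cons algebra_simps del: foldr.simps(2))
      \<comment> \<open>Cutting h into 2^n pieces makes all three increments at most s / 2^n. The
        number of pieces uses up one power and leaves 1 + \<open>\<beta>\<close>, still above
        1.\<close>
      then have "\<bar>fdiffs [?k, ?k] (fdiffs [h] g) x\<bar> \<le> real (2 ^ n) * (C * (s / 2 ^ n) powr (2 + \<beta>))"
        using fdiff_subdivide[of "2 ^ n" "fdiffs [?k, ?k] g" x h, OF _ step] by simp
      also have "\<dots> = C * s powr (2 + \<beta>) * (2 ^ n * (1 / 2 ^ n) powr (2 + \<beta>))"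
        by (simp add: powr_dyadic[OF s(1)])
      also have "2 ^ n * (1 / 2 ^ n :: real) powr (2 + \<beta>) = (1 / 2 ^ n) powr (1 + \<beta>)"
        using powr_add[of "1 / 2 ^ n :: real" 1 "1 + \<beta>"] by (simp add: add.assoc[symmetric])
      finally show ?thesis .
    qed
    have xh: "x \<in> ball x\<^sub>0 R" "x + h \<in> ball x\<^sub>0 R"
      using s(2,3) R(1) mem_ball_shift[OF s(3,4)] by auto
    have "norm (x - x\<^sub>0) + real (length [h]) * s < R" using s by (simp add: dist_norm norm_minus_commute)
    moreover have "\<And>y. y \<in> ball x\<^sub>0 R \<Longrightarrow> g differentiable at y" using R(3) e(2) assms(4) by (meson subsetD subset_ball)
    ultimately have G: "fdiffs [h] g differentiable (at x)" "pderiv_dir i (fdiffs [h] g) x = fdiffs [h] (pderiv_dir i g) x" for i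
      using fdiffs_pderiv_dir[of x\<^sub>0 R g x "[h]" s i] s(4) by (auto simp del: foldr.simps)
    have "\<bar>fdiffs [h] g (x + k) - fdiffs [h] g x - (\<Sum>i\<in>UNIV. k $ i * pderiv_dir i (fdiffs [h] g) x)\<bar>
        \<le> C * s powr (2 + \<beta>) / (1 - 2 powr (- \<beta>))"
      using rC assms(1) bound dyadic_quotients_tendsto_derivative[OF G(1), of k]
      by (intro dyadic_difference_quotients(2)) auto
    then show ?thesis by (simp add: D_def G(2) del: foldr.simps)
  qed
  show ?thesis
  proof (rule diff_boundI)
    show "0 < R / 4" "0 \<le> C + 2 * D" using R rC D0 by auto
    fix s x and hs :: "(real^'n) list"
    assume s: "0 < s" "s \<le> R / 4" "x \<in> ball x\<^sub>0 (R / 4)" "length hs = 2" and nh: "\<And>h. h \<in> set hs \<Longrightarrow> norm h \<le> s"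
    obtain h h' where hs: "hs = [h', h]" using s(4) by (auto simp: length_Suc_conv numeral_2_eq_2)
    have h: "norm h \<le> s" "norm h' \<le> s" using nh by (auto simp: hs)
    have xb: "x \<in> ball x\<^sub>0 (R / 2)" "x \<in> ball x\<^sub>0 R" using s(3) R(1) by auto
    have xhb: "x + h' \<in> ball x\<^sub>0 (R / 2)" using mem_ball_shift[OF s(3) h(2)] s(2) by auto
    let ?k = "axis i s :: real^'n"
    have nk: "norm ?k \<le> s" using s(1) by (simp add: norm_axis)
    have "\<bar>fdiffs [h', ?k, h] g x\<bar> \<le> C * s powr (2 + \<beta>)" using s(1,2) R xb h nk by (intro diff_bound_onD[OF *, of R]) auto
    moreover have "\<bar>fdiffs [h] g (x + ?k) - fdiffs [h] g x - s * fdiffs [h] (pderiv_dir i g) x\<bar> \<le> D * s powr (2 + \<beta>)"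
      using taylor[OF s(1,2) xb(1) h(1) nk] by (simp add: sum_axis_mult del: foldr.simps)
    moreover have "\<bar>fdiffs [h] g (x + h' + ?k) - fdiffs [h] g (x + h') - s * fdiffs [h] (pderiv_dir i g) (x + h')\<bar> \<le> D * s powr (2 + \<beta>)"
      using taylor[OF s(1,2) xhb h(1) nk] by (simp add: sum_axis_mult del: foldr.simps)
    moreover have "fdiffs [h', ?k, h] g x = fdiffs [h] g (x + h' + ?k) - fdiffs [h] g (x + h') - (fdiffs [h] g (x + ?k) - fdiffs [h] g x)"
      by (simp only: fdiffs_Cons[of h'] fdiffs_Cons[of ?k])
    ultimately have "\<bar>s * fdiffs [h] (pderiv_dir i g) (x + h') - s * fdiffs [h] (pderiv_dir i g) x\<bar> \<le> C * s powr (2 + \<beta>) + 2 * (D * s powr (2 + \<beta>))"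
      by linarith
    also have "\<dots> = s * ((C + 2 * D) * s powr (1 + \<beta>))"
      using s(1) powr_add[of s 1 "1 + \<beta>"] by (simp add: add.assoc[symmetric] algebra_simps)
    finally have "s * \<bar>fdiffs [h] (pderiv_dir i g) (x + h') - fdiffs [h] (pderiv_dir i g) x\<bar> \<le> s * ((C + 2 * D) * s powr (1 + \<beta>))"
      using s(1) by (simp add: right_diff_distrib[symmetric] abs_mult del: foldr.simps)
    then show "\<bar>fdiffs hs (pderiv_dir i g) x\<bar> \<le> (C + 2 * D) * s powr (1 + \<beta>)"
      using s(1) unfolding hs fdiffs_Cons[of h'] by simp
  qed
qed

text \<open>Additivity gives homogeneity over the integers. Splitting n c into integer and
  fractional part shows that n times the defect of homogeneity at c stays bounded for all n, so the
  defect vanishes.\<close>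

lemma additive_bounded_imp_linear:
  fixes Q :: "'a::real_normed_vector \<Rightarrow> real"
  assumes add: "\<And>x y. Q (x + y) = Q x + Q y" and "0 < r" and bound: "\<And>h. norm h \<le> r \<Longrightarrow> \<bar>Q h\<bar> \<le> M"
  shows "linear Q"
proof (rule linearI[OF add])
  fix c :: real and h :: 'a
  have Q0: "Q 0 = 0" using add[of 0 0] by simp
  have minus: "Q (- x) = - Q x" for x using add[of x "- x"] Q0 by simp
  have nat: "Q (real n *\<^sub>R x) = real n * Q x" for n x
    by (induction n) (simp_all add: Q0 scaleR_left_distrib add distrib_right)
  have int: "Q (real_of_int m *\<^sub>R x) = real_of_int m * Q x" for m x
    by (cases m rule: int_cases2) (simp_all add: nat minus)
  obtain N where N: "norm h / r < real N" "0 < N"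
    by (metis reals_Archimedean2 gr0I less_le_trans norm_ge_zero divide_nonneg_pos \<open>0 < r\<close> not_less of_nat_0)
  have B: "\<bar>Q (t *\<^sub>R h)\<bar> \<le> real N * M" if "0 \<le> t" "t \<le> 1" for t
  proof -
    have "t * norm h \<le> norm h" using that by (simp add: mult_left_le_one_le)
    also have "norm h \<le> r * real N" using N(1) \<open>0 < r\<close> by (simp add: divide_less_eq mult.commute)
    finally have "norm ((t / real N) *\<^sub>R h) \<le> r" using that N(2) by (simp add: divide_le_eq)
    then have "\<bar>Q ((t / real N) *\<^sub>R h)\<bar> \<le> M" by (rule bound)
    moreover have "Q (t *\<^sub>R h) = real N * Q ((t / real N) *\<^sub>R h)" using nat[of N "(t / real N) *\<^sub>R h"] N(2) by simp
    ultimately show ?thesis by (simp add: abs_mult mult_left_mono)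
  qed
  have le: "real n * \<bar>Q (c *\<^sub>R h) - c * Q h\<bar> \<le> \<bar>Q h\<bar> + real N * M" for n
  proof -
    define m where "m = \<lfloor>real n * c\<rfloor>"
    define t where "t = real n * c - real_of_int m"
    have t: "0 \<le> t" "t \<le> 1" unfolding t_def m_def by linarith+
    have "real n * Q (c *\<^sub>R h) = Q (real_of_int m *\<^sub>R h + t *\<^sub>R h)"
      unfolding nat[symmetric] by (simp add: t_def scaleR_left_distrib[symmetric])
    also have "\<dots> = real_of_int m * Q h + Q (t *\<^sub>R h)" by (simp only: add int)
    finally have "real n * (Q (c *\<^sub>R h) - c * Q h) = real_of_int m * Q h + Q (t *\<^sub>R h) - real n * c * Q h"
      by (simp add: right_diff_distrib)
    also have "\<dots> = Q (t *\<^sub>R h) - t * Q h" by (simp add: t_def left_diff_distrib)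
    finally have "real n * (Q (c *\<^sub>R h) - c * Q h) = Q (t *\<^sub>R h) - t * Q h" .
    moreover have "\<bar>t * Q h\<bar> \<le> \<bar>Q h\<bar>" using t by (simp add: abs_mult mult_left_le_one_le)
    ultimately have "\<bar>real n * (Q (c *\<^sub>R h) - c * Q h)\<bar> \<le> \<bar>Q h\<bar> + real N * M" using B[OF t] by linarith
    then show ?thesis by (simp add: abs_mult)
  qed
  have "\<not> 0 < \<bar>Q (c *\<^sub>R h) - c * Q h\<bar>"
    using reals_Archimedean3[of "\<bar>Q (c *\<^sub>R h) - c * Q h\<bar>"] le by (meson not_less)
  then show "Q (c *\<^sub>R h) = c *\<^sub>R Q h" by simp
qed

lemma diff_bound1_imp_continuous_on:
  fixes g :: "'a::real_normed_vector \<Rightarrow> real"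
  assumes "0 < \<beta>" "diff_bound 1 \<beta> g x\<^sub>0"
  shows "\<exists>r>0. continuous_on (ball x\<^sub>0 r) g"
proof -
  obtain r C where rC: "0 < r" "0 \<le> C" and *: "diff_bound_on r C 1 \<beta> g x\<^sub>0"
    by (rule diff_boundE[OF assms(2)]) blast
  have "isCont g x" if x: "x \<in> ball x\<^sub>0 r" for x
  proof -
    have "((\<lambda>y. norm (y - x)) \<longlongrightarrow> 0) (at x)" by (rule tendsto_eq_intros | simp)+
    then have "((\<lambda>y. C * norm (y - x) powr \<beta>) \<longlongrightarrow> C * 0) (at x)"
      using assms(1) by (intro tendsto_intros tendsto_zero_powrI) auto
    moreover have "\<forall>\<^sub>F y in at x. norm (g y - g x) \<le> C * norm (y - x) powr \<beta>"
      unfolding eventually_at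
    proof (intro exI[of _ r] conjI rC(1) ballI impI)
      fix y assume y: "y \<noteq> x \<and> dist y x < r"
      then show "norm (g y - g x) \<le> C * norm (y - x) powr \<beta>"
        using diff_bound_onD[OF *, of r "norm (y - x)" x "[y - x]"] x by (simp add: fdiffs_Cons dist_norm del: foldr.simps(2))
    qed
    ultimately have "((\<lambda>y. g y - g x) \<longlongrightarrow> 0) (at x)" by (auto intro: Lim_null_comparison)
    then show ?thesis by (simp add: isCont_def LIM_zero_iff)
  qed
  then show ?thesis using rC(1) by (auto intro!: continuous_at_imp_continuous_on)
qed

text \<open>The candidate Q h is the limit of the dyadic quotients. It is additive because the
  defect is 2^n times a mixed second difference of size 2^(-n (1 + \<open>\<beta>\<close>)), and
  bounded near 0 because P is continuous, hence linear. The remainder bound for the quotients is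
  then differentiability.\<close>

lemma diff_bound2_imp_differentiable:
  fixes P :: "real^'n::finite \<Rightarrow> real"
  assumes "0 < \<beta>" "open U" "x\<^sub>0 \<in> U" "continuous_on U P" "diff_bound 2 (1 + \<beta>) P x\<^sub>0"
  shows "\<exists>r>0. ball x\<^sub>0 r \<subseteq> U \<and> (\<forall>x\<in>ball x\<^sub>0 r. P differentiable (at x))"
proof -
  obtain r C where rC: "0 < r" "0 \<le> C" and *: "diff_bound_on r C 2 (1 + \<beta>) P x\<^sub>0"
    by (rule diff_boundE[OF assms(5)]) blast
  obtain e where e: "0 < e" "ball x\<^sub>0 e \<subseteq> U" using assms(2,3) open_contains_ball by blast
  define R where "R = min r e"
  have R: "0 < R" "R \<le> r" "R \<le> e" using rC e by (auto simp: R_def)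
  define D where "D = C / (1 - 2 powr (- \<beta>))"
  have D0: "0 \<le> D" using rC assms(1) powr_less_mono[of "- \<beta>" 0 2] by (simp add: D_def)
  have "P differentiable (at x)" if x: "x \<in> ball x\<^sub>0 R" for x
  proof -
    define \<phi> where "\<phi> h n = 2 ^ n * (P (x + (1 / 2 ^ n) *\<^sub>R h) - P x)" for h and n :: nat
    have second: "\<bar>fdiffs [(1 / 2 ^ n) *\<^sub>R h, (1 / 2 ^ n) *\<^sub>R k] P x\<bar> \<le> C * s powr (1 + \<beta>) * (1 / 2 ^ n) powr (1 + \<beta>)"
      if "0 < s" "norm h \<le> s" "norm k \<le> s" "s / 2 ^ n \<le> R" for s h k n
    proof -
      have "norm ((1 / 2 ^ n) *\<^sub>R h) \<le> s / 2 ^ n" "norm ((1 / 2 ^ n) *\<^sub>R k) \<le> s / 2 ^ n"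
        using that by (auto simp: divide_simps)
      then have "\<bar>fdiffs [(1 / 2 ^ n) *\<^sub>R h, (1 / 2 ^ n) *\<^sub>R k] P x\<bar> \<le> C * (s / 2 ^ n) powr (1 + \<beta>)"
        using that R x by (intro diff_bound_onD[OF *, of R]) auto
      then show ?thesis by (simp only: powr_dyadic[OF that(1)] mult.assoc)
    qed
    have quot: "\<bar>fdiffs [(1 / 2 ^ n) *\<^sub>R h, (1 / 2 ^ n) *\<^sub>R h] P x\<bar> \<le> C * norm h powr (1 + \<beta>) * (1 / 2 ^ n) powr (1 + \<beta>)"
      if "h \<noteq> 0" "norm h \<le> R" for h n
    proof (rule second)
      have "norm h / 2 ^ n \<le> norm h / 1" by (intro divide_left_mono) auto
      then show "norm h / 2 ^ n \<le> R" using that by simp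
    qed (use that in auto)
    have conv_small: "convergent (\<phi> h)" if "norm h \<le> R" for h
    proof (cases "h = 0")
      case True
      then show ?thesis by (simp add: \<phi>_def[abs_def] convergent_const)
    next
      case False
      then show ?thesis
        unfolding \<phi>_def[abs_def] using quot[OF False that] rC assms(1)
        by (intro dyadic_difference_quotients(1)[of \<beta> "C * norm h powr (1 + \<beta>)"]) auto
    qed
    \<comment> \<open>Small increments suffice: replacing h by 2^(-m) h only shifts the
      index.\<close>
    have conv: "convergent (\<phi> h)" for h
    proof -
      obtain m where "norm h / R < 2 ^ m" using real_arch_pow[of 2 "norm h / R"] by auto
      then have "norm h < R * 2 ^ m" using R(1) by (simp add: divide_less_eq mult.commute)
      then have "norm ((1 / 2 ^ m) *\<^sub>R h) \<le> R" by (simp add: divide_le_eq)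
      from convergent_mult[OF convergent_const conv_small[OF this], of "2 ^ m"]
      have "convergent (\<lambda>n. 2 ^ m * \<phi> ((1 / 2 ^ m) *\<^sub>R h) n)" .
      moreover have "2 ^ m * \<phi> ((1 / 2 ^ m) *\<^sub>R h) n = \<phi> h (n + m)" for n
        by (simp add: \<phi>_def power_add mult_ac)
      ultimately have "convergent (\<lambda>n. \<phi> h (n + m))" by (simp only:)
      then show ?thesis by (simp only: convergent_ignore_initial_segment)
    qed
    define Q where "Q h = lim (\<phi> h)" for h
    have Q: "\<phi> h \<longlonglongrightarrow> Q h" for h using conv[of h] by (simp add: Q_def convergent_LIMSEQ_iff)
    have near: "\<bar>P (x + h) - P x - Q h\<bar> \<le> D * norm h powr (1 + \<beta>)" if "norm h \<le> R" for h
    proof (cases "h = 0")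
      case True
      have "\<phi> 0 = (\<lambda>n. 0)" by (simp add: \<phi>_def fun_eq_iff)
      then have "Q 0 = 0" using Q[of 0] LIMSEQ_unique[of "\<lambda>n. 0::real" "Q 0" 0] by simp
      then show ?thesis using True by simp
    next
      case False
      have "\<bar>P (x + h) - P x - Q h\<bar> \<le> C * norm h powr (1 + \<beta>) / (1 - 2 powr (- \<beta>))"
        using quot[OF False that] rC assms(1) Q[of h] unfolding \<phi>_def[abs_def]
        by (intro dyadic_difference_quotients(2)) auto
      then show ?thesis by (simp add: D_def)
    qed
    have add: "Q (h + k) = Q h + Q k" for h k
    proof -
      \<comment> \<open>The summand 1 only keeps s positive.\<close>
      define s where "s = max (norm h) (norm k) + 1"
      have s: "0 < s" "norm h \<le> s" "norm k \<le> s" by (auto simp: s_def max_def intro: add_nonneg_pos)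
      have "(\<lambda>n. (1 / 2) ^ n :: real) \<longlonglongrightarrow> 0" by (intro LIMSEQ_power_zero) simp
      then have z: "(\<lambda>n. 1 / 2 ^ n :: real) \<longlonglongrightarrow> 0" by (simp add: power_one_over)
      then have "(\<lambda>n. s * (1 / 2 ^ n)) \<longlonglongrightarrow> s * 0" by (intro tendsto_intros)
      then have "\<forall>\<^sub>F n in sequentially. s * (1 / 2 ^ n) < R" using R(1) by (intro order_tendstoD) auto
      then have ev: "\<forall>\<^sub>F n in sequentially. s / 2 ^ n \<le> R" by eventually_elim simp
      have "(\<lambda>n. C * s powr (1 + \<beta>) * (1 / 2 ^ n) powr \<beta>) \<longlonglongrightarrow> C * s powr (1 + \<beta>) * 0"
        using z assms(1) by (intro tendsto_intros tendsto_zero_powrI) auto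
      moreover have "\<forall>\<^sub>F n in sequentially. norm (\<phi> (h + k) n - \<phi> h n - \<phi> k n) \<le> C * s powr (1 + \<beta>) * (1 / 2 ^ n) powr \<beta>"
        using ev
      proof eventually_elim
        case (elim n)
        have "\<phi> (h + k) n - \<phi> h n - \<phi> k n = 2 ^ n * fdiffs [(1 / 2 ^ n) *\<^sub>R h, (1 / 2 ^ n) *\<^sub>R k] P x"
          by (simp add: \<phi>_def fdiffs_Cons scaleR_right_distrib algebra_simps del: foldr.simps(2))
        then have "norm (\<phi> (h + k) n - \<phi> h n - \<phi> k n) \<le> 2 ^ n * (C * s powr (1 + \<beta>) * (1 / 2 ^ n) powr (1 + \<beta>))"
          using second[OF s elim] by (simp add: abs_mult)
        also have "\<dots> = C * s powr (1 + \<beta>) * (1 / 2 ^ n) powr \<beta>" by (simp add: powr_add)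
        finally show ?case .
      qed
      ultimately have "(\<lambda>n. \<phi> (h + k) n - \<phi> h n - \<phi> k n) \<longlonglongrightarrow> 0" by (auto intro: Lim_null_comparison)
      moreover have "(\<lambda>n. \<phi> (h + k) n - \<phi> h n - \<phi> k n) \<longlonglongrightarrow> Q (h + k) - Q h - Q k"
        by (intro tendsto_diff Q)
      ultimately have "Q (h + k) - Q h - Q k = 0" using LIMSEQ_unique by blast
      then show ?thesis by simp
    qed
    have "x \<in> U" using x R(3) e(2) by auto
    then have "isCont P x" using assms(2,4) continuous_on_eq_continuous_at by blast
    then obtain d where d: "0 < d" "\<And>y. dist y x < d \<Longrightarrow> \<bar>P y - P x\<bar> < 1"
      using continuous_at_eps_delta[of x P] by (auto simp: dist_norm) (metis zero_less_one)
    have "\<bar>Q h\<bar> \<le> 1 + D * R powr (1 + \<beta>)" if "norm h \<le> min (d / 2) R" for h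
    proof -
      have "\<bar>P (x + h) - P x\<bar> < 1" using that d(1) by (intro d(2)) (simp add: dist_norm)
      moreover have "D * norm h powr (1 + \<beta>) \<le> D * R powr (1 + \<beta>)"
        using that D0 assms(1) by (intro mult_left_mono powr_mono2) auto
      ultimately show ?thesis using near[of h] that by linarith
    qed
    then have "linear Q" using d(1) R(1) by (intro additive_bounded_imp_linear[OF add, of "min (d / 2) R"]) auto
    then have bl: "bounded_linear Q" by (simp add: linear_conv_bounded_linear)
    have "(P has_derivative Q) (at x)"
    proof (rule has_derivativeI_sandwich[OF R(1) bl])
      fix y assume y: "y \<noteq> x" "dist y x < R"
      have "norm (P y - P x - Q (y - x)) / norm (y - x) \<le> D * norm (y - x) powr (1 + \<beta>) / norm (y - x)"
        using near[of "y - x"] y by (intro divide_right_mono) (auto simp: dist_norm)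
      also have "\<dots> = D * norm (y - x) powr \<beta>" using y by (simp add: powr_add)
      finally show "norm (P y - P x - Q (y - x)) / norm (y - x) \<le> D * norm (y - x) powr \<beta>" .
    next
      have "((\<lambda>y. norm (y - x)) \<longlongrightarrow> 0) (at x)" by (rule tendsto_eq_intros | simp)+
      then have "((\<lambda>y. D * norm (y - x) powr \<beta>) \<longlongrightarrow> D * 0) (at x)"
        using assms(1) by (intro tendsto_intros tendsto_zero_powrI) auto
      then show "((\<lambda>y. D * norm (y - x) powr \<beta>) \<longlongrightarrow> 0) (at x)" by simp
    qed
    then show ?thesis by (auto simp: differentiable_def)
  qed
  then show ?thesis using R e by (intro exI[of _ R]) auto
qed

lemma diff_bound2_imp_C1:
  fixes P :: "real^'n::finite \<Rightarrow> real"
  assumes "0 < \<beta>" "open U" "x\<^sub>0 \<in> U" "continuous_on U P" "diff_bound 2 (1 + \<beta>) P x\<^sub>0"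
  shows "\<exists>V. open V \<and> x\<^sub>0 \<in> V \<and> Ck_on 1 P V"
proof -
  obtain r where r: "0 < r" "\<And>x. x \<in> ball x\<^sub>0 r \<Longrightarrow> P differentiable (at x)"
    using diff_bound2_imp_differentiable[OF assms] by blast
  have "diff_bound 1 \<beta> (pderiv_dir i P) x\<^sub>0" for i
    by (rule diff_bound_pderiv_dir1[OF assms(1), of "ball x\<^sub>0 r"]) (use r assms(5) in auto)
  then have "\<forall>i. \<exists>q>0. continuous_on (ball x\<^sub>0 q) (pderiv_dir i P)"
    using diff_bound1_imp_continuous_on[OF assms(1)] by blast
  then obtain q where q: "\<And>i. 0 < q i" "\<And>i. continuous_on (ball x\<^sub>0 (q i)) (pderiv_dir i P)" by metis
  define R where "R = min r (Min (range q))"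
  have R: "0 < R" "R \<le> r" "R \<le> q i" for i
    using r(1) q(1) by (auto simp: R_def intro: min.coboundedI2)
  have "continuous_on (ball x\<^sub>0 R) (pderiv_dir i P)" for i
    using q(2)[of i] R(3)[of i] by (rule continuous_on_subset[OF _ subset_ball])
  then have "Ck_on (Suc 0) P (ball x\<^sub>0 R)" using r(2) R(2) by (auto simp: Ck_on.simps)
  then show ?thesis using R(1) by (intro exI[of _ "ball x\<^sub>0 R"]) auto
qed

lemma Ck_on_fdiffs:
  fixes g :: "real^'n::finite \<Rightarrow> real"
  assumes "Ck_on k g (ball x\<^sub>0 R)" "\<And>h. h \<in> set hs \<Longrightarrow> norm h \<le> s" "0 \<le> s"
  shows "Ck_on k (fdiffs hs g) (ball x\<^sub>0 (R - real (length hs) * s))"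
  using assms(2)
proof (induction hs)
  case Nil
  then show ?case using assms(1) by simp
next
  case (Cons h hs)
  let ?B = "ball x\<^sub>0 (R - real (length (h # hs)) * s)"
  have IH: "Ck_on k (fdiffs hs g) (ball x\<^sub>0 (R - real (length hs) * s))" using Cons by simp
  have h: "norm h \<le> s" using Cons.prems by simp
  have "Ck_on k (\<lambda>x. fdiffs hs g (x + h)) ?B"
  proof (rule Ck_on_shift[OF IH])
    fix x assume "x \<in> ?B"
    from mem_ball_shift[OF this h] show "x + h \<in> ball x\<^sub>0 (R - real (length hs) * s)" by (simp add: algebra_simps)
  qed
  moreover have "Ck_on k (fdiffs hs g) ?B"
    using assms(3) by (intro Ck_on_subset[OF IH]) (auto intro!: subset_ball simp: algebra_simps)
  ultimately have "Ck_on k (\<lambda>x. fdiffs hs g (x + h) - fdiffs hs g x) ?B" by (rule Ck_on_diff[OF open_ball])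
  moreover have "fdiffs (h # hs) g = (\<lambda>x. fdiffs hs g (x + h) - fdiffs hs g x)" by (rule ext) (rule fdiffs_Cons)
  ultimately show ?case by (simp only:)
qed

lemma fdiffs_sum: "fdiffs hs (\<lambda>x. \<Sum>i\<in>I. f i x) x = (\<Sum>i\<in>I. fdiffs hs (f i) x)"
proof (induction I rule: infinite_finite_induct)
  case (insert i I)
  then show ?case by (simp add: fdiffs_add)
next
  have zero: "fdiffs hs (\<lambda>x. 0) x = 0" by (induction hs arbitrary: x) (simp_all add: fdiffs_Cons del: foldr.simps(2))
  { case empty show ?case by (simp add: zero) }
  { case (infinite A) then show ?case by (simp add: zero) }
qed

section \<open>Interior regularity\<close>

text \<open>Derivatives of order at most k are of class C^2, so only those of order k + 1 limit the
  exponent.\<close>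

lemma lin_op_diff_bound:
  fixes u :: "real^'n::finite \<Rightarrow> real"
  assumes "lin_op \<Omega> p (Suc k) F" "2 \<le> p" "open \<Omega>" "open U" "U \<subseteq> \<Omega>" "x\<^sub>0 \<in> U" "Ck_on (k + 2) u U"
    and "0 \<le> \<theta>" "\<theta> \<le> 1" "\<And>l. length l = Suc k \<Longrightarrow> diff_bound 2 (1 + \<theta>) (iter_deriv l u) x\<^sub>0"
  shows "diff_bound 2 (1 + \<theta>) (F u) x\<^sub>0"
proof -
  obtain c where c: "\<And>l. Ck_on p (c l) \<Omega>" "F = (\<lambda>u x. \<Sum>l | length l \<le> Suc k. c l x * iter_deriv l u x)"
    using assms(1) unfolding lin_op_def by blast
  have x0: "x\<^sub>0 \<in> \<Omega>" using assms(5,6) by auto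
  have bounds: "diff_bound 0 0 g x\<^sub>0" "diff_bound 1 1 g x\<^sub>0" if "Ck_on 1 g V" "open V" "x\<^sub>0 \<in> V" for g V
    using Ck_on_imp_diff_bound[OF that(2,3,1)] Ck_on_imp_diff_bound[OF that(2,3) Ck_on_le[OF that(1)], of 0] by simp_all
  have bound2: "diff_bound 2 2 g x\<^sub>0" if "Ck_on 2 g V" "open V" "x\<^sub>0 \<in> V" for g V
    using Ck_on_imp_diff_bound[OF that(2,3,1)] by simp
  have "diff_bound 2 (1 + \<theta>) (\<lambda>x. c l x * iter_deriv l u x) x\<^sub>0" if l: "length l \<le> Suc k" for l
  proof (rule diff_bound_mult[OF assms(9)])
    show "diff_bound 0 0 (c l) x\<^sub>0" "diff_bound 1 1 (c l) x\<^sub>0"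
      by (rule bounds[OF Ck_on_le[OF c(1)] assms(3) x0]; use assms(2) in simp)+
    show "diff_bound 2 2 (c l) x\<^sub>0" using assms(2) by (intro bound2[OF Ck_on_le[OF c(1)] assms(3) x0]) auto
    show "diff_bound 0 0 (iter_deriv l u) x\<^sub>0" "diff_bound 1 1 (iter_deriv l u) x\<^sub>0"
      by (rule bounds[OF Ck_on_iter_deriv_le[OF assms(7)] assms(4,6)]; use l in simp)+
    show "diff_bound 2 (1 + \<theta>) (iter_deriv l u) x\<^sub>0"
    proof (cases "length l = Suc k")
      case False
      then have "diff_bound 2 2 (iter_deriv l u) x\<^sub>0"
        using l by (intro bound2[OF Ck_on_iter_deriv_le[OF assms(7)] assms(4,6)]) auto
      then show ?thesis by (rule diff_bound_mono) (use assms(9) in simp)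
    qed (rule assms(10))
  qed
  then show ?thesis unfolding c(2) by (intro diff_bound_sum finite_lists_length_le') auto
qed

text \<open>
  The gradient estimate on a ball of radius \<open>sqrt s\<close>, applied to a third difference with increments
  of size \<open>s\<close>.
\<close>

lemma third_difference_gain:
  fixes a :: "real^'n::finite \<Rightarrow> real^'n^'n"
  assumes "open \<Omega>" "elliptic_operator (Suc M) a \<Omega>" "k + 2 \<le> M" and U: "open U" "U \<subseteq> \<Omega>" "x\<^sub>0 \<in> U"
    and u: "Ck_on (k + 2) u U" "\<forall>x\<in>U. L_op a u x = 0"
    and \<theta>: "0 \<le> \<theta>" "\<theta> \<le> 1" "\<And>l. length l = k + 2 \<Longrightarrow> diff_bound 1 \<theta> (iter_deriv l u) x\<^sub>0"
    and l: "length l = k"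
  shows "diff_bound 3 (3 / 2 + \<theta>) (pderiv_dir i (iter_deriv l u)) x\<^sub>0"
proof -
  define w where "w = iter_deriv l u"
  have aC: "\<And>i j. Ck_on (Suc M) (\<lambda>x. a x $ i $ j) \<Omega>" using assms(2) by (simp add: elliptic_operator_def)
  have x0: "x\<^sub>0 \<in> \<Omega>" using U by auto
  have C2w: "Ck_on 2 w U" unfolding w_def using l by (intro Ck_on_iter_deriv_le[OF u(1)]) simp
  have dw: "w differentiable (at x)" "pderiv_dir i w differentiable (at x)" if "x \<in> U" for x i
    using C2w that by (auto simp: numeral_2_eq_2 Ck_on.simps)
  \<comment> \<open>Antiderivatives: the Hoelder bound in order k + 2 becomes exponent 1 +
    \<open>\<theta>\<close> in order k + 1 and 2 + \<open>\<theta>\<close> in order k, with one more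
    difference each time.\<close>
  have T2: "diff_bound 2 (1 + \<theta>) (iter_deriv l' u) x\<^sub>0" if "length l' = Suc k" for l'
    using diff_bound_antiderivative[OF U(1,3), of "iter_deriv l' u" 1 \<theta>] \<theta>(3)[of "_ # l'"] that
      iter_deriv_differentiable[OF u(1), of l']
    by (simp add: iter_deriv_Cons numeral_2_eq_2 add.commute)
  have Tw: "diff_bound 3 (2 + \<theta>) w x\<^sub>0"
    using diff_bound_antiderivative[OF U(1,3) dw(1), of 2 "1 + \<theta>"] T2[of "_ # l"] l
    by (simp add: w_def iter_deriv_Cons numeral_3_eq_3 numeral_2_eq_2 add_ac)
  obtain F where F: "lin_op \<Omega> (M - k) (Suc k) F" and eq: "\<And>x. x \<in> U \<Longrightarrow> trace_hess a w x = F u x"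
    using trace_hess_iter_deriv[OF assms(1) aC, of l] l assms(3) U u unfolding w_def by auto
  have "diff_bound 2 (1 + \<theta>) (F u) x\<^sub>0"
    using assms(3) by (intro lin_op_diff_bound[OF F _ assms(1) U u(1) \<theta>(1,2) T2]) auto
  then have "diff_bound 2 (1 + \<theta>) (trace_hess a w) x\<^sub>0" by (rule diff_bound_cong[OF _ U(1,3)]) (simp add: eq)
  then have TF: "diff_bound 3 (1 + \<theta>) (trace_hess a w) x\<^sub>0" using diff_bound_Suc[of 2] by (simp add: numeral_3_eq_3 numeral_2_eq_2)
  define K where "K p q r C \<longleftrightarrow> (\<forall>r' s x h k l. r' \<le> r \<longrightarrow> 0 < s \<longrightarrow> s \<le> r' \<longrightarrow> x \<in> ball x\<^sub>0 r' \<longrightarrow> norm h \<le> s \<longrightarrow> norm k \<le> s \<longrightarrow> norm l \<le> s \<longrightarrow>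
     \<bar>fdiffs [h, k, l] (\<lambda>x. a x $ p $ q * pderiv_dir p (pderiv_dir q w) x) x - a x $ p $ q * fdiffs [h, k, l] (pderiv_dir p (pderiv_dir q w)) x\<bar>
      \<le> C * s powr (1 + \<theta>))" for p q r C
  have "\<exists>r>0. \<exists>C\<ge>0. K p q r C" for p q unfolding K_def
  proof (rule diff_bound_commutator[OF \<theta>(1,2)])
    show "diff_bound 1 1 (\<lambda>x. a x $ p $ q) x\<^sub>0"
      using Ck_on_imp_diff_bound[OF assms(1) x0 Ck_on_le[OF aC], of 1] by simp
    show "diff_bound 2 2 (\<lambda>x. a x $ p $ q) x\<^sub>0"
      using Ck_on_imp_diff_bound[OF assms(1) x0 Ck_on_le[OF aC], of 2] assms(3) by simp
    have "Ck_on 0 (iter_deriv (p # q # l) u) U" using l by (intro Ck_on_iter_deriv_le[OF u(1)]) simp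
    from Ck_on_imp_diff_bound[OF U(1,3) this] show "diff_bound 0 0 (pderiv_dir p (pderiv_dir q w)) x\<^sub>0"
      by (simp add: w_def iter_deriv_Cons)
    show "diff_bound 1 \<theta> (pderiv_dir p (pderiv_dir q w)) x\<^sub>0"
      using \<theta>(3)[of "p # q # l"] l by (simp add: w_def iter_deriv_Cons)
  qed
  then have "\<exists>r C. 0 < r \<and> 0 \<le> C \<and> K p q r C" for p q by blast
  then obtain rc Cc where rc: "\<And>p q. 0 < rc p q" "\<And>p q. 0 \<le> Cc p q" and Kpq: "\<And>p q. K p q (rc p q) (Cc p q)"
    by metis
  have comm: "\<bar>fdiffs [h, k, l] (\<lambda>x. a x $ p $ q * pderiv_dir p (pderiv_dir q w) x) x - a x $ p $ q * fdiffs [h, k, l] (pderiv_dir p (pderiv_dir q w)) x\<bar>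
      \<le> Cc p q * s powr (1 + \<theta>)"
    if "r' \<le> rc p q" "0 < s" "s \<le> r'" "x \<in> ball x\<^sub>0 r'" "norm h \<le> s" "norm k \<le> s" "norm l \<le> s" for p q r' s x h k l
    using Kpq[of p q] that unfolding K_def by blast
  obtain r1 C1 where r1: "0 < r1" "0 \<le> C1" and bw: "diff_bound_on r1 C1 3 (2 + \<theta>) w x\<^sub>0"
    by (rule diff_boundE[OF Tw])
  obtain r2 C2 where r2: "0 < r2" "0 \<le> C2" and bF: "diff_bound_on r2 C2 3 (1 + \<theta>) (trace_hess a w) x\<^sub>0"
    by (rule diff_boundE[OF TF])
  obtain e where e: "0 < e" "cball x\<^sub>0 e \<subseteq> U" using U(1,3) open_contains_cball by blast
  obtain \<mu> \<Lambda> \<tau> where cb: "\<And>x \<rho>. 0 < \<rho> \<Longrightarrow> ball x \<rho> \<subseteq> cball x\<^sub>0 e \<Longrightarrow> coeff_bounds \<mu> \<Lambda> \<tau> a (ball x \<rho>)"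
    using compact_imp_coeff_bounds[OF assms(2) _ assms(1) compact_cball order_trans[OF e(2) U(2)]] by auto
  have pos: "0 < \<mu>" "0 \<le> \<Lambda>" "0 \<le> \<tau>" using cb[OF e(1), of x\<^sub>0] by (auto simp: coeff_bounds_def)
  define n where "n = 3 * \<tau> * real CARD('n) ^ 3"
  have n0: "0 \<le> n" using pos by (simp add: n_def)
  define R where "R = min 1 (min (\<mu> / (n + 1)) (min e (min r1 (min r2 (Min (range (\<lambda>(p, q). rc p q)))))))"
  have R: "R \<le> 1" "R \<le> \<mu> / (n + 1)" "R \<le> e" "R \<le> r1" "R \<le> r2" by (auto simp: R_def min_le_iff_disj)
  have Rc: "R \<le> rc p q" for p q
  proof -
    have "Min (range (\<lambda>(p, q). rc p q)) \<le> rc p q" by (rule Min_le) (auto intro: image_eqI[of _ _ "(p, q)"])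
    then show ?thesis by (auto simp: R_def min_le_iff_disj)
  qed
  have R0: "0 < R" using pos n0 e r1 r2 rc by (auto simp: R_def)
  define G where "G = (16 + 256 * real CARD('n) * \<Lambda>) / \<mu>"
  define B where "B = C2 + (\<Sum>p\<in>UNIV. \<Sum>q\<in>UNIV. Cc p q)"
  have B0: "0 \<le> B" using r2 rc by (auto simp: B_def intro!: add_nonneg_nonneg sum_nonneg)
  have G0: "0 \<le> G" using pos by (simp add: G_def)
  \<comment> \<open>Guarantees sqrt s \<le> R / 8, so that the ball of radius sqrt s about x,
    enlarged by three increments, stays inside \<open>ball x\<^sub>0 R\<close>.\<close>
  define t where "t = (R / 8)\<^sup>2"
  have t: "0 < t" "sqrt t = R / 8" "t \<le> R / 8"
  proof -
    show "0 < t" "sqrt t = R / 8" using R0 by (simp_all add: t_def)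
    have "(R / 8) * (R / 8) \<le> (R / 8) * 1" using R0 R(1) by (intro mult_left_mono) auto
    then show "t \<le> R / 8" by (simp add: t_def power2_eq_square)
  qed
  show ?thesis
  proof (rule diff_boundI)
    show "0 < t" by (rule t)
    show "0 \<le> G * (C1 + B)" using G0 r1 B0 by simp
    fix s x and hs :: "(real^'n) list"
    assume s: "0 < s" "s \<le> t" "x \<in> ball x\<^sub>0 t" "length hs = 3" and nh: "\<And>h. h \<in> set hs \<Longrightarrow> norm h \<le> s"
    obtain h1 h2 h3 where hs: "hs = [h1, h2, h3]" using s(4) by (auto simp: length_Suc_conv numeral_3_eq_3)
    define \<rho> where "\<rho> = sqrt s"
    have \<rho>: "0 < \<rho>" "\<rho> \<le> R / 8" using s(1,2) t(2) real_sqrt_le_mono[of s t] by (auto simp: \<rho>_def)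
    have sub: "ball x \<rho> \<subseteq> ball x\<^sub>0 (R / 2)"
    proof
      fix y assume "y \<in> ball x \<rho>"
      then show "y \<in> ball x\<^sub>0 (R / 2)" using s(3) \<rho>(2) t(3) R0 dist_triangle[of x\<^sub>0 y x] by auto
    qed
    have near: "x \<in> ball x \<rho>" using \<rho> by simp
    have sR: "s \<le> R / 8" "s \<le> R" using s(2) t(3) R0 by auto
    have "Ck_on 2 w (ball x\<^sub>0 R)" by (rule Ck_on_subset[OF C2w]) (use R(3) e(2) in auto)
    then have "Ck_on 2 (fdiffs hs w) (ball x\<^sub>0 (R - real (length hs) * s))" using nh s(1) by (intro Ck_on_fdiffs) auto
    then have TC: "Ck_on 2 (fdiffs hs w) (ball x \<rho>)"
      by (rule Ck_on_subset) (rule order_trans[OF sub], use sR s(4) in \<open>auto intro!: subset_ball\<close>)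
    have Ub: "y \<in> U" if "y \<in> ball x\<^sub>0 R" for y using that R(3) e(2) by auto
    have pd1: "pderiv_dir q (fdiffs hs w) y = fdiffs hs (pderiv_dir q w) y" if "y \<in> ball x\<^sub>0 (R / 2)" for y q
      using fdiffs_pderiv_dir[of x\<^sub>0 R w y hs s q] dw(1) Ub that sR s(4) nh by (simp add: dist_norm norm_minus_commute)
    have pd2: "pderiv_dir p (pderiv_dir q (fdiffs hs w)) y = fdiffs hs (pderiv_dir p (pderiv_dir q w)) y"
      if y: "y \<in> ball x\<^sub>0 (R / 2)" for y p q
    proof -
      have "pderiv_dir p (pderiv_dir q (fdiffs hs w)) y = pderiv_dir p (fdiffs hs (pderiv_dir q w)) y"
        by (rule pderiv_dir_cong[OF open_ball y pd1])
      also have "\<dots> = fdiffs hs (pderiv_dir p (pderiv_dir q w)) y"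
        using fdiffs_pderiv_dir[of x\<^sub>0 R "pderiv_dir q w" y hs s p] dw(2) Ub y sR s(4) nh by (simp add: dist_norm norm_minus_commute)
      finally show ?thesis .
    qed
    \<comment> \<open>With \<open>\<rho>\<close> = s^(1/2) both terms are of size s^(3/2 +
      \<open>\<theta>\<close>), half a power better than the exponent 1 + \<open>\<theta>\<close>
      known so far for derivatives of order k + 1.\<close>
    have "\<bar>pderiv_dir i (fdiffs hs w) x\<bar> \<le> G * (C1 * s powr (2 + \<theta>) / \<rho> + \<rho> * (B * s powr (1 + \<theta>)))"
      unfolding G_def
    proof (rule gradient_estimate)
      have "ball x\<^sub>0 (R / 2) \<subseteq> cball x\<^sub>0 e" using R(3) R0 by auto
      then show "coeff_bounds \<mu> \<Lambda> \<tau> a (ball x \<rho>)" using sub by (intro cb \<rho>) auto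
      show "Ck_on 2 (fdiffs hs w) (ball x \<rho>)" by (rule TC)
      show "0 < \<rho>" by (rule \<rho>)
      have "R * (n + 1) \<le> \<mu>" using R(2) n0 by (simp add: le_divide_eq)
      moreover have "n * \<rho> \<le> n * R" using \<rho>(2) R0 n0 by (intro mult_left_mono) auto
      ultimately show "3 * \<tau> * real CARD('n) ^ 3 * \<rho> \<le> \<mu>" using R0 unfolding n_def[symmetric] by (simp add: algebra_simps)
    next
      fix y assume "y \<in> ball x \<rho>"
      then have y: "y \<in> ball x\<^sub>0 (R / 2)" "y \<in> ball x\<^sub>0 R" using sub R0 by auto
      show "\<bar>fdiffs hs w y\<bar> \<le> C1 * s powr (2 + \<theta>)" using s sR R y nh by (intro diff_bound_onD[OF bw, of R]) auto
      let ?W = "\<lambda>p q. pderiv_dir p (pderiv_dir q w)"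
      have sum: "fdiffs hs (trace_hess a w) y = (\<Sum>p\<in>UNIV. \<Sum>q\<in>UNIV. fdiffs hs (\<lambda>x. a x $ p $ q * ?W p q x) y)"
        unfolding trace_hess_def[abs_def] fdiffs_sum ..
      have "trace_hess a (fdiffs hs w) y = (\<Sum>p\<in>UNIV. \<Sum>q\<in>UNIV. a y $ p $ q * fdiffs hs (?W p q) y)"
        by (simp add: trace_hess_def pd2[OF y(1)])
      \<comment> \<open>The third difference of w satisfies the differenced equation up to
        commutators of the difference with the coefficients.\<close>
      also have "\<dots> = fdiffs hs (trace_hess a w) y - (\<Sum>p\<in>UNIV. \<Sum>q\<in>UNIV. fdiffs hs (\<lambda>x. a x $ p $ q * ?W p q x) y - a y $ p $ q * fdiffs hs (?W p q) y)"
        unfolding sum sum_subtractf by simp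
      finally have "\<bar>trace_hess a (fdiffs hs w) y\<bar> \<le> \<bar>fdiffs hs (trace_hess a w) y\<bar>
          + \<bar>\<Sum>p\<in>UNIV. \<Sum>q\<in>UNIV. fdiffs hs (\<lambda>x. a x $ p $ q * ?W p q x) y - a y $ p $ q * fdiffs hs (?W p q) y\<bar>" by linarith
      also have "\<bar>fdiffs hs (trace_hess a w) y\<bar> \<le> C2 * s powr (1 + \<theta>)" using s sR R y nh by (intro diff_bound_onD[OF bF, of R]) auto
      also have "\<bar>\<Sum>p\<in>UNIV. \<Sum>q\<in>UNIV. fdiffs hs (\<lambda>x. a x $ p $ q * ?W p q x) y - a y $ p $ q * fdiffs hs (?W p q) y\<bar>
          \<le> (\<Sum>p\<in>UNIV. \<Sum>q\<in>UNIV. Cc p q * s powr (1 + \<theta>))"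
      proof (intro order_trans[OF sum_abs] sum_mono)
        fix p q :: 'n
        show "\<bar>fdiffs hs (\<lambda>x. a x $ p $ q * ?W p q x) y - a y $ p $ q * fdiffs hs (?W p q) y\<bar> \<le> Cc p q * s powr (1 + \<theta>)"
          unfolding hs using s sR Rc y nh by (intro comm[of R]) (auto simp: hs)
      qed
      finally show "\<bar>trace_hess a (fdiffs hs w) y\<bar> \<le> B * s powr (1 + \<theta>)"
        by (simp add: B_def distrib_right sum_distrib_right)
    qed
    also have "\<dots> = G * (C1 + B) * s powr (3 / 2 + \<theta>)"
    proof -
      have \<rho>s: "\<rho> = s powr (1 / 2)" using s(1) by (simp add: \<rho>_def powr_half_sqrt)
      have "s powr (2 + \<theta>) / \<rho> = s powr (3 / 2 + \<theta>)" "\<rho> * s powr (1 + \<theta>) = s powr (3 / 2 + \<theta>)"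
        unfolding \<rho>s powr_diff[symmetric] powr_add[symmetric] by (simp_all add: algebra_simps)
      then have "C1 * s powr (2 + \<theta>) / \<rho> = C1 * s powr (3 / 2 + \<theta>)"
        "\<rho> * (B * s powr (1 + \<theta>)) = B * s powr (3 / 2 + \<theta>)"
        unfolding times_divide_eq_right[symmetric] mult.left_commute[of \<rho>] by (simp_all only:)
      then show ?thesis by (simp add: distrib_left distrib_right mult.assoc)
    qed
    finally show "\<bar>fdiffs hs (pderiv_dir i (iter_deriv l u)) x\<bar> \<le> G * (C1 + B) * s powr (3 / 2 + \<theta>)"
      using pd1[OF subsetD[OF sub near]] by (simp add: w_def)
  qed
qed

text \<open>Continuity of the derivatives of order k + 2 is the case \<open>\<theta>\<close> = 0. It
  gives exponent 3/2 for third differences one order below, hence by Marchaud's inequality exponent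
  1/2 in order k + 2; a second round raises this to 3/4. The third round gives 9/4 for third
  differences in order k + 1. This is past 2, so second differences in order k + 2 have exponent 5/4
  > 1, and the derivatives of that order are of class C^1.\<close>

lemma regularity_step:
  fixes a :: "real^'n::finite \<Rightarrow> real^'n^'n"
  assumes "open \<Omega>" "elliptic_operator (Suc M) a \<Omega>" "k + 2 \<le> M" and U: "open U" "U \<subseteq> \<Omega>"
    and u: "Ck_on (k + 2) u U" "\<forall>x\<in>U. L_op a u x = 0"
  shows "Ck_on (k + 3) u U"
proof -
  have "Ck_on 1 (iter_deriv p u) U" if p: "length p = k + 2" for p
  proof (rule Ck_on_local)
    fix x\<^sub>0 assume x0: "x\<^sub>0 \<in> U"
    note gain = third_difference_gain[OF assms(1-3) U x0 u]
    have cont: "continuous_on U (iter_deriv l u)" if "length l = k + 2" for l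
      using Ck_on_iter_deriv_le[OF u(1), of 0 l] that by simp
    have diff: "iter_deriv l u differentiable (at x)" if "length l = Suc k" "x \<in> U" for l x
      using iter_deriv_differentiable[OF u(1) _ that(2)] that(1) by simp
    have bdd: "diff_bound 0 0 (iter_deriv l u) x\<^sub>0" if "length l = Suc k" for l
      using Ck_on_imp_diff_bound[OF U(1) x0 Ck_on_iter_deriv_le[OF u(1), of 0 l]] that by simp
    have third: "diff_bound 3 (3 / 2 + \<theta>) (iter_deriv l u) x\<^sub>0"
      if "0 \<le> \<theta>" "\<theta> \<le> 1" "\<And>l. length l = k + 2 \<Longrightarrow> diff_bound 1 \<theta> (iter_deriv l u) x\<^sub>0" "length l = Suc k" for \<theta> l
      using gain[OF that(1-3), of "tl l" "hd l"] that(4) by (cases l) (auto simp: iter_deriv_Cons)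
    have improve: "diff_bound 1 \<beta> (iter_deriv l u) x\<^sub>0"
      if \<theta>: "0 \<le> \<theta>" "\<theta> \<le> 1" "\<And>l. length l = k + 2 \<Longrightarrow> diff_bound 1 \<theta> (iter_deriv l u) x\<^sub>0"
        and \<beta>: "0 < \<beta>" "\<beta> < 1" "\<beta> \<le> 1 / 2 + \<theta>" and l: "length l = k + 2" for \<theta> \<beta> l
    proof -
      obtain i l' where l': "l = i # l'" "length l' = Suc k" using l by (cases l) auto
      have "diff_bound 3 (3 / 2 + \<theta>) (iter_deriv l' u) x\<^sub>0" by (rule third[OF \<theta> l'(2)])
      then have "diff_bound 3 (1 + \<beta>) (iter_deriv l' u) x\<^sub>0"
        by (rule diff_bound_mono) (use \<beta>(3) in linarith)
      then have "diff_bound 2 (1 + \<beta>) (iter_deriv l' u) x\<^sub>0" by (intro diff_bound_marchaud bdd l' \<beta>)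
      from diff_bound_pderiv_dir1[OF \<beta>(1) U(1) x0 diff[OF l'(2)] this]
      show ?thesis by (simp add: l' iter_deriv_Cons)
    qed
    have H0: "diff_bound 1 0 (iter_deriv l u) x\<^sub>0" if "length l = k + 2" for l
      using diff_bound_Suc[OF diff_bound_continuous[OF U(1) x0 cont[OF that]]] by simp
    have H1: "diff_bound 1 (1 / 2) (iter_deriv l u) x\<^sub>0" if "length l = k + 2" for l
      by (rule improve[of 0]) (use H0 that in auto)
    \<comment> \<open>Marchaud's inequality requires \<open>\<beta>\<close> < 1, which excludes the
      exponent 1 that the gain would permit; 3/4 is enough, since 3/2 + 3/4 > 2.\<close>
    have H2: "diff_bound 1 (3 / 4) (iter_deriv l u) x\<^sub>0" if "length l = k + 2" for l
      by (rule improve[of "1 / 2"]) (use H1 that in auto)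
    obtain i p' where p': "p = i # p'" "length p' = Suc k" using p by (cases p) auto
    have "diff_bound 3 (2 + 1 / 4) (iter_deriv p' u) x\<^sub>0" using third[of "3 / 4" p'] H2 p'(2) by simp
    from diff_bound_pderiv_dir2[OF _ U(1) x0 diff[OF p'(2)] this, of i]
    have "diff_bound 2 (1 + 1 / 4) (iter_deriv p u) x\<^sub>0" unfolding p' iter_deriv_Cons by simp
    then show "\<exists>V. open V \<and> x\<^sub>0 \<in> V \<and> Ck_on 1 (iter_deriv p u) V"
      by (intro diff_bound2_imp_C1[of "1 / 4", OF _ U(1) x0 cont[OF p]]) simp_all
  qed
  then have "Ck_on (k + 2 + 1) u U" by (rule Ck_on_addI[OF u(1)])
  then show ?thesis by (simp add: numeral_3_eq_3 numeral_2_eq_2)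
qed

text \<open>Coefficients of class C^(M + 1) allow the step to be repeated until the solution has
  class C^(M + 1) as well.\<close>

theorem interior_regularity:
  fixes a :: "real^'n::finite \<Rightarrow> real^'n^'n"
  assumes "open \<Omega>" "elliptic_operator (Suc M) a \<Omega>" and U: "open U" "U \<subseteq> \<Omega>"
    and u: "Ck_on 2 u U" "\<forall>x\<in>U. L_op a u x = 0" and "k + 2 \<le> Suc M"
  shows "Ck_on (k + 2) u U"
  using assms(7)
proof (induction k)
  case (Suc k)
  then show ?case using regularity_step[OF assms(1,2) _ U _ u(2), of k] by (simp add: numeral_3_eq_3 numeral_2_eq_2)
qed (use u(1) in \<open>simp add: numeral_2_eq_2\<close>)

section \<open>Approximating families along dyadic scales\<close>

text \<open>The sum is the integral of a step function that lies below g on A.\<close>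

lemma sum_le_nn_integral_of_disjoint:
  fixes f :: "nat \<Rightarrow> real" and g :: "real \<Rightarrow> real" and I :: "nat \<Rightarrow> real set"
  assumes "\<And>m n. m < n \<Longrightarrow> I m \<inter> I n = {}" "\<And>n. I n \<in> sets lborel" "\<And>n. I n \<subseteq> A"
    and "\<And>n t. t \<in> I n \<Longrightarrow> f n \<le> g t"
  shows "(\<Sum>n<N. ennreal (f n) * emeasure lborel (I n)) \<le> (\<integral>\<^sup>+t\<in>A. ennreal (g t) \<partial>lborel)"
proof -
  have "(\<Sum>n<N. ennreal (f n) * emeasure lborel (I n)) = (\<integral>\<^sup>+t. (\<Sum>n<N. ennreal (f n) * indicator (I n) t) \<partial>lborel)"
    using assms(2) by (subst nn_integral_sum) (auto simp: nn_integral_cmult_indicator)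
  also have "\<dots> \<le> (\<integral>\<^sup>+t\<in>A. ennreal (g t) \<partial>lborel)"
  proof (rule nn_integral_mono)
    fix t :: real
    show "(\<Sum>n<N. ennreal (f n) * indicator (I n) t) \<le> ennreal (g t) * indicator A t"
    proof (cases "\<exists>m<N. t \<in> I m")
      case True
      then obtain m where m: "m < N" "t \<in> I m" by blast
      have "t \<notin> I n" if "n \<noteq> m" for n
        using assms(1)[of n m] assms(1)[of m n] m(2) that by (cases "n < m") auto
      then have "(\<Sum>n<N. ennreal (f n) * indicator (I n) t) = (\<Sum>n<N. if n = m then ennreal (f m) else 0)"
        using m(2) by (intro sum.cong refl) auto
      also have "\<dots> \<le> ennreal (g t) * indicator A t"
        using m assms(3,4) by (auto simp: subset_iff intro: ennreal_leI)
      finally show ?thesis .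
    next
      case False
      then have "(\<Sum>n<N. ennreal (f n) * indicator (I n) t) = 0" by (intro sum.neutral) auto
      then show ?thesis by simp
    qed
  qed
  finally show ?thesis .
qed

text \<open>On a dyadic interval the integrand is bounded from below by the value of
  \<open>\<omega>\<close> at the left end over the denominator at the right end. Multiplied by the
  length this is half, respectively a quarter, of a summand, whence the constants 2 |c| and 4
  |c|.\<close>

lemma modulus_dyadic_sums:
  assumes "modulus_of_continuity \<omega>" "modulus_integral_condition \<omega>"
  shows "\<exists>c\<ge>0. \<forall>\<tau>>0. \<forall>N. (\<Sum>n<N. \<omega> (\<tau> / 2 ^ Suc n)) \<le> c * \<omega> \<tau> \<and>
    (\<Sum>n<N. \<omega> (\<tau> * 2 ^ n) / (\<tau> * 2 ^ n)) \<le> c * \<omega> \<tau> / \<tau>"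
proof -
  have pos: "0 < \<omega> t" if "0 < t" for t using assms(1) that by (simp add: modulus_of_continuity_def)
  have mono: "\<omega> s \<le> \<omega> t" if "0 < s" "s \<le> t" for s t
    using assms(1) that mono_onD[of "{0<..}" \<omega> s t] by (simp add: modulus_of_continuity_def)
  obtain c where c: "\<And>\<tau>. 0 < \<tau> \<Longrightarrow> (\<integral>\<^sup>+t\<in>{0<..<\<tau>}. ennreal (\<omega> t / t) \<partial>lborel)
        + ennreal \<tau> * (\<integral>\<^sup>+t\<in>{\<tau><..}. ennreal (\<omega> t / t^2) \<partial>lborel) \<le> ennreal (c * \<omega> \<tau>)"
    using assms(2) unfolding modulus_integral_condition_def by blast
  have c': "(\<integral>\<^sup>+t\<in>{0<..<\<tau>}. ennreal (\<omega> t / t) \<partial>lborel) \<le> ennreal (\<bar>c\<bar> * \<omega> \<tau>)"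
    "ennreal \<tau> * (\<integral>\<^sup>+t\<in>{\<tau><..}. ennreal (\<omega> t / t^2) \<partial>lborel) \<le> ennreal (\<bar>c\<bar> * \<omega> \<tau>)" if "0 < \<tau>" for \<tau>
  proof -
    have le: "ennreal (c * \<omega> \<tau>) \<le> ennreal (\<bar>c\<bar> * \<omega> \<tau>)"
      using pos[OF that] by (intro ennreal_leI mult_right_mono) auto
    show "(\<integral>\<^sup>+t\<in>{0<..<\<tau>}. ennreal (\<omega> t / t) \<partial>lborel) \<le> ennreal (\<bar>c\<bar> * \<omega> \<tau>)"
      by (rule order_trans[OF _ order_trans[OF c[OF that] le]]) simp
    show "ennreal \<tau> * (\<integral>\<^sup>+t\<in>{\<tau><..}. ennreal (\<omega> t / t^2) \<partial>lborel) \<le> ennreal (\<bar>c\<bar> * \<omega> \<tau>)"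
      by (rule order_trans[OF _ order_trans[OF c[OF that] le]]) simp
  qed
  have low: "(\<Sum>n<N. \<omega> (\<tau> / 2 ^ Suc n)) \<le> 2 * \<bar>c\<bar> * \<omega> \<tau>" if \<tau>: "0 < \<tau>" for \<tau> N
  proof -
    define I where "I n = {\<tau> / 2 ^ Suc n <..< \<tau> / 2 ^ n}" for n :: nat
    define f where "f n = \<omega> (\<tau> / 2 ^ Suc n) / (\<tau> / 2 ^ n)" for n :: nat
    have half: "\<tau> / 2 ^ n - \<tau> / 2 ^ Suc n = \<tau> / 2 ^ n / 2" for n :: nat by (simp add: field_simps)
    have f: "ennreal (f n) * emeasure lborel (I n) = ennreal (\<omega> (\<tau> / 2 ^ Suc n) / 2)" for n
    proof -
      have "emeasure lborel (I n) = ennreal (\<tau> / 2 ^ n / 2)"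
        unfolding I_def half[symmetric] using \<tau> by (intro emeasure_lborel_Ioo) (simp add: divide_simps)
      moreover have "0 \<le> f n" using pos[of "\<tau> / 2 ^ Suc n"] \<tau> by (simp add: f_def)
      moreover have "f n * (\<tau> / 2 ^ n / 2) = \<omega> (\<tau> / 2 ^ Suc n) / 2" using \<tau> by (simp add: f_def)
      moreover have "0 \<le> \<tau> / 2 ^ n / 2" using \<tau> by simp
      ultimately show ?thesis using ennreal_mult[of "f n" "\<tau> / 2 ^ n / 2"] by (simp only:)
    qed
    have "(\<Sum>n<N. ennreal (f n) * emeasure lborel (I n)) \<le> (\<integral>\<^sup>+t\<in>{0<..<\<tau>}. ennreal (\<omega> t / t) \<partial>lborel)"
    proof (rule sum_le_nn_integral_of_disjoint)
      fix m n :: nat assume "m < n"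
      then have "\<tau> / 2 ^ n \<le> \<tau> / 2 ^ Suc m" using \<tau> by (intro divide_left_mono power_increasing) auto
      then show "I m \<inter> I n = {}" by (auto simp: I_def)
    next
      fix n :: nat
      have "\<tau> / 2 ^ n \<le> \<tau> / 1" using \<tau> by (intro divide_left_mono) auto
      moreover have "0 < \<tau> / 2 ^ Suc n" using \<tau> by simp
      ultimately show "I n \<subseteq> {0<..<\<tau>}" unfolding I_def by fastforce
    next
      fix n t assume t: "t \<in> I n"
      have "0 < \<tau> / 2 ^ Suc n" using \<tau> by simp
      then have t': "0 < \<tau> / 2 ^ Suc n" "\<tau> / 2 ^ Suc n < t" "t < \<tau> / 2 ^ n" "0 < t" using t by (auto simp: I_def simp del: power_Suc)
      show "f n \<le> \<omega> t / t" unfolding f_def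
        using t' mono[OF t'(1), of t] pos[OF t'(4)] by (intro frac_le) auto
    qed (simp add: I_def)
    also have "\<dots> \<le> ennreal (\<bar>c\<bar> * \<omega> \<tau>)" by (rule c'(1)[OF \<tau>])
    finally have "ennreal (\<Sum>n<N. \<omega> (\<tau> / 2 ^ Suc n) / 2) \<le> ennreal (\<bar>c\<bar> * \<omega> \<tau>)"
      unfolding f using pos \<tau> by (subst sum_ennreal[symmetric]) (auto intro: less_imp_le simp del: power_Suc)
    then have "(\<Sum>n<N. \<omega> (\<tau> / 2 ^ Suc n) / 2) \<le> \<bar>c\<bar> * \<omega> \<tau>"
      using pos[OF \<tau>] by (subst (asm) ennreal_le_iff) auto
    then show ?thesis by (simp add: sum_divide_distrib[symmetric] del: power_Suc)
  qed
  have high: "(\<Sum>n<N. \<omega> (\<tau> * 2 ^ n) / (\<tau> * 2 ^ n)) \<le> 4 * \<bar>c\<bar> * \<omega> \<tau> / \<tau>" if \<tau>: "0 < \<tau>" for \<tau> N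
  proof -
    define I where "I n = {\<tau> * 2 ^ n <..< \<tau> * 2 ^ Suc n}" for n :: nat
    define f where "f n = \<omega> (\<tau> * 2 ^ n) / (\<tau> * 2 ^ Suc n)\<^sup>2" for n :: nat
    have f: "ennreal (f n) * emeasure lborel (I n) = ennreal (\<omega> (\<tau> * 2 ^ n) / (\<tau> * 2 ^ n) / 4)" for n
    proof -
      have "emeasure lborel (I n) = ennreal (\<tau> * 2 ^ Suc n - \<tau> * 2 ^ n)"
        unfolding I_def using \<tau> by (intro emeasure_lborel_Ioo) simp
      moreover have "\<tau> * 2 ^ Suc n - \<tau> * 2 ^ n = \<tau> * 2 ^ n" by simp
      moreover have "0 \<le> f n" using pos[of "\<tau> * 2 ^ n"] \<tau> by (simp add: f_def)
      moreover have "f n * (\<tau> * 2 ^ n) = \<omega> (\<tau> * 2 ^ n) / (\<tau> * 2 ^ n) / 4"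
        using \<tau> by (simp add: f_def power2_eq_square)
      ultimately show ?thesis using \<tau> by (simp add: ennreal_mult[symmetric])
    qed
    have "(\<Sum>n<N. ennreal (f n) * emeasure lborel (I n)) \<le> (\<integral>\<^sup>+t\<in>{\<tau><..}. ennreal (\<omega> t / t\<^sup>2) \<partial>lborel)"
    proof (rule sum_le_nn_integral_of_disjoint)
      fix m n :: nat assume "m < n"
      then have "\<tau> * 2 ^ Suc m \<le> \<tau> * 2 ^ n" using \<tau> by (intro mult_left_mono power_increasing) auto
      then show "I m \<inter> I n = {}" by (auto simp: I_def)
    next
      fix n :: nat
      have "\<tau> * 1 \<le> \<tau> * 2 ^ n" using \<tau> by (intro mult_left_mono) auto
      then show "I n \<subseteq> {\<tau><..}" unfolding I_def by fastforce
    next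
      fix n t assume t: "t \<in> I n"
      have "0 < \<tau> * 2 ^ n" using \<tau> by simp
      then have t': "0 < \<tau> * 2 ^ n" "\<tau> * 2 ^ n < t" "t < \<tau> * 2 ^ Suc n" "0 < t" using t by (auto simp: I_def)
      show "f n \<le> \<omega> t / t\<^sup>2" unfolding f_def
        using t' mono[OF t'(1), of t] pos[OF t'(4)] by (intro frac_le power_mono) auto
    qed (simp add: I_def)
    then have "ennreal (\<Sum>n<N. \<omega> (\<tau> * 2 ^ n) / (\<tau> * 2 ^ n) / 4) \<le> (\<integral>\<^sup>+t\<in>{\<tau><..}. ennreal (\<omega> t / t\<^sup>2) \<partial>lborel)"
      unfolding f using pos \<tau> by (subst sum_ennreal[symmetric]) (auto intro: less_imp_le)
    then have "ennreal \<tau> * ennreal (\<Sum>n<N. \<omega> (\<tau> * 2 ^ n) / (\<tau> * 2 ^ n) / 4) \<le> ennreal (\<bar>c\<bar> * \<omega> \<tau>)"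
      by (intro order_trans[OF mult_left_mono c'(2)[OF \<tau>]]) auto
    moreover have "0 \<le> (\<Sum>n<N. \<omega> (\<tau> * 2 ^ n) / (\<tau> * 2 ^ n) / 4)"
      using pos \<tau> by (intro sum_nonneg) (auto intro: less_imp_le)
    ultimately have "\<tau> * (\<Sum>n<N. \<omega> (\<tau> * 2 ^ n) / (\<tau> * 2 ^ n) / 4) \<le> \<bar>c\<bar> * \<omega> \<tau>"
      using pos[OF \<tau>] \<tau> by (simp add: ennreal_mult[symmetric] ennreal_le_iff)
    then have "\<tau> * ((\<Sum>n<N. \<omega> (\<tau> * 2 ^ n) / (\<tau> * 2 ^ n)) / 4) \<le> \<bar>c\<bar> * \<omega> \<tau>"
      unfolding sum_divide_distrib .
    then show ?thesis using \<tau> by (simp only: le_divide_eq if_True) (simp add: ac_simps)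
  qed
  show ?thesis
  proof (intro exI[of _ "4 * \<bar>c\<bar>"] conjI allI impI)
    fix \<tau> :: real and N :: nat assume \<tau>: "0 < \<tau>"
    have "2 * \<bar>c\<bar> * \<omega> \<tau> \<le> 4 * \<bar>c\<bar> * \<omega> \<tau>" using pos[OF \<tau>] by (intro mult_right_mono) auto
    then show "(\<Sum>n<N. \<omega> (\<tau> / 2 ^ Suc n)) \<le> 4 * \<bar>c\<bar> * \<omega> \<tau>" using low[OF \<tau>, of N] by linarith
    show "(\<Sum>n<N. \<omega> (\<tau> * 2 ^ n) / (\<tau> * 2 ^ n)) \<le> 4 * \<bar>c\<bar> * \<omega> \<tau> / \<tau>" by (rule high[OF \<tau>])
  qed simp
qed

text \<open>\<open>mi_deriv\<close> chooses its list from \<alpha> alone, so a single list serves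
  every function and hence all scales.\<close>

lemma mi_deriv_eq_iter_deriv:
  fixes \<alpha> :: "'n::finite \<Rightarrow> nat"
  shows "\<exists>l. length l = mi_order \<alpha> \<and> mi_deriv \<alpha> = iter_deriv l"
proof -
  have ex: "\<exists>js. \<forall>j. count_list js j = \<alpha> j" for \<alpha> :: "'n \<Rightarrow> nat"
  proof (induction "mi_order \<alpha>" arbitrary: \<alpha>)
    case 0
    then show ?case by (intro exI[of _ "[]"]) (auto simp: mi_order_def)
  next
    case (Suc n)
    then obtain j where j: "\<alpha> j \<noteq> 0" by (metis mi_order_def nat.distinct(1) sum.neutral)
    define \<beta> where "\<beta> = \<alpha>(j := \<alpha> j - 1)"
    have "mi_order \<alpha> = \<alpha> j + (\<Sum>i\<in>UNIV - {j}. \<alpha> i)" "mi_order \<beta> = \<beta> j + (\<Sum>i\<in>UNIV - {j}. \<beta> i)"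
      unfolding mi_order_def by (simp_all add: sum.remove[of UNIV j])
    moreover have "(\<Sum>i\<in>UNIV - {j}. \<beta> i) = (\<Sum>i\<in>UNIV - {j}. \<alpha> i)" by (intro sum.cong) (auto simp: \<beta>_def)
    ultimately have "n = mi_order \<beta>" using Suc.hyps(2) j by (simp add: \<beta>_def)
    then obtain js where "\<forall>i. count_list js i = \<beta> i" using Suc.hyps(1) by blast
    then show ?case using j by (intro exI[of _ "j # js"]) (auto simp: \<beta>_def)
  qed
  define js where "js = (SOME js. \<forall>j. count_list js j = \<alpha> j)"
  have js: "\<forall>j. count_list js j = \<alpha> j" unfolding js_def by (rule someI_ex[OF ex])
  have "mi_order \<alpha> = (\<Sum>j\<in>UNIV. count_list js j)" using js by (simp add: mi_order_def)
  also have "\<dots> = length js" by (rule sum_count_set) auto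
  finally show ?thesis by (intro exI[of _ js]) (auto simp: mi_deriv_def iter_deriv_def js_def fun_eq_iff)
qed

section \<open>Neighbourhoods of K and differences of solutions\<close>

lemma mem_nbhdI: "x \<in> K \<Longrightarrow> dist x y < \<delta> \<Longrightarrow> y \<in> nbhd K \<delta>"
  by (auto simp: nbhd_def)

lemma open_nbhd: "open (nbhd K \<delta>)"
  by (auto simp: nbhd_def)

lemma nbhd_mono: "\<delta> \<le> \<delta>' \<Longrightarrow> nbhd K \<delta> \<subseteq> nbhd K \<delta>'"
  by (force simp: nbhd_def)

lemma ball_subset_nbhd:
  assumes "y \<in> nbhd K \<delta>" "\<delta> + \<rho> \<le> \<delta>'"
  shows "ball y \<rho> \<subseteq> nbhd K \<delta>'"
proof
  fix z assume z: "z \<in> ball y \<rho>"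
  obtain x where x: "x \<in> K" "dist x y < \<delta>" using assms(1) by (auto simp: nbhd_def)
  have "dist x z < \<delta>'" using x(2) z assms(2) dist_triangle[of x z y] by simp
  then show "z \<in> nbhd K \<delta>'" by (rule mem_nbhdI[OF x(1)])
qed

lemma nbhd_subset_infdist: "nbhd K \<delta> \<subseteq> {x. infdist x K \<le> \<delta>}"
proof
  fix y assume "y \<in> nbhd K \<delta>"
  then obtain x where "x \<in> K" "dist x y < \<delta>" by (auto simp: nbhd_def)
  then show "y \<in> {x. infdist x K \<le> \<delta>}" using infdist_le[of x K y] by (simp add: dist_commute)
qed

text \<open>The closed neighbourhoods are the compact sets on which constants are taken; each lies
  in every larger open one because the distance to K is attained.\<close>

lemma infdist_subset_nbhd:
  fixes K :: "'a::heine_borel set"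
  assumes "compact K" "K \<noteq> {}" "\<delta> < \<delta>'"
  shows "{x. infdist x K \<le> \<delta>} \<subseteq> nbhd K \<delta>'"
proof
  fix y assume "y \<in> {x. infdist x K \<le> \<delta>}"
  moreover obtain x where "x \<in> K" "infdist y K = dist y x"
    using infdist_attains_inf[OF compact_imp_closed[OF assms(1)] assms(2)] by blast
  ultimately show "y \<in> nbhd K \<delta>'" using assms(3) by (intro mem_nbhdI[of x]) (auto simp: dist_commute)
qed

lemma L_op_diff:
  fixes a :: "real^'n::finite \<Rightarrow> real^'n^'n"
  assumes "open U" "\<And>i j. Ck_on 1 (\<lambda>x. a x $ i $ j) U" "Ck_on 2 u U" "Ck_on 2 w U" "x \<in> U"
  shows "L_op a (\<lambda>y. u y - w y) x = L_op a u x - L_op a w x"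
proof -
  have 1: "pderiv_dir j (\<lambda>y. u y - w y) y = pderiv_dir j u y - pderiv_dir j w y" if "y \<in> U" for j y
    using iter_deriv_diff[OF assms(1,3,4), of "[j]" y] that by (simp add: iter_deriv_Cons)
  have 2: "pderiv_dir i (pderiv_dir j (\<lambda>y. u y - w y)) x = pderiv_dir i (pderiv_dir j u) x - pderiv_dir i (pderiv_dir j w) x" for i j
    using iter_deriv_diff[OF assms(1,3,4), of "[i, j]" x] assms(5) by (simp add: iter_deriv_Cons)
  show ?thesis
    unfolding L_op_expand[OF assms(2,3,5)] L_op_expand[OF assms(2,4,5)]
      L_op_expand[OF assms(2) Ck_on_diff[OF assms(1,3,4)] assms(5)]
    by (simp add: trace_hess_def 1[OF assms(5)] 2 right_diff_distrib sum_subtractf)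
qed

text \<open>Separate domains \<open>U\<^sub>1\<close> and \<open>U\<^sub>2\<close> are allowed
  because approximations at different scales solve the equation on different neighbourhoods. As a
  predicate in C the estimate can be handed on with its constant fixed.\<close>

definition difference_estimate :: "(real^'n::finite \<Rightarrow> real^'n^'n) \<Rightarrow> (real^'n) set \<Rightarrow> (real^'n) set \<Rightarrow> real \<Rightarrow> nat \<Rightarrow> real \<Rightarrow> bool" where
  "difference_estimate a \<Omega> P q m C \<longleftrightarrow> (\<forall>y \<rho> U\<^sub>1 U\<^sub>2 u w B l. 0 < \<rho> \<longrightarrow> \<rho> \<le> q \<longrightarrow> ball y \<rho> \<subseteq> P \<longrightarrow>
    ball y \<rho> \<subseteq> U\<^sub>1 \<longrightarrow> ball y \<rho> \<subseteq> U\<^sub>2 \<longrightarrow> L_solution a \<Omega> U\<^sub>1 u \<longrightarrow> L_solution a \<Omega> U\<^sub>2 w \<longrightarrow>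
    (\<forall>z\<in>ball y \<rho>. \<bar>u z - w z\<bar> \<le> B) \<longrightarrow> length l \<le> m \<longrightarrow>
    \<bar>iter_deriv l u y - iter_deriv l w y\<bar> * \<rho> ^ length l \<le> C * B)"

lemma difference_estimateD:
  assumes "difference_estimate a \<Omega> P q m C" "0 < \<rho>" "\<rho> \<le> q" "ball y \<rho> \<subseteq> P" "ball y \<rho> \<subseteq> U\<^sub>1" "ball y \<rho> \<subseteq> U\<^sub>2"
    and "L_solution a \<Omega> U\<^sub>1 u" "L_solution a \<Omega> U\<^sub>2 w" "\<forall>z\<in>ball y \<rho>. \<bar>u z - w z\<bar> \<le> B" "length l \<le> m"
  shows "\<bar>iter_deriv l u y - iter_deriv l w y\<bar> * \<rho> ^ length l \<le> C * B"
  using assms unfolding difference_estimate_def by blast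

text \<open>By linearity the difference is again a solution, and interior regularity makes it
  differentiable often enough for the interior estimate.\<close>

lemma L_solution_difference_estimate:
  fixes a :: "real^'n::finite \<Rightarrow> real^'n^'n"
  assumes "open \<Omega>" "elliptic_operator (k + 3) a \<Omega>" "compact P" "P \<subseteq> \<Omega>"
  shows "\<exists>C\<ge>0. difference_estimate a \<Omega> P D (k + 1) C"
proof -
  have ell: "elliptic_operator (Suc (k + 2)) a \<Omega>" using assms(2) by (simp add: eval_nat_numeral)
  obtain C where C: "0 \<le> C" and est: "\<And>x \<rho> u B l. 0 < \<rho> \<Longrightarrow> \<rho> \<le> D \<Longrightarrow> ball x \<rho> \<subseteq> P \<Longrightarrow>
     Ck_on (k + 2) u (ball x \<rho>) \<Longrightarrow> (\<forall>y\<in>ball x \<rho>. L_op a u y = 0) \<Longrightarrow> (\<forall>y\<in>ball x \<rho>. \<bar>u y\<bar> \<le> B) \<Longrightarrow>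
     length l \<le> k + 1 \<Longrightarrow> \<bar>iter_deriv l u x\<bar> * \<rho> ^ length l \<le> C * B"
    using interior_estimate[OF assms(1) ell assms(3,4), of "k + 1" D] by auto
  have "\<bar>iter_deriv l u y - iter_deriv l w y\<bar> * \<rho> ^ length l \<le> C * B"
    if \<rho>: "0 < \<rho>" "\<rho> \<le> D" and b: "ball y \<rho> \<subseteq> P" "ball y \<rho> \<subseteq> U\<^sub>1" "ball y \<rho> \<subseteq> U\<^sub>2"
      and u: "L_solution a \<Omega> U\<^sub>1 u" and w: "L_solution a \<Omega> U\<^sub>2 w"
      and B: "\<forall>z\<in>ball y \<rho>. \<bar>u z - w z\<bar> \<le> B" and l: "length l \<le> k + 1" for y \<rho> U\<^sub>1 U\<^sub>2 u w B l
  proof -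
    have b\<Omega>: "ball y \<rho> \<subseteq> \<Omega>" using b(1) assms(4) by auto
    have C2: "Ck_on 2 u (ball y \<rho>)" "Ck_on 2 w (ball y \<rho>)"
      using u w b Ck_on_subset unfolding L_solution_def by blast+
    have L0: "L_op a u z = 0" "L_op a w z = 0" if "z \<in> ball y \<rho>" for z
      using u w b that unfolding L_solution_def by blast+
    have aC: "Ck_on 1 (\<lambda>x. a x $ i $ j) (ball y \<rho>)" for i j
      using assms(2) by (intro Ck_on_subset[OF _ b\<Omega>] Ck_on_le[of "k + 3" _ \<Omega> 1]) (auto simp: elliptic_operator_def)
    have Ck: "Ck_on (k + 2) u (ball y \<rho>)" "Ck_on (k + 2) w (ball y \<rho>)"
      using interior_regularity[OF assms(1) ell open_ball b\<Omega>] C2 L0 by auto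
    have "\<bar>iter_deriv l (\<lambda>z. u z - w z) y\<bar> * \<rho> ^ length l \<le> C * B"
      using L_op_diff[OF open_ball aC C2] L0 B by (intro est \<rho> b l Ck_on_diff[OF open_ball] Ck) auto
    moreover have "iter_deriv l (\<lambda>z. u z - w z) y = iter_deriv l u y - iter_deriv l w y"
      using l \<rho>(1) by (intro iter_deriv_diff[OF open_ball Ck]) auto
    ultimately show ?thesis by simp
  qed
  then show ?thesis using C unfolding difference_estimate_def by blast
qed

lemma approximating_family_dyadic:
  assumes "L_solution a \<Omega> (nbhd K \<delta>) (v \<delta>)" "L_solution a \<Omega> (nbhd K (\<delta>/2)) (v (\<delta>/2))" "0 < \<delta>"
    and "\<forall>y\<in>nbhd K (\<delta>/2). \<bar>v \<delta> y - v (\<delta>/2) y\<bar> \<le> B"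
    and est: "difference_estimate a \<Omega> P q m C"
    and "\<delta>/2 \<le> q" "nbhd K q \<subseteq> P" "y \<in> nbhd K (\<delta>/4)" "length l \<le> m"
  shows "\<bar>iter_deriv l (v \<delta>) y - iter_deriv l (v (\<delta>/2)) y\<bar> \<le> 4 ^ length l * C * B / \<delta> ^ length l"
proof -
  \<comment> \<open>The point y lies in the \<open>\<delta>\<close>/4-neighbourhood and both
    functions are compared on the \<open>\<delta>\<close>/2-neighbourhood, which leaves the radius
    \<open>\<delta>\<close>/4; this is the origin of 4 ^ length l.\<close>
  have sub: "ball y (\<delta>/4) \<subseteq> nbhd K (\<delta>/2)" by (rule ball_subset_nbhd[OF assms(8)]) simp
  have "\<bar>iter_deriv l (v \<delta>) y - iter_deriv l (v (\<delta>/2)) y\<bar> * (\<delta>/4) ^ length l \<le> C * B"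
  proof (rule difference_estimateD[OF est])
    show "ball y (\<delta>/4) \<subseteq> nbhd K \<delta>" using sub nbhd_mono[of "\<delta>/2" \<delta> K] assms(3) by auto
    show "ball y (\<delta>/4) \<subseteq> P" using sub nbhd_mono[OF assms(6), of K] assms(7) by auto
  qed (use sub assms in auto)
  then show ?thesis using assms(3) by (simp add: power_divide field_simps)
qed

section \<open>Summation over the scales\<close>

lemma exists_dyadic_scale:
  fixes \<delta> s :: real
  assumes "0 < \<delta>" "\<delta> \<le> 2 * s" "0 < s"
  shows "\<exists>n. s / 2 ^ n \<le> \<delta> \<and> \<delta> \<le> 2 * (s / 2 ^ n)"
proof -
  obtain N where "s / \<delta> < 2 ^ N" using real_arch_pow[of 2 "s / \<delta>"] by auto
  then have N: "s / 2 ^ N \<le> \<delta>" using assms by (simp add: field_simps)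
  define n where "n = (LEAST n. s / 2 ^ n \<le> \<delta>)"
  have n: "s / 2 ^ n \<le> \<delta>" unfolding n_def by (rule LeastI[of _ N]) (rule N)
  have "\<delta> \<le> 2 * (s / 2 ^ n)"
  proof (cases n)
    case 0
    then show ?thesis using assms(2) by simp
  next
    case (Suc k)
    then have "\<not> s / 2 ^ k \<le> \<delta>" using not_less_Least[of k "\<lambda>n. s / 2 ^ n \<le> \<delta>"] by (simp add: n_def)
    then show ?thesis by (simp add: Suc)
  qed
  then show ?thesis using n by blast
qed

text \<open>The scale \<open>\<delta>\<close> is doubled until the range from
  \<open>\<tau>\<^sub>0\<close> to D is reached. The step at scale \<open>\<sigma>\<close> costs a
  multiple of \<open>\<sigma>\<close>^(r + 1 - m) times the quotient
  \<open>\<omega> \<sigma> / \<sigma>\<close>; since m \<le> r + 1 the first factor is at most a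
  power of D, and the quotients are summed by the modulus condition.\<close>

lemma derivative_bound_along_scales:
  fixes v :: "real \<Rightarrow> real^'n::finite \<Rightarrow> real"
  assumes pos: "\<And>t. 0 < t \<Longrightarrow> 0 < \<omega> t" and mono: "\<And>s t. 0 < s \<Longrightarrow> s \<le> t \<Longrightarrow> \<omega> s \<le> \<omega> t"
    and c: "0 \<le> c" "\<And>\<tau> N. 0 < \<tau> \<Longrightarrow> (\<Sum>n<N. \<omega> (\<tau> * 2 ^ n) / (\<tau> * 2 ^ n)) \<le> c * \<omega> \<tau> / \<tau>"
    and C: "0 \<le> C" and c\<^sub>0: "0 \<le> c\<^sub>0" and "length l = m" "m \<le> Suc r"
    and step: "\<And>\<sigma> y. \<sigma> \<in> S \<Longrightarrow> \<sigma> / 2 \<in> S \<Longrightarrow> \<sigma> / 2 \<le> q \<Longrightarrow> y \<in> nbhd K (\<sigma>/4) \<Longrightarrow>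
       \<bar>iter_deriv l (v \<sigma>) y - iter_deriv l (v (\<sigma>/2)) y\<bar> \<le> 4 ^ m * C * (c\<^sub>0 * \<sigma> ^ r * \<omega> \<sigma>) / \<sigma> ^ m"
    and top: "0 \<le> T" "\<And>\<sigma> y. \<sigma> \<in> S \<Longrightarrow> \<tau>\<^sub>0 \<le> \<sigma> \<Longrightarrow> y \<in> nbhd K (\<sigma>/2) \<Longrightarrow> \<bar>iter_deriv l (v \<sigma>) y\<bar> \<le> T"
    and "0 < \<tau>\<^sub>0" "0 < \<delta>" and chain: "\<And>j. j \<le> J \<Longrightarrow> \<delta> * 2 ^ j \<in> S" "\<And>j. j < J \<Longrightarrow> \<delta> * 2 ^ j \<le> q"
    and J: "\<tau>\<^sub>0 \<le> \<delta> * 2 ^ J" "\<delta> * 2 ^ J \<le> D" and y: "y \<in> nbhd K (\<delta>/2)"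
  shows "\<bar>iter_deriv l (v \<delta>) y\<bar> \<le> (4 ^ m * C * c\<^sub>0 * D ^ (Suc r - m) + T * D / \<omega> \<tau>\<^sub>0) * c * \<omega> \<delta> / \<delta>"
proof -
  define g where "g j = iter_deriv l (v (\<delta> * 2 ^ j)) y" for j :: nat
  define h where "h j = \<omega> (\<delta> * 2 ^ j) / (\<delta> * 2 ^ j)" for j :: nat
  define E where "E = 4 ^ m * C * c\<^sub>0 * D ^ (Suc r - m)"
  have D: "0 < D" using assms(12) J by linarith
  have yn: "y \<in> nbhd K (\<delta> * 2 ^ j / 2)" for j
  proof -
    have "\<delta> * 1 \<le> \<delta> * 2 ^ j" using \<open>0 < \<delta>\<close> by (intro mult_left_mono) auto
    then show ?thesis using y nbhd_mono[of "\<delta>/2" "\<delta> * 2 ^ j / 2" K] by auto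
  qed
  have h0: "0 \<le> h j" for j using pos[of "\<delta> * 2 ^ j"] \<open>0 < \<delta>\<close> by (simp add: h_def less_imp_le)
  have diff: "\<bar>g j - g (Suc j)\<bar> \<le> E * h (Suc j)" if j: "j < J" for j
  proof -
    define \<sigma> where "\<sigma> = \<delta> * 2 ^ Suc j"
    have \<sigma>: "0 < \<sigma>" "\<sigma> / 2 = \<delta> * 2 ^ j" using \<open>0 < \<delta>\<close> by (auto simp: \<sigma>_def)
    have "\<sigma> \<le> \<delta> * 2 ^ J" unfolding \<sigma>_def using j \<open>0 < \<delta>\<close> by (intro mult_left_mono power_increasing) auto
    then have \<sigma>D: "\<sigma> \<le> D" using J(2) by linarith
    have "\<sigma> \<in> S" "\<sigma> / 2 \<in> S" "\<sigma> / 2 \<le> q" unfolding \<sigma>(2) using chain(1)[of "Suc j"] chain j by (auto simp: \<sigma>_def)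
    moreover have "y \<in> nbhd K (\<sigma>/4)" using yn[of j] \<sigma>(2) by simp
    ultimately have "\<bar>iter_deriv l (v \<sigma>) y - iter_deriv l (v (\<sigma>/2)) y\<bar> \<le> 4 ^ m * C * (c\<^sub>0 * \<sigma> ^ r * \<omega> \<sigma>) / \<sigma> ^ m"
      by (rule step)
    also have "\<dots> = 4 ^ m * C * c\<^sub>0 * (\<sigma> ^ Suc r / \<sigma> ^ m) * (\<omega> \<sigma> / \<sigma>)" using \<sigma>(1) by simp
    also have "\<sigma> ^ Suc r / \<sigma> ^ m = \<sigma> ^ (Suc r - m)" using assms(8) \<sigma>(1) by (simp add: power_diff del: power_Suc)
    also have "4 ^ m * C * c\<^sub>0 * \<sigma> ^ (Suc r - m) * (\<omega> \<sigma> / \<sigma>) \<le> E * (\<omega> \<sigma> / \<sigma>)"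
      unfolding E_def using \<sigma> \<sigma>D C c\<^sub>0 pos[OF \<sigma>(1)] by (intro mult_right_mono mult_left_mono power_mono) auto
    finally show ?thesis by (simp add: g_def h_def \<sigma>_def abs_minus_commute)
  qed
  have "g 0 - g J = (\<Sum>j<J. g j - g (Suc j))" by (simp add: sum_lessThan_telescope')
  also have "\<bar>\<dots>\<bar> \<le> (\<Sum>j<J. E * h (Suc j))" using diff by (intro order_trans[OF sum_abs] sum_mono) auto
  finally have "\<bar>g 0 - g J\<bar> \<le> E * (\<Sum>j<J. h (Suc j))" by (simp add: sum_distrib_left)
  moreover have sumh: "(\<Sum>j<Suc J. h j) \<le> c * \<omega> \<delta> / \<delta>" unfolding h_def by (rule c(2)[OF \<open>0 < \<delta>\<close>])
  moreover have E0: "0 \<le> E" using C c\<^sub>0 D by (simp add: E_def)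
  moreover have "(\<Sum>j<J. h (Suc j)) \<le> (\<Sum>j<Suc J. h j)" using h0[of 0] by (simp only: sum.lessThan_Suc_shift)
  ultimately have 1: "\<bar>g 0 - g J\<bar> \<le> E * (c * \<omega> \<delta> / \<delta>)"
    by (meson mult_left_mono order_trans)
  have "\<bar>g J\<bar> \<le> T" unfolding g_def using chain(1)[of J] J(1) yn by (intro top(2)) auto
  \<comment> \<open>The bound T at the top scale is absorbed too: the last quotient
    \<open>h J\<close> is at least \<open>\<omega> \<tau>\<^sub>0 / D\<close> and is itself a
    summand of the series.\<close>
  also have "T \<le> T * D / \<omega> \<tau>\<^sub>0 * h J"
  proof -
    have "\<omega> \<tau>\<^sub>0 / D \<le> h J" unfolding h_def
      using mono[OF assms(12) J(1)] J \<open>0 < \<delta>\<close> pos[OF assms(12)] by (intro frac_le) auto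
    then have "T * D / \<omega> \<tau>\<^sub>0 * (\<omega> \<tau>\<^sub>0 / D) \<le> T * D / \<omega> \<tau>\<^sub>0 * h J"
      using top(1) D pos[OF assms(12)] by (intro mult_left_mono) auto
    then show ?thesis using D pos[OF assms(12)] by simp
  qed
  also have "T * D / \<omega> \<tau>\<^sub>0 * h J \<le> T * D / \<omega> \<tau>\<^sub>0 * (c * \<omega> \<delta> / \<delta>)"
  proof (rule mult_left_mono)
    have "h J \<le> (\<Sum>j<Suc J. h j)" using h0 by (intro member_le_sum) auto
    then show "h J \<le> c * \<omega> \<delta> / \<delta>" using sumh by linarith
    show "0 \<le> T * D / \<omega> \<tau>\<^sub>0" using top(1) D pos[OF assms(12)] by simp
  qed
  finally have "\<bar>g 0\<bar> \<le> E * (c * \<omega> \<delta> / \<delta>) + T * D / \<omega> \<tau>\<^sub>0 * (c * \<omega> \<delta> / \<delta>)" using 1 by linarith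
  then show ?thesis by (simp add: g_def E_def distrib_right add_divide_distrib mult.assoc)
qed

text \<open>Beyond index n the powers only decrease, so they are replaced by the one at n, and
  \<open>\<omega>\<close> alone makes the series converge; for p = 0, which occurs when |\<alpha>| =
  r, nothing else is available. The bound on dyadic sums starts one scale lower, and the missing
  first term accounts for the 1 in 1 + c.\<close>

lemma surrogate_derivative_along_sequence:
  fixes g :: "nat \<Rightarrow> real"
  assumes pos: "\<And>t. 0 < t \<Longrightarrow> 0 < \<omega> t"
    and c: "0 \<le> c" "\<And>\<tau> N. 0 < \<tau> \<Longrightarrow> (\<Sum>n<N. \<omega> (\<tau> / 2 ^ Suc n)) \<le> c * \<omega> \<tau>"
    and "0 < \<tau>" "0 \<le> A"
    and step: "\<And>n. \<bar>g n - g (Suc n)\<bar> \<le> A * (\<tau> / 2 ^ n) ^ p * \<omega> (\<tau> / 2 ^ n)"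
  shows "\<bar>lim g - g n\<bar> \<le> A * (1 + c) * (\<tau> / 2 ^ n) ^ p * \<omega> (\<tau> / 2 ^ n)"
proof -
  have tail: "(\<Sum>i<N. \<bar>g (n + i) - g (Suc (n + i))\<bar>) \<le> A * (1 + c) * (\<tau> / 2 ^ n) ^ p * \<omega> (\<tau> / 2 ^ n)" for n N
  proof -
    define s where "s = \<tau> / 2 ^ n"
    have s: "0 < s" using \<open>0 < \<tau>\<close> by (simp add: s_def)
    have "\<bar>g (n + i) - g (Suc (n + i))\<bar> \<le> A * s ^ p * \<omega> (s / 2 ^ i)" for i
    proof -
      have eq: "\<tau> / 2 ^ (n + i) = s / 2 ^ i" by (simp add: s_def power_add)
      have "s / 2 ^ i \<le> s / 1" using s by (intro divide_left_mono) auto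
      then have "(s / 2 ^ i) ^ p \<le> s ^ p" using s by (intro power_mono) auto
      then have "A * (s / 2 ^ i) ^ p * \<omega> (s / 2 ^ i) \<le> A * s ^ p * \<omega> (s / 2 ^ i)"
        using \<open>0 \<le> A\<close> pos[of "s / 2 ^ i"] s by (intro mult_right_mono mult_left_mono) auto
      then show ?thesis using step[of "n + i"] unfolding eq by linarith
    qed
    then have "(\<Sum>i<N. \<bar>g (n + i) - g (Suc (n + i))\<bar>) \<le> (\<Sum>i<N. A * s ^ p * \<omega> (s / 2 ^ i))"
      by (intro sum_mono) auto
    also have "\<dots> \<le> (\<Sum>i<Suc N. A * s ^ p * \<omega> (s / 2 ^ i))"
      using \<open>0 \<le> A\<close> s pos[of "s / 2 ^ N"] by simp
    also have "\<dots> = A * s ^ p * (\<omega> s + (\<Sum>i<N. \<omega> (s / 2 ^ Suc i)))"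
      unfolding sum.lessThan_Suc_shift sum_distrib_left[symmetric] by (simp add: distrib_left del: power_Suc)
    also have "\<dots> \<le> A * s ^ p * (\<omega> s + c * \<omega> s)"
      using \<open>0 \<le> A\<close> s by (intro mult_left_mono add_left_mono c(2)) auto
    also have "\<dots> = A * (1 + c) * s ^ p * \<omega> s" by (simp add: algebra_simps)
    finally show ?thesis by (simp add: s_def)
  qed
  have "summable (\<lambda>i. \<bar>g i - g (Suc i)\<bar>)"
    using tail[of 0] by (intro summableI_nonneg_bounded[where x = "A * (1 + c) * \<tau> ^ p * \<omega> \<tau>"]) auto
  then have "summable (\<lambda>i. g i - g (Suc i))" by (rule summable_rabs_cancel)
  then have "convergent (\<lambda>n. \<Sum>i<n. g i - g (Suc i))" by (simp add: summable_iff_convergent)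
  then have "convergent (\<lambda>n. g 0 - g n)" by (simp add: sum_lessThan_telescope')
  from convergent_diff[OF convergent_const this, of "g 0"]
  have "convergent (\<lambda>n. g 0 - (g 0 - g n))" .
  moreover have "(\<lambda>n. g 0 - (g 0 - g n)) = g" by auto
  ultimately have "convergent g" by (simp only:)
  then have lim: "g \<longlonglongrightarrow> lim g" by (simp add: convergent_LIMSEQ_iff)
  have "\<bar>g (N + n) - g n\<bar> \<le> A * (1 + c) * (\<tau> / 2 ^ n) ^ p * \<omega> (\<tau> / 2 ^ n)" for N
  proof -
    have "g n - g (n + N) = (\<Sum>i<N. g (n + i) - g (Suc (n + i)))"
      using sum_lessThan_telescope'[of "\<lambda>i. g (n + i)" N] by simp
    then have "\<bar>g n - g (n + N)\<bar> \<le> (\<Sum>i<N. \<bar>g (n + i) - g (Suc (n + i))\<bar>)" by simp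
    then show ?thesis using tail[where n = n and N = N] by (simp add: abs_minus_commute add.commute)
  qed
  moreover have "(\<lambda>N. \<bar>g (N + n) - g n\<bar>) \<longlonglongrightarrow> \<bar>lim g - g n\<bar>"
    by (intro tendsto_intros LIMSEQ_ignore_initial_segment lim)
  ultimately show ?thesis by (intro LIMSEQ_le_const2) auto
qed

text \<open>Common to both kinds of scale sets. The reference sequence \<open>\<tau> / 2 ^ n\<close>
  defines the surrogate derivatives, and \<open>comp\<close> ties each scale to a member of it
  within a factor 2. Doubling along \<open>chain\<close> ends in a range bounded from below, where
  \<open>top\<close> supplies the bound. The closed q-neighbourhood is compact and inside
  \<open>\<Omega>\<close>, which limits where the interior estimate may be applied.\<close>

lemma theorem_along_scales:
  fixes K \<Omega> :: "(real^'n::finite) set" and v :: "real \<Rightarrow> real^'n \<Rightarrow> real"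
  assumes K: "compact K" and \<omega>: "modulus_of_continuity \<omega>" "modulus_integral_condition \<omega>" and kr: "k \<le> r"
    and \<Omega>: "open \<Omega>" and ell: "elliptic_operator (k + 3) a \<Omega>"
    and v: "approximating_family a \<Omega> r \<omega> K f S v"
    and S: "\<And>\<delta>. \<delta> \<in> S \<Longrightarrow> 0 < \<delta>" "\<And>\<delta>. \<delta> \<in> S \<Longrightarrow> \<delta>/2 \<in> S"
    and P: "compact {x. infdist x K \<le> q}" "{x. infdist x K \<le> q} \<subseteq> \<Omega>"
    and \<tau>0: "0 < \<tau>\<^sub>0" and chain: "\<And>\<delta>. \<delta> \<in> S \<Longrightarrow> \<exists>J. (\<forall>j\<le>J. \<delta> * 2 ^ j \<in> S) \<and> (\<forall>j<J. \<delta> * 2 ^ j \<le> q) \<and>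
          \<tau>\<^sub>0 \<le> \<delta> * 2 ^ J \<and> \<delta> * 2 ^ J \<le> D"
    and top: "\<And>l. length l = k + 1 \<Longrightarrow> \<exists>T\<ge>0. \<forall>\<sigma>\<in>S. \<tau>\<^sub>0 \<le> \<sigma> \<longrightarrow> (\<forall>y\<in>nbhd K (\<sigma>/2). \<bar>iter_deriv l (v \<sigma>) y\<bar> \<le> T)"
    and \<tau>: "0 < \<tau>" "\<tau> \<le> q" "\<And>n. \<tau> / 2 ^ n \<in> S"
    and comp: "0 \<le> c\<^sub>1" "\<And>\<delta>. \<delta> \<in> S \<Longrightarrow> \<exists>n. \<tau> / 2 ^ n \<le> \<delta> \<and> \<delta> \<le> 2 * (\<tau> / 2 ^ n) \<and>
          (\<forall>y\<in>nbhd K (\<tau> / 2 ^ n). \<bar>v \<delta> y - v (\<tau> / 2 ^ n) y\<bar> \<le> c\<^sub>1 * \<delta>^r * \<omega> \<delta>)"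
  shows "(\<exists>c. \<forall>\<delta>\<in>S. Ck_on (k + 1) (v \<delta>) (nbhd K \<delta>) \<and>
             nabla_sup_norm (k + 1) (nbhd K (\<delta>/2)) (v \<delta>) \<le> ereal (c * \<omega> \<delta> / \<delta>)) \<and>
         (\<exists>C. \<exists>f\<^sub>\<alpha> :: ('n \<Rightarrow> nat) \<Rightarrow> real^'n \<Rightarrow> real.
             \<forall>\<delta>\<in>S. \<forall>x\<in>K. \<forall>\<alpha>. 1 \<le> mi_order \<alpha> \<and> mi_order \<alpha> \<le> k \<longrightarrow>
               \<bar>f\<^sub>\<alpha> \<alpha> x - mi_deriv \<alpha> (v \<delta>) x\<bar> \<le> C * \<delta>^(r - mi_order \<alpha>) * \<omega> \<delta>)"
proof -
  have pos: "0 < \<omega> t" if "0 < t" for t using \<omega>(1) that by (simp add: modulus_of_continuity_def)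
  have mono: "\<omega> s \<le> \<omega> t" if "0 < s" "s \<le> t" for s t
    using \<omega>(1) that mono_onD[of "{0<..}" \<omega> s t] by (simp add: modulus_of_continuity_def)
  obtain c where c: "0 \<le> c" "\<And>\<tau> N. 0 < \<tau> \<Longrightarrow> (\<Sum>n<N. \<omega> (\<tau> / 2 ^ Suc n)) \<le> c * \<omega> \<tau>"
    "\<And>\<tau> N. 0 < \<tau> \<Longrightarrow> (\<Sum>n<N. \<omega> (\<tau> * 2 ^ n) / (\<tau> * 2 ^ n)) \<le> c * \<omega> \<tau> / \<tau>"
    using modulus_dyadic_sums[OF \<omega>] by blast
  obtain c0 where sol: "\<And>\<delta>. \<delta> \<in> S \<Longrightarrow> L_solution a \<Omega> (nbhd K \<delta>) (v \<delta>)"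
    and c0: "\<And>\<delta> y. \<delta> \<in> S \<Longrightarrow> y \<in> nbhd K (\<delta>/2) \<Longrightarrow> \<bar>v \<delta> y - v (\<delta>/2) y\<bar> \<le> c0 * \<delta>^r * \<omega> \<delta>"
    using v unfolding approximating_family_def by blast
  define c\<^sub>0 where "c\<^sub>0 = \<bar>c0\<bar>"
  have c\<^sub>0: "0 \<le> c\<^sub>0" by (simp add: c\<^sub>0_def)
  have half: "\<bar>v \<delta> y - v (\<delta>/2) y\<bar> \<le> c\<^sub>0 * \<delta>^r * \<omega> \<delta>" if "\<delta> \<in> S" "y \<in> nbhd K (\<delta>/2)" for \<delta> y
  proof -
    have "c0 * \<delta>^r * \<omega> \<delta> \<le> c\<^sub>0 * \<delta>^r * \<omega> \<delta>"
      using S(1)[OF that(1)] pos[OF S(1)[OF that(1)]] unfolding c\<^sub>0_def by (intro mult_right_mono) auto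
    then show ?thesis using c0[OF that] by linarith
  qed
  let ?P = "{x. infdist x K \<le> q}"
  obtain C where C: "0 \<le> C" and est: "difference_estimate a \<Omega> ?P q (k + 1) C"
    using L_solution_difference_estimate[OF \<Omega> ell P, of q] by blast
  have step: "\<bar>iter_deriv l (v \<sigma>) y - iter_deriv l (v (\<sigma>/2)) y\<bar> \<le> 4 ^ length l * C * (c\<^sub>0 * \<sigma> ^ r * \<omega> \<sigma>) / \<sigma> ^ length l"
    if "\<sigma> \<in> S" "\<sigma>/2 \<le> q" "y \<in> nbhd K (\<sigma>/4)" "length l \<le> k + 1" for \<sigma> y l
    by (rule approximating_family_dyadic[OF sol[OF that(1)] sol[OF S(2)[OF that(1)]] S(1)[OF that(1)] _ est that(2) nbhd_subset_infdist that(3,4)])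
      (use half[OF that(1)] in auto)
  have ell': "elliptic_operator (Suc (k + 2)) a \<Omega>" using ell by (simp add: eval_nat_numeral)
  have reg: "Ck_on (k + 2) (v \<delta>) (nbhd K \<delta>)" if "\<delta> \<in> S" for \<delta>
    using sol[OF that] unfolding L_solution_def by (intro interior_regularity[OF \<Omega> ell' open_nbhd]) auto
  show ?thesis
  proof
    have "\<exists>b\<ge>0. \<forall>\<delta>\<in>S. \<forall>y\<in>nbhd K (\<delta>/2). \<bar>iter_deriv l (v \<delta>) y\<bar> \<le> b * \<omega> \<delta> / \<delta>" if l: "length l = k + 1" for l
    proof -
      obtain T where T: "0 \<le> T" "\<And>\<sigma> y. \<sigma> \<in> S \<Longrightarrow> \<tau>\<^sub>0 \<le> \<sigma> \<Longrightarrow> y \<in> nbhd K (\<sigma>/2) \<Longrightarrow> \<bar>iter_deriv l (v \<sigma>) y\<bar> \<le> T"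
        using top[OF l] by blast
      define b where "b = (4 ^ (k + 1) * C * c\<^sub>0 * D ^ (Suc r - (k + 1)) + T * D / \<omega> \<tau>\<^sub>0) * c"
      have bound: "\<bar>iter_deriv l (v \<delta>) y\<bar> \<le> b * \<omega> \<delta> / \<delta>" if \<delta>: "\<delta> \<in> S" and y: "y \<in> nbhd K (\<delta>/2)" for \<delta> y
      proof -
        obtain J where J: "\<And>j. j \<le> J \<Longrightarrow> \<delta> * 2 ^ j \<in> S" "\<And>j. j < J \<Longrightarrow> \<delta> * 2 ^ j \<le> q" "\<tau>\<^sub>0 \<le> \<delta> * 2 ^ J" "\<delta> * 2 ^ J \<le> D"
          using chain[OF \<delta>] by blast
        have st: "\<bar>iter_deriv l (v \<sigma>) y - iter_deriv l (v (\<sigma>/2)) y\<bar> \<le> 4 ^ (k + 1) * C * (c\<^sub>0 * \<sigma> ^ r * \<omega> \<sigma>) / \<sigma> ^ (k + 1)"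
          if "\<sigma> \<in> S" "\<sigma>/2 \<in> S" "\<sigma>/2 \<le> q" "y \<in> nbhd K (\<sigma>/4)" for \<sigma> y
          using step[OF that(1,3,4), of l] by (simp only: l)
        show ?thesis
          unfolding b_def
          by (rule derivative_bound_along_scales[where S = S and q = q and K = K and J = J, OF pos mono c(1) c(3) C c\<^sub>0 l _ st T \<tau>0 S(1)[OF \<delta>] J y])
            (use kr in auto)
      qed
      have "0 \<le> b" if "\<delta> \<in> S" for \<delta>
      proof -
        have "0 < D" using chain[OF that] \<tau>0 by force
        then show ?thesis using C c\<^sub>0 T(1) c(1) pos[OF \<tau>0] by (simp add: b_def)
      qed
      \<comment> \<open>The sign of b rests on 0 < D, which \<open>chain\<close> yields only if
        there is a scale; for empty S any constant will do.\<close>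
      then show ?thesis using bound by (cases "S = {}") (auto intro: exI[of _ b] exI[of _ 0])
    qed
    then obtain b where b: "\<And>l. length l = k + 1 \<Longrightarrow> 0 \<le> b l"
      "\<And>l \<delta> y. length l = k + 1 \<Longrightarrow> \<delta> \<in> S \<Longrightarrow> y \<in> nbhd K (\<delta>/2) \<Longrightarrow> \<bar>iter_deriv l (v \<delta>) y\<bar> \<le> b l * \<omega> \<delta> / \<delta>"
      by metis
    define B where "B = (\<Sum>l :: 'n list | length l = k + 1. b l)"
    have fin: "finite {l :: 'n list. length l = k + 1}"
      by (rule finite_subset[OF _ finite_lists_length_le'[of "k + 1"]]) auto
    have "nabla_sup_norm (k + 1) (nbhd K (\<delta>/2)) (v \<delta>) \<le> ereal (B * \<omega> \<delta> / \<delta>)" if \<delta>: "\<delta> \<in> S" for \<delta>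
      unfolding nabla_sup_norm_def
    proof (intro SUP_least)
      fix y \<alpha> assume y: "y \<in> nbhd K (\<delta>/2)" and "\<alpha> \<in> {\<alpha> :: 'n \<Rightarrow> nat. mi_order \<alpha> = k + 1}"
      then obtain l where l: "length l = k + 1" "mi_deriv \<alpha> = iter_deriv l" using mi_deriv_eq_iter_deriv[of \<alpha>] by auto
      have "b l \<le> B" unfolding B_def using b(1) l(1) fin by (intro member_le_sum) auto
      then have "b l * \<omega> \<delta> / \<delta> \<le> B * \<omega> \<delta> / \<delta>"
        using S(1)[OF \<delta>] pos[OF S(1)[OF \<delta>]] by (intro divide_right_mono mult_right_mono) auto
      then show "ereal \<bar>mi_deriv \<alpha> (v \<delta>) y\<bar> \<le> ereal (B * \<omega> \<delta> / \<delta>)"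
        using b(2)[OF l(1) \<delta> y] by (simp add: l(2))
    qed
    then show "\<exists>c. \<forall>\<delta>\<in>S. Ck_on (k + 1) (v \<delta>) (nbhd K \<delta>) \<and>
             nabla_sup_norm (k + 1) (nbhd K (\<delta>/2)) (v \<delta>) \<le> ereal (c * \<omega> \<delta> / \<delta>)"
      using Ck_on_le[OF reg, of _ "k + 1"] by auto
  next
    \<comment> \<open>Only the reference sequence enters, so the limit does not depend on
      \<open>\<delta>\<close>.\<close>
    define F where "F l x = lim (\<lambda>n. iter_deriv l (v (\<tau> / 2 ^ n)) x)" for l x
    \<comment> \<open>The two summands are the tail of the series along the reference sequence and
      the comparison of \<open>v \<delta>\<close> with its reference member.\<close>
    define Q where "Q = 4 ^ k * C * c\<^sub>0 * (1 + c) + 2 ^ k * C * c\<^sub>1"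
    have main: "\<bar>F l x - iter_deriv l (v \<delta>) x\<bar> \<le> Q * \<delta> ^ (r - length l) * \<omega> \<delta>"
      if \<delta>: "\<delta> \<in> S" and x: "x \<in> K" and l: "length l \<le> k" for \<delta> x l
    proof -
      define p where "p = length l"
      have p: "p \<le> k" "p \<le> r" using l kr by (auto simp: p_def)
      have \<tau>n: "0 < \<tau> / 2 ^ n" "\<tau> / 2 ^ n \<le> q" for n
      proof -
        have "\<tau> / 2 ^ n \<le> \<tau> / 1" using \<tau>(1) by (intro divide_left_mono) auto
        then show "0 < \<tau> / 2 ^ n" "\<tau> / 2 ^ n \<le> q" using \<tau>(1,2) by auto
      qed
      have \<delta>0: "0 < \<delta>" "0 < \<omega> \<delta>" using S(1)[OF \<delta>] pos by auto
      have xn: "x \<in> nbhd K s" if "0 < s" for s using x that by (intro mem_nbhdI[of x]) auto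
      obtain n where n: "\<tau> / 2 ^ n \<le> \<delta>" "\<delta> \<le> 2 * (\<tau> / 2 ^ n)"
        "\<And>y. y \<in> nbhd K (\<tau> / 2 ^ n) \<Longrightarrow> \<bar>v \<delta> y - v (\<tau> / 2 ^ n) y\<bar> \<le> c\<^sub>1 * \<delta>^r * \<omega> \<delta>"
        using comp(2)[OF \<delta>] by blast
      let ?A = "4 ^ k * C * c\<^sub>0"
      have A: "0 \<le> ?A" using C c\<^sub>0 by simp
      have "\<bar>F l x - iter_deriv l (v (\<tau> / 2 ^ n)) x\<bar> \<le> ?A * (1 + c) * (\<tau> / 2 ^ n) ^ (r - p) * \<omega> (\<tau> / 2 ^ n)"
        unfolding F_def
      proof (rule surrogate_derivative_along_sequence[OF pos c(1,2) \<tau>(1) A])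
        fix n
        define \<sigma> where "\<sigma> = \<tau> / 2 ^ n"
        have \<sigma>: "0 < \<sigma>" "\<sigma> / 2 \<le> q" "\<sigma> \<in> S" "\<tau> / 2 ^ Suc n = \<sigma> / 2" using \<tau>n[of n] \<tau>(3) by (auto simp: \<sigma>_def)
        have "\<bar>iter_deriv l (v \<sigma>) x - iter_deriv l (v (\<sigma>/2)) x\<bar> \<le> 4 ^ p * C * (c\<^sub>0 * \<sigma> ^ r * \<omega> \<sigma>) / \<sigma> ^ p"
          unfolding p_def using \<sigma> xn l by (intro step) auto
        also have "\<dots> = 4 ^ p * (C * c\<^sub>0) * \<sigma> ^ (r - p) * \<omega> \<sigma>" using p(2) \<sigma>(1) by (simp add: power_diff)
        also have "\<dots> \<le> 4 ^ k * (C * c\<^sub>0) * \<sigma> ^ (r - p) * \<omega> \<sigma>"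
          using p(1) \<sigma>(1) pos[OF \<sigma>(1)] C c\<^sub>0 by (intro mult_right_mono power_increasing) auto
        finally show "\<bar>iter_deriv l (v (\<tau> / 2 ^ n)) x - iter_deriv l (v (\<tau> / 2 ^ Suc n)) x\<bar> \<le> ?A * (\<tau> / 2 ^ n) ^ (r - p) * \<omega> (\<tau> / 2 ^ n)"
          unfolding \<sigma>(4) unfolding \<sigma>_def[symmetric] by (simp add: mult.assoc)
      qed
      also have "\<dots> \<le> ?A * (1 + c) * \<delta> ^ (r - p) * \<omega> \<delta>"
        using n(1) \<tau>n[of n] mono[OF \<tau>n(1) n(1)] A c(1) \<delta>0 pos[OF \<tau>n(1)[of n]]
        by (intro mult_mono mult_left_mono power_mono) auto
      finally have 1: "\<bar>F l x - iter_deriv l (v (\<tau> / 2 ^ n)) x\<bar> \<le> ?A * (1 + c) * \<delta> ^ (r - p) * \<omega> \<delta>" .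
      have ballK: "ball x (\<tau> / 2 ^ n) \<subseteq> nbhd K (\<tau> / 2 ^ n)" using x by (auto simp: nbhd_def)
      \<comment> \<open>At points of K the full ball of radius \<open>\<tau> / 2 ^ n\<close> is
        available. This radius is at least \<open>\<delta>\<close> / 2, so replacing it by
        \<open>\<delta>\<close> costs 2^p.\<close>
      have "\<bar>iter_deriv l (v \<delta>) x - iter_deriv l (v (\<tau> / 2 ^ n)) x\<bar> * (\<tau> / 2 ^ n) ^ p \<le> C * (c\<^sub>1 * \<delta>^r * \<omega> \<delta>)"
        unfolding p_def
      proof (rule difference_estimateD[OF est \<tau>n _ _ ballK sol[OF \<delta>] sol[OF \<tau>(3)]])
        show "ball x (\<tau> / 2 ^ n) \<subseteq> ?P" using ballK nbhd_mono[OF \<tau>n(2)[of n], of K] nbhd_subset_infdist[of K q] by blast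
        show "ball x (\<tau> / 2 ^ n) \<subseteq> nbhd K \<delta>" using ballK nbhd_mono[OF n(1), of K] by blast
      qed (use n(3) ballK l in auto)
      moreover have "\<bar>iter_deriv l (v \<delta>) x - iter_deriv l (v (\<tau> / 2 ^ n)) x\<bar> * (\<delta> / 2) ^ p
          \<le> \<bar>iter_deriv l (v \<delta>) x - iter_deriv l (v (\<tau> / 2 ^ n)) x\<bar> * (\<tau> / 2 ^ n) ^ p"
      proof (intro mult_left_mono power_mono)
        show "\<delta> / 2 \<le> \<tau> / 2 ^ n" using n(2) by linarith
      qed (use \<delta>0 in auto)
      ultimately have "\<bar>iter_deriv l (v \<delta>) x - iter_deriv l (v (\<tau> / 2 ^ n)) x\<bar> * (\<delta> / 2) ^ p \<le> C * (c\<^sub>1 * \<delta>^r * \<omega> \<delta>)" by linarith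
      then have "\<bar>iter_deriv l (v \<delta>) x - iter_deriv l (v (\<tau> / 2 ^ n)) x\<bar> \<le> 2 ^ p * (C * c\<^sub>1) * (\<delta> ^ r / \<delta> ^ p) * \<omega> \<delta>"
        using \<delta>0 by (simp add: power_divide field_simps)
      also have "\<delta> ^ r / \<delta> ^ p = \<delta> ^ (r - p)" using p(2) \<delta>0 by (simp add: power_diff)
      also have "2 ^ p * (C * c\<^sub>1) * \<delta> ^ (r - p) * \<omega> \<delta> \<le> 2 ^ k * (C * c\<^sub>1) * \<delta> ^ (r - p) * \<omega> \<delta>"
        using p(1) \<delta>0 C comp(1) by (intro mult_right_mono power_increasing) auto
      finally have "\<bar>F l x - iter_deriv l (v \<delta>) x\<bar> \<le> ?A * (1 + c) * \<delta> ^ (r - p) * \<omega> \<delta> + 2 ^ k * (C * c\<^sub>1) * \<delta> ^ (r - p) * \<omega> \<delta>"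
        using 1 by linarith
      also have "\<dots> = Q * \<delta> ^ (r - p) * \<omega> \<delta>" by (simp add: Q_def algebra_simps)
      finally show ?thesis by (simp add: p_def)
    qed
    define lst where "lst \<alpha> = (SOME l. length l = mi_order \<alpha> \<and> mi_deriv \<alpha> = iter_deriv l)" for \<alpha> :: "'n \<Rightarrow> nat"
    have lst: "length (lst \<alpha>) = mi_order \<alpha>" "mi_deriv \<alpha> = iter_deriv (lst \<alpha>)" for \<alpha>
      using someI_ex[OF mi_deriv_eq_iter_deriv[of \<alpha>]] unfolding lst_def by auto
    have "\<bar>F (lst \<alpha>) x - mi_deriv \<alpha> (v \<delta>) x\<bar> \<le> Q * \<delta> ^ (r - mi_order \<alpha>) * \<omega> \<delta>"
      if "\<delta> \<in> S" "x \<in> K" "mi_order \<alpha> \<le> k" for \<delta> x \<alpha>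
      using main[OF that(1,2), of "lst \<alpha>"] that(3) by (simp add: lst)
    then show "\<exists>C. \<exists>f\<^sub>\<alpha> :: ('n \<Rightarrow> nat) \<Rightarrow> real^'n \<Rightarrow> real.
             \<forall>\<delta>\<in>S. \<forall>x\<in>K. \<forall>\<alpha>. 1 \<le> mi_order \<alpha> \<and> mi_order \<alpha> \<le> k \<longrightarrow>
               \<bar>f\<^sub>\<alpha> \<alpha> x - mi_deriv \<alpha> (v \<delta>) x\<bar> \<le> C * \<delta>^(r - mi_order \<alpha>) * \<omega> \<delta>"
      by (intro exI[of _ Q] exI[of _ "\<lambda>\<alpha>. F (lst \<alpha>)"]) blast
  qed
qed

lemma iter_deriv_bounded_on_compact:
  assumes "Ck_on (k + 2) u U" "length l = k + 1" "compact P" "P \<subseteq> U"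
  shows "\<exists>T\<ge>0. \<forall>y\<in>P. \<bar>iter_deriv l u y\<bar> \<le> T"
proof -
  have "continuous_on U (iter_deriv l u)" using Ck_on_iter_deriv_le[OF assms(1), of 0 l] assms(2) by simp
  then have "bounded (iter_deriv l u ` P)"
    using assms(3,4) by (intro compact_imp_bounded compact_continuous_image) (rule continuous_on_subset)
  then show ?thesis unfolding bounded_pos by (auto intro: less_imp_le)
qed

theorem theorem1p3:
  fixes K \<Omega> :: "(real^'n::finite) set"
    and a :: "real^'n \<Rightarrow> real^'n^'n"
    and \<omega> :: "real \<Rightarrow> real"
    and r k\<^sub>0 :: nat
    and f :: "real^'n \<Rightarrow> real"
    and v :: "real \<Rightarrow> real^'n \<Rightarrow> real"
    and S :: "real set"
  assumes "CARD('n) \<ge> 3"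
    and "compact K"
    and "AD_regular (real CARD('n) - 2) K"
    and "modulus_of_continuity \<omega>"
    and "modulus_integral_condition \<omega>"
    and "r \<ge> 1"
    and "k\<^sub>0 \<le> r"
    and "open \<Omega>" "bounded \<Omega>" "connected \<Omega>" "K \<subseteq> \<Omega>"
    and "elliptic_operator (k\<^sub>0 + 3) a \<Omega>"
    and "f \<in> H_class a \<Omega> r \<omega> K"
    and "scale_range r \<omega> K v S"
    and "approximating_family a \<Omega> r \<omega> K f S v"
  shows "(\<exists>c. \<forall>\<delta>\<in>S. Ck_on (k\<^sub>0 + 1) (v \<delta>) (nbhd K \<delta>) \<and>
             nabla_sup_norm (k\<^sub>0 + 1) (nbhd K (\<delta>/2)) (v \<delta>) \<le> ereal (c * \<omega> \<delta> / \<delta>)) \<and>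
         (\<exists>C. \<exists>f\<^sub>\<alpha> :: ('n \<Rightarrow> nat) \<Rightarrow> real^'n \<Rightarrow> real.
             \<forall>\<delta>\<in>S. \<forall>x\<in>K. \<forall>\<alpha>. 1 \<le> mi_order \<alpha> \<and> mi_order \<alpha> \<le> k\<^sub>0 \<longrightarrow>
               \<bar>f\<^sub>\<alpha> \<alpha> x - mi_deriv \<alpha> (v \<delta>) x\<bar> \<le> C * \<delta>^(r - mi_order \<alpha>) * \<omega> \<delta>)"
proof (cases "S = {}")
  case True
  then show ?thesis by simp
next
  case False
  define d where "d = diameter K"
  have d: "0 < d"
    using assms(14) False by (auto simp: scale_range_def d_def)
  have Kne: "K \<noteq> {}" using d by (auto simp: d_def)
  have ell': "elliptic_operator (Suc (k\<^sub>0 + 2)) a \<Omega>" using assms(12) by (simp add: eval_nat_numeral)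
  obtain c0 where sol: "\<And>\<delta>. \<delta> \<in> S \<Longrightarrow> L_solution a \<Omega> (nbhd K \<delta>) (v \<delta>)"
    and c0: "\<And>\<delta> y. \<delta> \<in> S \<Longrightarrow> y \<in> nbhd K (\<delta>/2) \<Longrightarrow> \<bar>v \<delta> y - v (\<delta>/2) y\<bar> \<le> c0 * \<delta>^r * \<omega> \<delta>"
    using assms(15) unfolding approximating_family_def by blast
  have reg: "Ck_on (k\<^sub>0 + 2) (v \<delta>) (nbhd K \<delta>)" if "\<delta> \<in> S" for \<delta>
    using sol[OF that] unfolding L_solution_def by (intro interior_regularity[OF assms(8) ell' open_nbhd]) auto
  \<comment> \<open>\<open>L_solution\<close> contains the inclusion of its domain in
    \<open>\<Omega>\<close>, so any scale above q puts the closed q-neighbourhood inside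
    \<open>\<Omega>\<close>.\<close>
  have sub\<Omega>: "{x. infdist x K \<le> q} \<subseteq> \<Omega>" if "\<delta> \<in> S" "q < \<delta>" for q \<delta>
    using infdist_subset_nbhd[OF assms(2) Kne that(2)] sol[OF that(1)] unfolding L_solution_def by blast
  have cpt: "compact {x. infdist x K \<le> q}" if "0 < q" for q
    using compact_infdist_le[OF Kne assms(2) that] .
  have pos: "0 < \<omega> t" if "0 < t" for t using assms(4) that by (simp add: modulus_of_continuity_def)
  have mono: "\<omega> s \<le> \<omega> t" if "0 < s" "s \<le> t" for s t
    using assms(4) that mono_onD[of "{0<..}" \<omega> s t] by (simp add: modulus_of_continuity_def)
  have abs_le: "b * s ^ r * \<omega> s \<le> \<bar>b\<bar> * s ^ r * \<omega> s" if "0 < s" for b s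
    using that pos[OF that] by (intro mult_right_mono) auto
  consider (dyadic) \<delta>\<^sub>0 where "0 < \<delta>\<^sub>0" "S = range (\<lambda>n. \<delta>\<^sub>0 / 2^n)"
    | (all) "S = {0<..<d / 4}" "comparable_scales r \<omega> K v"
    using assms(14) unfolding scale_range_def d_def by blast
  then show ?thesis
  proof cases
    case dyadic
    have mem: "\<delta>\<^sub>0 / 2 ^ n \<in> S" for n using dyadic(2) by auto
    have top_mem: "\<delta>\<^sub>0 \<in> S" using mem[of 0] by simp
    note P = cpt[of "\<delta>\<^sub>0 / 2"] sub\<Omega>[OF top_mem, of "\<delta>\<^sub>0 / 2"]
    show ?thesis
    \<comment> \<open>No larger scale is at hand, so the closed
      \<open>\<delta>\<^sub>0\<close>-neighbourhood may leave \<open>\<Omega>\<close>. Therefore q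
      and the reference sequence start at \<open>\<delta>\<^sub>0 / 2\<close>, and
      \<open>\<delta>\<^sub>0\<close> is compared with it by the defining condition of the
      family.\<close>
    proof (rule theorem_along_scales[OF assms(2,4,5,7,8,12,15), where q = "\<delta>\<^sub>0 / 2" and \<tau>\<^sub>0 = \<delta>\<^sub>0 and D = \<delta>\<^sub>0 and \<tau> = "\<delta>\<^sub>0 / 2" and c\<^sub>1 = "\<bar>c0\<bar>"])
      fix \<delta> assume "\<delta> \<in> S"
      then obtain n where n: "\<delta> = \<delta>\<^sub>0 / 2 ^ n" using dyadic(2) by auto
      show "0 < \<delta>" using n dyadic(1) by simp
      show "\<delta> / 2 \<in> S" using mem[of "Suc n"] n by (simp add: mult.commute)
      have eq: "\<delta> * 2 ^ j = \<delta>\<^sub>0 / 2 ^ (n - j)" if "j \<le> n" for j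
        using that by (simp add: n power_diff)
      have le: "\<delta> * 2 ^ j \<le> \<delta>\<^sub>0 / 2" if "j < n" for j
      proof -
        have "\<delta>\<^sub>0 / 2 ^ (n - j) \<le> \<delta>\<^sub>0 / 2 ^ 1" using that dyadic(1) by (intro divide_left_mono power_increasing) auto
        then show ?thesis using eq[of j] that by simp
      qed
      show "\<exists>J. (\<forall>j\<le>J. \<delta> * 2 ^ j \<in> S) \<and> (\<forall>j<J. \<delta> * 2 ^ j \<le> \<delta>\<^sub>0 / 2) \<and> \<delta>\<^sub>0 \<le> \<delta> * 2 ^ J \<and> \<delta> * 2 ^ J \<le> \<delta>\<^sub>0"
        by (intro exI[of _ n]) (use eq mem le in auto)
      show "\<exists>m. \<delta>\<^sub>0 / 2 / 2 ^ m \<le> \<delta> \<and> \<delta> \<le> 2 * (\<delta>\<^sub>0 / 2 / 2 ^ m) \<and>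
          (\<forall>y\<in>nbhd K (\<delta>\<^sub>0 / 2 / 2 ^ m). \<bar>v \<delta> y - v (\<delta>\<^sub>0 / 2 / 2 ^ m) y\<bar> \<le> \<bar>c0\<bar> * \<delta> ^ r * \<omega> \<delta>)"
      proof (cases n)
        case 0
        have "\<bar>v \<delta>\<^sub>0 y - v (\<delta>\<^sub>0 / 2) y\<bar> \<le> \<bar>c0\<bar> * \<delta>\<^sub>0 ^ r * \<omega> \<delta>\<^sub>0" if "y \<in> nbhd K (\<delta>\<^sub>0 / 2)" for y
          using c0[OF top_mem that] abs_le[OF dyadic(1), of c0] by linarith
        then show ?thesis using 0 n dyadic(1) by (intro exI[of _ 0]) auto
      next
        case (Suc m)
        then have "\<delta>\<^sub>0 / 2 / 2 ^ m = \<delta>" using n by simp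
        then show ?thesis using \<open>0 < \<delta>\<close> pos[OF \<open>0 < \<delta>\<close>] by (intro exI[of _ m]) simp
      qed
    next
      fix l :: "'n list" assume l: "length l = k\<^sub>0 + 1"
      obtain T where T: "0 \<le> T" "\<And>y. y \<in> {x. infdist x K \<le> \<delta>\<^sub>0 / 2} \<Longrightarrow> \<bar>iter_deriv l (v \<delta>\<^sub>0) y\<bar> \<le> T"
        using iter_deriv_bounded_on_compact[OF reg[OF top_mem] l P(1) infdist_subset_nbhd[OF assms(2) Kne]] dyadic(1) by auto
      \<comment> \<open>The top range consists of the single scale \<open>\<delta>\<^sub>0\<close>,
        so compactness alone yields T.\<close>
      have "\<sigma> = \<delta>\<^sub>0" if \<sigma>: "\<sigma> \<in> S" "\<delta>\<^sub>0 \<le> \<sigma>" for \<sigma>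
      proof -
        obtain n where n: "\<sigma> = \<delta>\<^sub>0 / 2 ^ n" using \<sigma>(1) dyadic(2) by auto
        have "\<delta>\<^sub>0 / 2 ^ n \<le> \<delta>\<^sub>0 / 1" using dyadic(1) by (intro divide_left_mono) auto
        then show ?thesis using \<sigma>(2) n by simp
      qed
      then show "\<exists>T\<ge>0. \<forall>\<sigma>\<in>S. \<delta>\<^sub>0 \<le> \<sigma> \<longrightarrow> (\<forall>y\<in>nbhd K (\<sigma>/2). \<bar>iter_deriv l (v \<sigma>) y\<bar> \<le> T)"
        using T nbhd_subset_infdist[of K "\<delta>\<^sub>0 / 2"] by (intro exI[of _ T]) blast
    next
      fix n show "\<delta>\<^sub>0 / 2 / 2 ^ n \<in> S" using mem[of "Suc n"] by simp
    qed (use P dyadic(1) in auto)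
  next
    case all
    obtain c1 where c1: "\<And>\<delta> \<delta>' y. 0 < \<delta> \<Longrightarrow> \<delta> < d / 4 \<Longrightarrow> \<delta>/2 \<le> \<delta>' \<Longrightarrow> \<delta>' \<le> \<delta> \<Longrightarrow>
        y \<in> nbhd K \<delta>' \<Longrightarrow> \<bar>v \<delta> y - v \<delta>' y\<bar> \<le> c1 * \<delta>^r * \<omega> \<delta>"
      using all(2) unfolding comparable_scales_def d_def by blast
    \<comment> \<open>The value d / 8 + d / 16: a ball of radius d / 16 about a point of the
      d/8-neighbourhood stays in the s-neighbourhood. Moreover s is within a factor 2 of every scale
      of the top range from d / 8 to d / 4.\<close>
    define s where "s = 3 * d / 16"
    have s: "0 < s" "s < d / 4" "s \<in> S" using d by (auto simp: s_def all(1))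
    \<comment> \<open>Any scale strictly between s and d / 4 would do; it places the closed
      s-neighbourhood inside \<open>\<Omega>\<close>.\<close>
    have "7 * d / 32 \<in> S" "s < 7 * d / 32" using d by (auto simp: s_def all(1))
    note P = cpt[OF s(1)] sub\<Omega>[OF this]
    have cmp: "\<bar>v \<delta> y - v \<delta>' y\<bar> \<le> \<bar>c1\<bar> * \<delta>^r * \<omega> \<delta>"
      if "0 < \<delta>" "\<delta> < d / 4" "\<delta>/2 \<le> \<delta>'" "\<delta>' \<le> \<delta>" "y \<in> nbhd K \<delta>'" for \<delta> \<delta>' y
      using c1[OF that] abs_le[OF that(1), of c1] by linarith
    show ?thesis
    proof (rule theorem_along_scales[OF assms(2,4,5,7,8,12,15), where q = s and \<tau>\<^sub>0 = "d / 8" and D = "d / 4" and \<tau> = s and c\<^sub>1 = "\<bar>c1\<bar>"])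
      fix \<delta> assume "\<delta> \<in> S"
      then have \<delta>: "0 < \<delta>" "\<delta> < d / 4" by (auto simp: all(1))
      show "0 < \<delta>" by (rule \<delta>(1))
      show "\<delta> / 2 \<in> S" using \<delta> by (auto simp: all(1))
      obtain N where "d / 8 / \<delta> < 2 ^ N" using real_arch_pow[of 2 "d / 8 / \<delta>"] by auto
      then have N: "d / 8 \<le> \<delta> * 2 ^ N" using \<delta>(1) by (simp add: field_simps)
      \<comment> \<open>The first doubling to reach d / 8: the scale before it is below d / 8, so
        this one is still below d / 4.\<close>
      define J where "J = (LEAST j. d / 8 \<le> \<delta> * 2 ^ j)"
      have J: "d / 8 \<le> \<delta> * 2 ^ J" unfolding J_def by (rule LeastI[of _ N]) (rule N)
      have less: "\<delta> * 2 ^ j < d / 8" if "j < J" for j using not_less_Least[of j "\<lambda>j. d / 8 \<le> \<delta> * 2 ^ j"] that by (simp add: J_def)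
      have less': "\<delta> * 2 ^ j < d / 4" if "j \<le> J" for j
      proof (cases j)
        case 0
        then show ?thesis using \<delta> by simp
      next
        case (Suc i)
        then have "\<delta> * 2 ^ i < d / 8" using that by (intro less) simp
        then show ?thesis using Suc by simp
      qed
      show "\<exists>J. (\<forall>j\<le>J. \<delta> * 2 ^ j \<in> S) \<and> (\<forall>j<J. \<delta> * 2 ^ j \<le> s) \<and> d / 8 \<le> \<delta> * 2 ^ J \<and> \<delta> * 2 ^ J \<le> d / 4"
      proof (intro exI[of _ J] conjI allI impI)
        show "\<delta> * 2 ^ j \<in> S" if "j \<le> J" for j using less'[OF that] \<delta>(1) by (simp add: all(1))
        show "\<delta> * 2 ^ j \<le> s" if "j < J" for j using less[OF that] d by (simp add: s_def)
        show "\<delta> * 2 ^ J \<le> d / 4" using less'[of J] by simp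
      qed (rule J)
      have "\<delta> \<le> 2 * s" using \<delta> d by (simp add: s_def)
      then obtain n where n: "s / 2 ^ n \<le> \<delta>" "\<delta> \<le> 2 * (s / 2 ^ n)" using exists_dyadic_scale[OF \<delta>(1) _ s(1)] by blast
      then show "\<exists>n. s / 2 ^ n \<le> \<delta> \<and> \<delta> \<le> 2 * (s / 2 ^ n) \<and>
          (\<forall>y\<in>nbhd K (s / 2 ^ n). \<bar>v \<delta> y - v (s / 2 ^ n) y\<bar> \<le> \<bar>c1\<bar> * \<delta> ^ r * \<omega> \<delta>)"
        by (intro exI[of _ n] conjI ballI cmp \<delta>) linarith+
    next
      fix l :: "'n list" assume l: "length l = k\<^sub>0 + 1"
      obtain T where T: "0 \<le> T" "\<And>y. y \<in> {x. infdist x K \<le> d / 8} \<Longrightarrow> \<bar>iter_deriv l (v s) y\<bar> \<le> T"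
        using iter_deriv_bounded_on_compact[OF reg[OF s(3)] l cpt[of "d / 8"] infdist_subset_nbhd[OF assms(2) Kne]] d
        by (auto simp: s_def)
      obtain C where C: "0 \<le> C" and est: "difference_estimate a \<Omega> {x. infdist x K \<le> s} d (k\<^sub>0 + 1) C"
        using L_solution_difference_estimate[OF assms(8,12) P, of d] by blast
      define B where "B = \<bar>c1\<bar> * (d / 4) ^ r * \<omega> (d / 4)"
      have B0: "0 \<le> B" using d pos[of "d / 4"] by (simp add: B_def)
      have B: "\<bar>c1\<bar> * t ^ r * \<omega> t \<le> B" if "0 < t" "t \<le> d / 4" for t
        unfolding B_def using that mono[OF that] pos[OF that(1)] by (intro mult_mono power_mono) auto
      \<comment> \<open>The top range contains infinitely many scales here, so
        \<open>v \<sigma>\<close> is bounded through its difference from the single function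
        \<open>v s\<close>; whichever of the two scales is the larger,
        \<open>comparable_scales\<close> applies to the pair.\<close>
      have bound: "\<bar>iter_deriv l (v \<sigma>) y\<bar> \<le> C * B / (d / 16) ^ length l + T"
        if \<sigma>: "\<sigma> \<in> S" "d / 8 \<le> \<sigma>" and y: "y \<in> nbhd K (\<sigma>/2)" for \<sigma> y
      proof -
        have \<sigma>': "0 < \<sigma>" "\<sigma> < d / 4" using \<sigma>(1) by (auto simp: all(1))
        have y8: "y \<in> nbhd K (d / 8)" using y nbhd_mono[of "\<sigma>/2" "d / 8" K] \<sigma>' by auto
        have b1: "ball y (d / 16) \<subseteq> nbhd K s" by (rule ball_subset_nbhd[OF y8]) (simp add: s_def)
        have b2: "ball y (d / 16) \<subseteq> nbhd K \<sigma>" by (rule ball_subset_nbhd[OF y]) (use \<sigma>(2) in simp)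
        have "\<bar>v \<sigma> z - v s z\<bar> \<le> B" if z: "z \<in> ball y (d / 16)" for z
        proof (cases "\<sigma> \<le> s")
          case True
          have "\<bar>v s z - v \<sigma> z\<bar> \<le> \<bar>c1\<bar> * s ^ r * \<omega> s"
            using subsetD[OF b2 z] True \<sigma>(2) s(1,2) by (intro cmp) (auto simp: s_def)
          then show ?thesis using B[OF s(1)] s(2) by (simp add: abs_minus_commute)
        next
          case False
          have "\<bar>v \<sigma> z - v s z\<bar> \<le> \<bar>c1\<bar> * \<sigma> ^ r * \<omega> \<sigma>"
            using subsetD[OF b1 z] False \<sigma>' by (intro cmp) (auto simp: s_def)
          then show ?thesis using B[OF \<sigma>'(1)] \<sigma>'(2) by simp
        qed
        then have "\<bar>iter_deriv l (v \<sigma>) y - iter_deriv l (v s) y\<bar> * (d / 16) ^ length l \<le> C * B"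
          using d b1 nbhd_subset_infdist[of K s] l by (intro difference_estimateD[OF est _ _ _ b2 b1 sol[OF \<sigma>(1)] sol[OF s(3)]]) auto
        then have "\<bar>iter_deriv l (v \<sigma>) y - iter_deriv l (v s) y\<bar> \<le> C * B / (d / 16) ^ length l"
          using d by (subst pos_le_divide_eq) auto
        moreover have "\<bar>iter_deriv l (v s) y\<bar> \<le> T" using y8 nbhd_subset_infdist[of K "d / 8"] by (intro T(2)) auto
        ultimately show ?thesis by linarith
      qed
      have "0 \<le> C * B / (d / 16) ^ length l + T" using C B0 T(1) d by simp
      then show "\<exists>T\<ge>0. \<forall>\<sigma>\<in>S. d / 8 \<le> \<sigma> \<longrightarrow> (\<forall>y\<in>nbhd K (\<sigma>/2). \<bar>iter_deriv l (v \<sigma>) y\<bar> \<le> T)"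
        using bound by blast
    next
      fix n
      have "s / 2 ^ n \<le> s / 1" using s(1) by (intro divide_left_mono) auto
      then have "s / 2 ^ n < d / 4" using s(2) by linarith
      moreover have "0 < s / 2 ^ n" using s(1) by simp
      ultimately show "s / 2 ^ n \<in> S" unfolding all(1) by simp
    qed (use P s d in auto)
  qed
qed

end
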